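(* Let $f:(\mathbb K^n,0)\to(\mathbb K^p,0)$ be a smooth map-germ and let $G_{\Omega_q}$ ($q=n$ or $p$) be one of the volume preserving subgroups $\mathcal A_{\Omega_n},\mathcal A_{\Omega_p},\mathcal K_{\Omega_n},\mathcal K_{\Omega_p},\mathcal R_{\Omega_n},\mathcal L_{\Omega_p},\mathcal C_{\Omega_p}$ of the corresponding Mather group $G$. Let $\mathrm{div}$ be the divergence map on the $q$-component of $LG$, with values in $C_r$, where $r=n$ for $\mathcal K_{\Omega_p}$ and $\mathcal C_{\Omega_p}$ and $r=q$ in all other cases. Then there is an isomorphism (of $\mathbb K$-vector spaces) $$\mathcal M(G_{\Omega_q},f):=\frac{LG\cdot f}{LG_{\Omega_q}\cdot f}\;\cong\;\frac{C_r}{\mathrm{div}(LG_f^q)} .$$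
   Context: $\mathbb K=\mathbb C$ or $\mathbb R$; "smooth" means complex-analytic if $\mathbb K=\mathbb C$, and $C^\infty$ or real-analytic if $\mathbb K=\mathbb R$. $C_m$ is the ring of smooth function germs on $(\mathbb K^m,0)$ with maximal ideal $\mathcal M_m$; $\theta_m$ is the $C_m$-module of vector field germs on $(\mathbb K^m,0)$; $\theta_f$ is the $C_n$-module of vector field germs along $f$ (identified with $C_n^p$). Put $tf(a)=df(a)$ for $a\in\theta_n$ and $\omega f(b)=b\circ f$ for $b\in\theta_p$. Mather groups: $\mathcal R=\mathrm{Diff}(\mathbb K^n,0)$, $\mathcal L=\mathrm{Diff}(\mathbb K^p,0)$, $\mathcal A=\mathcal R\times\mathcal L$, $\mathcal C=GL_p(C_n)$ acting on $f$ by matrix multiplication, $\mathcal K=\mathcal R\cdot\mathcal C$ (semi-direct product). Lie algebras: $L\mathcal A=\mathcal M_n\theta_n\oplus\mathcal M_p\theta_p$ and $L\mathcal K=\mathcal M_n\theta_n\oplus gl_p(C_n)$; $\mathcal R,\mathcal L$ are regarded as subgroups of $\mathcal A$ and $\mathcal C$ as a subgroup of $\mathcal K$, with the other factor trivial. The differential of the orbit map is $\gamma_f:LG\to LG\cdot f\subset\mathcal M_n\theta_f$, given by $(a,b)\mapsto tf(a)-\omega f(b)$ for subgroups of $\mathcal A$ and $(a,B)\mapsto tf(a)-B\cdot f$ for subgroups of $\mathcal K$. $LG\cdot f$ is its image, $LG_f$ its kernel, and $LG_f^q$ is the projection of $LG_f$ onto the source factor ($q=n$) or target factor ($q=p$).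 Given a volume form $\Omega_q$ on $(\mathbb K^q,0)$, the divergence of a vector field $X$ is $\mathrm{div}(X)=d(X\rfloor\Omega_q)/\Omega_q\in C_q$. For the target factor $gl_p(C_n)$ of $L\mathcal K$ and $L\mathcal C$ a matrix $B=(b_{ij})$ is identified with the linear vector field $\sum_i\big(\sum_j b_{ij}(x)y_j\big)\partial/\partial y_i$ with coefficients in $C_n$, and $\mathrm{div}(B)=\mathrm{trace}\,B\in C_n$. $G_{\Omega_q}$ is the subgroup of $G$ whose $q$-factor preserves $\Omega_q$ (for $\mathcal C_{\Omega_p}$: $SL_p(C_n)$, and $\mathcal K_{\Omega_p}=\mathcal R\cdot\mathcal C_{\Omega_p}$); $LG_{\Omega_q}$ consists of the elements of $LG$ whose $q$-component has zero divergence, and $LG_{\Omega_q}\cdot f=\gamma_f(LG_{\Omega_q})$. *)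

theory Defs
  imports "HOL-Analysis.Analysis"
begin

section \<open>Germs at the origin\<close>

quotient_type (overloaded) ('a, 'b) germ =
  "'a::{topological_space, zero} \<Rightarrow> 'b" / "\<lambda>f g. \<forall>\<^sub>F x in nhds 0. f x = g x"
proof (rule equivpI)
  show "reflp (\<lambda>f g::'a \<Rightarrow> 'b. \<forall>\<^sub>F x in nhds 0. f x = g x)"
    by (simp add: reflp_def)
  show "symp (\<lambda>f g::'a \<Rightarrow> 'b. \<forall>\<^sub>F x in nhds 0. f x = g x)"
    by (simp add: symp_def eq_commute)
  show "transp (\<lambda>f g::'a \<Rightarrow> 'b. \<forall>\<^sub>F x in nhds 0. f x = g x)"
    unfolding transp_def by (auto elim: eventually_elim2)
qed

lift_definition germ_map :: "('b \<Rightarrow> 'c) \<Rightarrow> ('a::{topological_space, zero}, 'b) germ \<Rightarrow> ('a, 'c) germ"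
  is "\<lambda>\<phi> f x. \<phi> (f x)"
  by (auto elim: eventually_mono)

lift_definition germ_map2 :: "('b \<Rightarrow> 'c \<Rightarrow> 'd) \<Rightarrow> ('a::{topological_space, zero}, 'b) germ
    \<Rightarrow> ('a, 'c) germ \<Rightarrow> ('a, 'd) germ"
  is "\<lambda>\<phi> f g x. \<phi> (f x) (g x)"
  by (auto elim: eventually_elim2)

lift_definition germ_value :: "('a::{topological_space, zero}, 'b) germ \<Rightarrow> 'b"
  is "\<lambda>f. f 0"
  by (rule eventually_nhds_x_imp_x)

text \<open>Composition of germs; independent of the chosen representatives whenever \<open>f\<close> is
  continuous at the origin and maps the origin to itself.\<close>

definition germ_comp :: "('b::{topological_space, zero}, 'c) germ
    \<Rightarrow> ('a::{topological_space, zero}, 'b) germ \<Rightarrow> ('a, 'c) germ"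
  where "germ_comp b f = abs_germ (rep_germ b \<circ> rep_germ f)"

instantiation germ :: ("{topological_space, zero}", ab_group_add) ab_group_add
begin

lift_definition zero_germ :: "('a, 'b) germ" is "\<lambda>_. 0" .

definition plus_germ :: "('a, 'b) germ \<Rightarrow> ('a, 'b) germ \<Rightarrow> ('a, 'b) germ"
  where "plus_germ = germ_map2 (+)"

definition minus_germ :: "('a, 'b) germ \<Rightarrow> ('a, 'b) germ \<Rightarrow> ('a, 'b) germ"
  where "minus_germ = germ_map2 (-)"

definition uminus_germ :: "('a, 'b) germ \<Rightarrow> ('a, 'b) germ"
  where "uminus_germ = germ_map uminus"

instance
proof
  fix a b c :: "('a, 'b) germ"
  show "a + b + c = a + (b + c)"
    unfolding plus_germ_def by transfer (simp add: algebra_simps)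
  show "a + b = b + a"
    unfolding plus_germ_def by transfer (simp add: algebra_simps)
  show "0 + a = a"
    unfolding plus_germ_def by transfer simp
  show "- a + a = 0"
    unfolding plus_germ_def uminus_germ_def by transfer simp
  show "a - b = a + - b"
    unfolding plus_germ_def uminus_germ_def minus_germ_def by transfer simp
qed

end


section \<open>Smooth germs\<close>

text \<open>\<open>C_infinity\<close> is only meant for real scalars: it is phrased with the real
  Frechet derivative.  \<open>Analytic\<close> means real-analytic over the reals and
  complex-analytic over the complex numbers.\<close>

datatype smoothness = C_infinity | Analytic

primrec Ck_on :: "nat \<Rightarrow> 'a::real_normed_vector set \<Rightarrow> ('a \<Rightarrow> 'b::real_normed_vector) \<Rightarrow> bool"
  where
    "Ck_on 0 U h \<longleftrightarrow> continuous_on U h"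
  | "Ck_on (Suc k) U h \<longleftrightarrow>
      (\<forall>x\<in>U. h differentiable (at x)) \<and> (\<forall>v. Ck_on k U (\<lambda>x. frechet_derivative h (at x) v))"

text \<open>In the analytic case, \<open>\<alpha>\<close> runs over all multi-indices.\<close>

fun smooth_at0 :: "smoothness \<Rightarrow> ('k::real_normed_field ^ 'm \<Rightarrow> 'k) \<Rightarrow> bool"
  where
    "smooth_at0 C_infinity h \<longleftrightarrow> (\<exists>U. open U \<and> 0 \<in> U \<and> (\<forall>k. Ck_on k U h))"
  | "smooth_at0 Analytic h \<longleftrightarrow>
      (\<exists>r>0. \<exists>c :: ('m \<Rightarrow> nat) \<Rightarrow> 'k. \<forall>x. (\<forall>i. norm (x $ i) < r) \<longrightarrow>
        ((\<lambda>\<alpha>. c \<alpha> * (\<Prod>i\<in>UNIV. x $ i ^ \<alpha> i)) has_sum h x) UNIV)"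

definition smooth_germs :: "smoothness \<Rightarrow> ('k::real_normed_field ^ 'm, 'k) germ set"
  where "smooth_germs s = {abs_germ h | h. smooth_at0 s h}"

definition max_ideal :: "smoothness \<Rightarrow> ('k::real_normed_field ^ 'm, 'k) germ set"
  where "max_ideal s = {h \<in> smooth_germs s. germ_value h = 0}"

text \<open>The free module of \<open>'q\<close>-tuples of smooth germs.  It serves as \<open>\<theta>\<^sub>m\<close> (for \<open>'q = 'm\<close>)
  and contains the map-germs.\<close>

definition theta :: "smoothness \<Rightarrow> ('k::real_normed_field ^ 'm, 'k ^ 'q) germ set"
  where "theta s = {abs_germ X | X. \<forall>i. smooth_at0 s (\<lambda>x. X x $ i)}"

definition map_germs :: "smoothness \<Rightarrow> ('k::real_normed_field ^ 'n, 'k ^ 'p) germ set"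
  where "map_germs s = {f \<in> theta s. germ_value f = 0}"

definition gl_germs :: "smoothness \<Rightarrow> ('k::real_normed_field ^ 'n, 'k ^ 'p ^ 'p) germ set"
  where "gl_germs s = {abs_germ B | B. \<forall>i j. smooth_at0 s (\<lambda>x. B x $ i $ j)}"

text \<open>The submodule \<open>\<M> \<theta>\<close>: finite sums of products.\<close>

definition M_theta :: "smoothness \<Rightarrow> ('k::real_normed_field ^ 'm, 'k ^ 'm) germ set"
  where "M_theta s =
    {sum_list (map (\<lambda>(h, X). germ_map2 (*s) h X) hs) | hs. set hs \<subseteq> max_ideal s \<times> theta s}"


section \<open>Differential forms and divergence\<close>

text \<open>The derivative of \<open>h\<close> at \<open>x\<close> in direction \<open>v\<close>, with respect to the scalar field \<open>'k\<close>
  (so a complex derivative over the complex numbers).\<close>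

definition dir_deriv :: "('k::real_normed_field ^ 'm \<Rightarrow> 'k) \<Rightarrow> 'k ^ 'm \<Rightarrow> 'k ^ 'm \<Rightarrow> 'k"
  where "dir_deriv h x v = deriv (\<lambda>t. h (x + t *s v)) 0"

lemma dir_deriv_cong:
  assumes "\<forall>\<^sub>F y in nhds x. f y = g y"
  shows "dir_deriv f x v = dir_deriv g x v"
proof -
  have "((\<lambda>t. x + t *s v) \<longlongrightarrow> x + 0 *s v) (nhds 0)"
    unfolding vector_scalar_mult_def
    by (intro tendsto_intros tendsto_vec_lambda filterlim_ident)
  then have "filterlim (\<lambda>t. x + t *s v) (nhds x) (nhds 0)"
    by simp
  then have "\<forall>\<^sub>F t in nhds 0. f (x + t *s v) = g (x + t *s v)"
    using assms by (rule filterlim_iff[THEN iffD1, rule_format])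
  then show ?thesis
    unfolding dir_deriv_def by (intro deriv_cong_ev refl)
qed

text \<open>A \<open>k\<close>-form assigns to each point an alternating \<open>k\<close>-linear function, represented as a
  function on lists of vectors that vanishes on lists of length other than \<open>k\<close>.\<close>

type_synonym ('k, 'q) form_germ = "('k ^ 'q, ('k ^ 'q) list \<Rightarrow> 'k) germ"

definition alternating_form :: "nat \<Rightarrow> (('k::field ^ 'q) list \<Rightarrow> 'k) \<Rightarrow> bool"
  where "alternating_form k \<omega> \<longleftrightarrow>
    (\<forall>vs. length vs \<noteq> k \<longrightarrow> \<omega> vs = 0) \<and>
    (\<forall>us ws. Vector_Spaces.linear (*s) (*) (\<lambda>v. \<omega> (us @ v # ws))) \<and>
    (\<forall>vs. \<not> distinct vs \<longrightarrow> \<omega> vs = 0)"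

definition volume_forms :: "smoothness \<Rightarrow> ('k::real_normed_field, 'q::finite) form_germ set"
  where "volume_forms s = {abs_germ \<Omega> | \<Omega>.
    (\<forall>x. alternating_form CARD('q) (\<Omega> x)) \<and>
    (\<forall>vs. smooth_at0 s (\<lambda>x. \<Omega> x vs)) \<and>
    (\<exists>vs. \<Omega> 0 vs \<noteq> 0)}"

definition interior_product :: "('k::real_normed_field ^ 'q, 'k ^ 'q) germ
    \<Rightarrow> ('k, 'q) form_germ \<Rightarrow> ('k, 'q) form_germ"
  where "interior_product = germ_map2 (\<lambda>X \<omega> vs. \<omega> (X # vs))"

text \<open>The invariant formula for \<open>d\<omega>\<close> evaluated on constant vector fields, for which the
  terms involving Lie brackets vanish.\<close>

lift_definition ext_deriv :: "('k::real_normed_field, 'q::finite) form_germ \<Rightarrow> ('k, 'q) form_germ"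
  is "\<lambda>\<omega> x vs. \<Sum>i<length vs.
        (-1) ^ i * dir_deriv (\<lambda>y. \<omega> y (take i vs @ drop (Suc i) vs)) x (vs ! i)"
proof -
  fix \<omega> \<omega>' :: "'k ^ 'q \<Rightarrow> ('k ^ 'q) list \<Rightarrow> 'k"
  assume "\<forall>\<^sub>F x in nhds 0. \<omega> x = \<omega>' x"
  then have "\<forall>\<^sub>F x in nhds 0. \<forall>\<^sub>F y in nhds x. \<omega> y = \<omega>' y"
    by (simp add: eventually_eventually)
  then show "\<forall>\<^sub>F x in nhds 0.
      (\<lambda>vs. \<Sum>i<length vs.
        (-1) ^ i * dir_deriv (\<lambda>y. \<omega> y (take i vs @ drop (Suc i) vs)) x (vs ! i)) =
      (\<lambda>vs. \<Sum>i<length vs.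
        (-1) ^ i * dir_deriv (\<lambda>y. \<omega>' y (take i vs @ drop (Suc i) vs)) x (vs ! i))"
    by (rule eventually_mono)
      (auto intro!: ext sum.cong arg_cong[where f = "(*) _"] dir_deriv_cong elim: eventually_mono)
qed

text \<open>\<open>d(X \<rfloor> \<Omega>) / \<Omega>\<close>, the quotient of two forms of top degree.\<close>

definition divergence :: "('k::real_normed_field, 'q::finite) form_germ
    \<Rightarrow> ('k ^ 'q, 'k ^ 'q) germ \<Rightarrow> ('k ^ 'q, 'k) germ"
  where "divergence \<Omega> X =
    (THE g. ext_deriv (interior_product X \<Omega>) = germ_map2 (\<lambda>g \<omega> vs. g * \<omega> vs) g \<Omega>)"


section \<open>Infinitesimal actions of the Mather groups\<close>

lift_definition tf :: "('k::real_normed_field ^ 'n, 'k ^ 'p) germ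
    \<Rightarrow> ('k ^ 'n, 'k ^ 'n) germ \<Rightarrow> ('k ^ 'n, 'k ^ 'p) germ"
  is "\<lambda>f a x. \<chi> i. dir_deriv (\<lambda>y. f y $ i) x (a x)"
proof -
  fix f g :: "'k ^ 'n \<Rightarrow> 'k ^ 'p" and a b :: "'k ^ 'n \<Rightarrow> 'k ^ 'n"
  assume "\<forall>\<^sub>F x in nhds 0. f x = g x" and ab: "\<forall>\<^sub>F x in nhds 0. a x = b x"
  then have "\<forall>\<^sub>F x in nhds 0. \<forall>\<^sub>F y in nhds x. f y = g y"
    by (simp add: eventually_eventually)
  with ab show "\<forall>\<^sub>F x in nhds 0.
      (\<chi> i. dir_deriv (\<lambda>y. f y $ i) x (a x)) = (\<chi> i. dir_deriv (\<lambda>y. g y $ i) x (b x))"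
  proof (rule eventually_elim2)
    fix x assume "a x = b x" and ev: "\<forall>\<^sub>F y in nhds x. f y = g y"
    moreover have "dir_deriv (\<lambda>y. f y $ i) x v = dir_deriv (\<lambda>y. g y $ i) x v" for i v
      using ev by (intro dir_deriv_cong) (auto elim: eventually_mono)
    ultimately show "(\<chi> i. dir_deriv (\<lambda>y. f y $ i) x (a x)) =
        (\<chi> i. dir_deriv (\<lambda>y. g y $ i) x (b x))"
      by simp
  qed
qed

definition gamma_A :: "('k::real_normed_field ^ 'n, 'k ^ 'p) germ
    \<Rightarrow> ('k ^ 'n, 'k ^ 'n) germ \<times> ('k ^ 'p, 'k ^ 'p) germ \<Rightarrow> ('k ^ 'n, 'k ^ 'p) germ"
  where "gamma_A f = (\<lambda>(a, b). tf f a - germ_comp b f)"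

definition gamma_K :: "('k::real_normed_field ^ 'n, 'k ^ 'p) germ
    \<Rightarrow> ('k ^ 'n, 'k ^ 'n) germ \<times> ('k ^ 'n, 'k ^ 'p ^ 'p) germ \<Rightarrow> ('k ^ 'n, 'k ^ 'p) germ"
  where "gamma_K f = (\<lambda>(a, B). tf f a - germ_map2 (*v) B f)"


section \<open>Quotient spaces\<close>

definition coset :: "'v::ab_group_add set \<Rightarrow> 'v \<Rightarrow> 'v set"
  where "coset W v = (+) v ` W"

definition quotient_space :: "'v::ab_group_add set \<Rightarrow> 'v set \<Rightarrow> 'v set set"
  where "quotient_space V W = coset W ` V"

definition coset_add :: "'v::ab_group_add set \<Rightarrow> 'v set \<Rightarrow> 'v set"
  where "coset_add A B = {a + b | a b. a \<in> A \<and> b \<in> B}"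

text \<open>Adding \<open>W\<close> makes the zero scalar multiple of a coset equal to \<open>W\<close> instead of \<open>{0}\<close>.\<close>

definition coset_scale :: "('k \<Rightarrow> 'v \<Rightarrow> 'v) \<Rightarrow> 'v::ab_group_add set \<Rightarrow> 'k \<Rightarrow> 'v set \<Rightarrow> 'v set"
  where "coset_scale sc W c A = {sc c a + w | a w. a \<in> A \<and> w \<in> W}"

text \<open>\<open>V / W\<close> and \<open>V' / W'\<close> are vector spaces (with scalar multiplications induced by \<open>sc\<close>
  and \<open>sc'\<close>), and they are isomorphic.\<close>

definition quotients_isomorphic ::
    "('k::field \<Rightarrow> 'v::ab_group_add \<Rightarrow> 'v) \<Rightarrow> 'v set \<Rightarrow> 'v set \<Rightarrow>
     ('k \<Rightarrow> 'w::ab_group_add \<Rightarrow> 'w) \<Rightarrow> 'w set \<Rightarrow> 'w set \<Rightarrow> bool"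
  where "quotients_isomorphic sc V W sc' V' W' \<longleftrightarrow>
    module.subspace sc V \<and> module.subspace sc W \<and> W \<subseteq> V \<and>
    module.subspace sc' V' \<and> module.subspace sc' W' \<and> W' \<subseteq> V' \<and>
    (\<exists>\<phi>. bij_betw \<phi> (quotient_space V W) (quotient_space V' W') \<and>
      (\<forall>A \<in> quotient_space V W. \<forall>B \<in> quotient_space V W.
        \<phi> (coset_add A B) = coset_add (\<phi> A) (\<phi> B)) \<and>
      (\<forall>c. \<forall>A \<in> quotient_space V W. \<phi> (coset_scale sc W c A) = coset_scale sc' W' c (\<phi> A)))"


section \<open>The volume preserving subgroups\<close>

text \<open>\<open>A_source \<Omega>\<close> stands for \<open>\<A>\<^bsub>\<Omega>\<^esub>\<close> with \<open>\<Omega>\<close> on the source, and so on.  For \<open>\<K>\<close> and \<open>\<C>\<close>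
  with a volume form on the target, the condition is that the trace vanishes, so no form
  needs to be recorded.\<close>

datatype ('a, 'b) volume_subgroup =
    A_source 'a | A_target 'b | K_source 'a | K_target | R_source 'a | L_target 'b | C_target

fun valid_subgroup :: "smoothness \<Rightarrow>
    (('k::real_normed_field, 'n::finite) form_germ, ('k, 'p::finite) form_germ) volume_subgroup \<Rightarrow> bool"
  where
    "valid_subgroup s (A_source \<Omega>) \<longleftrightarrow> \<Omega> \<in> volume_forms s"
  | "valid_subgroup s (A_target \<Omega>) \<longleftrightarrow> \<Omega> \<in> volume_forms s"
  | "valid_subgroup s (K_source \<Omega>) \<longleftrightarrow> \<Omega> \<in> volume_forms s"
  | "valid_subgroup s K_target \<longleftrightarrow> True"
  | "valid_subgroup s (R_source \<Omega>) \<longleftrightarrow> \<Omega> \<in> volume_forms s"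
  | "valid_subgroup s (L_target \<Omega>) \<longleftrightarrow> \<Omega> \<in> volume_forms s"
  | "valid_subgroup s C_target \<longleftrightarrow> True"

text \<open>Here \<open>\<gamma>\<close> is the differential of the orbit map, \<open>L\<close> the Lie algebra \<open>LG\<close>, \<open>\<pi>\<close> the projection
  to the \<open>q\<close>-component, \<open>dv\<close> the divergence there, and \<open>C\<close> the ring \<open>C\<^sub>r\<close>.  The two quotients are
  \<open>LG\<cdot>f / LG\<^sub>\<Omega>\<cdot>f\<close> and \<open>C\<^sub>r / div(LG\<^sub>f\<^sup>q)\<close>.\<close>

definition moduli_iso :: "('l \<Rightarrow> ('k::real_normed_field ^ 'n, 'k ^ 'p) germ) \<Rightarrow> 'l set
    \<Rightarrow> ('l \<Rightarrow> 'c) \<Rightarrow> ('c \<Rightarrow> ('k ^ 'r, 'k) germ) \<Rightarrow> ('k ^ 'r, 'k) germ set \<Rightarrow> bool"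
  where "moduli_iso \<gamma> L \<pi> dv C \<longleftrightarrow>
    quotients_isomorphic
      (\<lambda>c. germ_map ((*s) c)) (\<gamma> ` L) (\<gamma> ` {z \<in> L. dv (\<pi> z) = 0})
      (\<lambda>c. germ_map ((*) c)) C (dv ` \<pi> ` {z \<in> L. \<gamma> z = 0})"

fun moduli_space_iso :: "smoothness
    \<Rightarrow> (('k::real_normed_field, 'n::finite) form_germ, ('k, 'p::finite) form_germ) volume_subgroup
    \<Rightarrow> ('k ^ 'n, 'k ^ 'p) germ \<Rightarrow> bool"
  where
    "moduli_space_iso s (A_source \<Omega>) f \<longleftrightarrow>
      moduli_iso (gamma_A f) (M_theta s \<times> M_theta s) fst (divergence \<Omega>) (smooth_germs s)"
  | "moduli_space_iso s (A_target \<Omega>) f \<longleftrightarrow>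
      moduli_iso (gamma_A f) (M_theta s \<times> M_theta s) snd (divergence \<Omega>) (smooth_germs s)"
  | "moduli_space_iso s (K_source \<Omega>) f \<longleftrightarrow>
      moduli_iso (gamma_K f) (M_theta s \<times> gl_germs s) fst (divergence \<Omega>) (smooth_germs s)"
  | "moduli_space_iso s K_target f \<longleftrightarrow>
      moduli_iso (gamma_K f) (M_theta s \<times> gl_germs s) snd (germ_map trace) (smooth_germs s)"
  | "moduli_space_iso s (R_source \<Omega>) f \<longleftrightarrow>
      moduli_iso (gamma_A f) (M_theta s \<times> {0}) fst (divergence \<Omega>) (smooth_germs s)"
  | "moduli_space_iso s (L_target \<Omega>) f \<longleftrightarrow>
      moduli_iso (gamma_A f) ({0} \<times> M_theta s) snd (divergence \<Omega>) (smooth_germs s)"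
  | "moduli_space_iso s C_target f \<longleftrightarrow>
      moduli_iso (gamma_K f) ({0} \<times> gl_germs s) snd (germ_map trace) (smooth_germs s)"

end

theory Submission
  imports Defs
begin

text \<open>
  The isomorphism is linear algebra as soon as two facts about the divergence are known.
  Write \<open>\<gamma>\<close> for the differential of the orbit map and \<open>\<delta>\<close> for the divergence of the
  \<open>q\<close>-component, both as linear maps on the Lie algebra \<open>L\<close>.  If \<open>\<delta>\<close> maps \<open>L\<close> onto \<open>C\<close>, then
  both quotients are \<open>L / (ker \<gamma> + ker \<delta>)\<close>:
  \<open>\<gamma>(L) / \<gamma>(ker \<delta>) \<cong> L / (ker \<gamma> + ker \<delta>) \<cong> \<delta>(L) / \<delta>(ker \<gamma>)\<close>.  This is
  \<open>quotients_isomorphic_of_linear_pair\<close>; it remains to see that \<open>\<delta>\<close> is linear with smooth values and onto.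

  For the groups with a trace condition this is immediate, since every smooth germ is the trace of a
  matrix with a single non-zero entry.  For the others, a volume form is a density \<open>\<omega>\<close> times
  a constant alternating form (\<open>volume_form_density\<close>), and the divergence of \<open>X\<close> becomes
  \<open>(\<Sum>j. \<partial>\<^sub>j (\<omega> X\<^sub>j)) / \<omega>\<close> (\<open>divergence_formula\<close>).  The algebra behind this formula is that the wedge
  product of a 1-form with a form of top degree vanishes (\<open>wedge_top_form_eq_0\<close>).  To reach a given
  germ \<open>g\<close>, integrate \<open>\<omega> g\<close> in one coordinate \<open>x\<^sub>i\<close> from \<open>0\<close> to get \<open>H\<close> with \<open>\<partial>\<^sub>i H = \<omega> g\<close> and
  \<open>H 0 = 0\<close>; the field \<open>(H / \<omega>) \<partial>/\<partial>x\<^sub>i\<close> lies in \<open>\<M> \<theta>\<close> and has divergence \<open>g\<close>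
  (\<open>divergence_onto\<close>).

  What this uses of smoothness is collected in the locale \<open>smooth_calculus\<close>: smooth germs form a
  ring in which germs not vanishing at the origin are invertible, and they can be differentiated and
  integrated coordinatewise.  For \<open>C_infinity\<close> the coordinate integral is \<open>x\<^sub>i \<integral>\<^sub>0\<^sup>1 h(\<dots>, t x\<^sub>i, \<dots>) dt\<close>, smooth by
  differentiation under the integral.  For \<open>Analytic\<close> everything is read off the coefficients: a
  power series converges near the origin iff its coefficients are bounded by \<open>M R\<^sup>|\<^sup>\<alpha>\<^sup>|\<close>, and the
  operations preserve bounds of this kind.
\<close>

section \<open>Quotients determined by a pair of linear maps\<close>

lemma subspace_kernel_on:
  assumes "module sl" "module sw" "module.subspace sl L"
    and add: "\<And>x y. x \<in> L \<Longrightarrow> y \<in> L \<Longrightarrow> \<delta> (x + y) = \<delta> x + \<delta> y"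
    and scale: "\<And>c x. x \<in> L \<Longrightarrow> \<delta> (sl c x) = sw c (\<delta> x)"
  shows "module.subspace sl {z \<in> L. \<delta> z = 0}"
proof -
  interpret l: module sl by fact
  interpret w: module sw by fact
  have "\<delta> 0 = 0"
    using scale[of 0 0] l.subspace_0[OF assms(3)] by simp
  with assms(3) show ?thesis
    by (auto simp: l.subspace_def add scale)
qed

lemma subspace_image_on:
  assumes "module sl" "module sv" "module.subspace sl L"
    and add: "\<And>x y. x \<in> L \<Longrightarrow> y \<in> L \<Longrightarrow> \<gamma> (x + y) = \<gamma> x + \<gamma> y"
    and scale: "\<And>c x. x \<in> L \<Longrightarrow> \<gamma> (sl c x) = sv c (\<gamma> x)"
  shows "module.subspace sv (\<gamma> ` L)"
proof -
  interpret l: module sl by fact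
  interpret v: module sv by fact
  show ?thesis
    unfolding v.subspace_def
  proof (intro conjI ballI allI)
    show "0 \<in> \<gamma> ` L"
      using scale[of 0 0] l.subspace_0[OF assms(3)] by (metis imageI l.scale_zero_left v.scale_zero_left)
    show "a + b \<in> \<gamma> ` L" if "a \<in> \<gamma> ` L" "b \<in> \<gamma> ` L" for a b
      using that l.subspace_add[OF assms(3)] by (auto simp flip: add)
    show "sv c a \<in> \<gamma> ` L" if "a \<in> \<gamma> ` L" for c a
      using that l.subspace_scale[OF assms(3)] by (auto simp flip: scale)
  qed
qed

lemma coset_eq_iff:
  assumes "module sv" "module.subspace sv W"
  shows "coset W a = coset W b \<longleftrightarrow> a - b \<in> W"
proof -
  interpret v: module sv by fact
  note W = assms(2)
  have self: "a \<in> coset W a" for a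
    using v.subspace_0[OF W] by (force simp: coset_def)
  have sub: "coset W a \<subseteq> coset W b" if "a - b \<in> W" for a b
  proof
    fix x assume "x \<in> coset W a"
    then obtain w where w: "w \<in> W" "x = a + w"
      by (auto simp: coset_def)
    then have "x = b + ((a - b) + w)" "(a - b) + w \<in> W"
      using v.subspace_add[OF W that] by auto
    then show "x \<in> coset W b"
      unfolding coset_def by blast
  qed
  show ?thesis
  proof
    assume "coset W a = coset W b"
    then have "a \<in> coset W b"
      using self by blast
    then show "a - b \<in> W"
      by (auto simp: coset_def)
  next
    assume ab: "a - b \<in> W"
    then have "b - a \<in> W"
      using v.subspace_neg[OF W ab] by simp
    with ab show "coset W a = coset W b"
      using sub by blast
  qed
qed

lemma coset_add_coset:
  assumes "module sv" "module.subspace sv W"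
  shows "coset_add (coset W a) (coset W b) = coset W (a + b)"
proof -
  interpret v: module sv by fact
  note W = assms(2)
  show ?thesis
  proof (intro subset_antisym subsetI)
    fix x assume "x \<in> coset_add (coset W a) (coset W b)"
    then obtain w w' where w: "w \<in> W" "w' \<in> W" "x = a + w + (b + w')"
      by (auto simp: coset_add_def coset_def)
    then have "x = (a + b) + (w + w')" "w + w' \<in> W"
      using v.subspace_add[OF W] by (auto simp: algebra_simps)
    then show "x \<in> coset W (a + b)"
      unfolding coset_def by blast
  next
    fix x assume "x \<in> coset W (a + b)"
    then obtain w where w: "w \<in> W" "x = (a + w) + (b + 0)"
      by (auto simp: coset_def algebra_simps)
    with v.subspace_0[OF W] show "x \<in> coset_add (coset W a) (coset W b)"
      unfolding coset_add_def coset_def by blast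
  qed
qed

lemma coset_scale_coset:
  assumes "module sv" "module.subspace sv W"
  shows "coset_scale sv W c (coset W a) = coset W (sv c a)"
proof -
  interpret v: module sv by fact
  note W = assms(2)
  show ?thesis
  proof (intro subset_antisym subsetI)
    fix x assume "x \<in> coset_scale sv W c (coset W a)"
    then obtain w w' where w: "w \<in> W" "w' \<in> W" "x = sv c (a + w) + w'"
      by (auto simp: coset_scale_def coset_def)
    then have "x = sv c a + (sv c w + w')" "sv c w + w' \<in> W"
      using v.subspace_add[OF W] v.subspace_scale[OF W] by (auto simp: v.scale_right_distrib algebra_simps)
    then show "x \<in> coset W (sv c a)"
      unfolding coset_def by blast
  next
    fix x assume "x \<in> coset W (sv c a)"
    then obtain w where w: "w \<in> W" "x = sv c (a + 0) + w"
      by (auto simp: coset_def)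
    with v.subspace_0[OF W] show "x \<in> coset_scale sv W c (coset W a)"
      unfolding coset_scale_def coset_def by blast
  qed
qed

text \<open>The isomorphism sends the coset of \<open>\<gamma> z\<close> to the coset of \<open>\<delta> z\<close>.  It is well defined and injective
  because each of \<open>\<gamma> z \<in> \<gamma>(ker \<delta>)\<close> and \<open>\<delta> z \<in> \<delta>(ker \<gamma>)\<close> says that \<open>z \<in> ker \<gamma> + ker \<delta>\<close>.  Linearity
  is assumed on \<open>L\<close>, where the vector fields are smooth and the divergence is linear.\<close>

lemma quotients_isomorphic_of_linear_pair:
  fixes \<gamma> :: "'l::ab_group_add \<Rightarrow> 'v::ab_group_add" and \<delta> :: "'l \<Rightarrow> 'w::ab_group_add"
    and sl :: "'k::field \<Rightarrow> 'l \<Rightarrow> 'l"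
  assumes m: "module sl" "module sv" "module sw" and L: "module.subspace sl L"
    and \<gamma>_add: "\<And>x y. x \<in> L \<Longrightarrow> y \<in> L \<Longrightarrow> \<gamma> (x + y) = \<gamma> x + \<gamma> y"
    and \<gamma>_scale: "\<And>c x. x \<in> L \<Longrightarrow> \<gamma> (sl c x) = sv c (\<gamma> x)"
    and \<delta>_add: "\<And>x y. x \<in> L \<Longrightarrow> y \<in> L \<Longrightarrow> \<delta> (x + y) = \<delta> x + \<delta> y"
    and \<delta>_scale: "\<And>c x. x \<in> L \<Longrightarrow> \<delta> (sl c x) = sw c (\<delta> x)"
    and onto: "\<delta> ` L = C"
  shows "quotients_isomorphic sv (\<gamma> ` L) (\<gamma> ` {z \<in> L. \<delta> z = 0}) sw C (\<delta> ` {z \<in> L. \<gamma> z = 0})"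
proof -
  interpret l: module sl by fact
  interpret v: module sv by fact
  interpret w: module sw by fact
  define K where "K = {z \<in> L. \<delta> z = 0}"
  define K' where "K' = {z \<in> L. \<gamma> z = 0}"
  define W where "W = \<gamma> ` K"
  define W' where "W' = \<delta> ` K'"
  have K: "l.subspace K"
    unfolding K_def by (rule subspace_kernel_on[where \<delta> = \<delta>, OF m(1,3) L]) (simp_all only: \<delta>_add \<delta>_scale)
  have K': "l.subspace K'"
    unfolding K'_def by (rule subspace_kernel_on[where \<delta> = \<gamma>, OF m(1,2) L]) (simp_all only: \<gamma>_add \<gamma>_scale)
  have KL: "K \<subseteq> L" "K' \<subseteq> L"
    by (auto simp: K_def K'_def)
  have V: "v.subspace (\<gamma> ` L)"
    by (rule subspace_image_on[where \<gamma> = \<gamma>, OF m(1,2) L]) (simp_all only: \<gamma>_add \<gamma>_scale)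
  have C: "w.subspace C"
    unfolding onto[symmetric]
    by (rule subspace_image_on[where \<gamma> = \<delta>, OF m(1,3) L]) (simp_all only: \<delta>_add \<delta>_scale)
  have W: "v.subspace W"
    unfolding W_def
    by (rule subspace_image_on[where \<gamma> = \<gamma>, OF m(1,2) K]) (use KL in \<open>auto intro: \<gamma>_add \<gamma>_scale\<close>)
  have W': "w.subspace W'"
    unfolding W'_def
    by (rule subspace_image_on[where \<gamma> = \<delta>, OF m(1,3) K']) (use KL in \<open>auto intro: \<delta>_add \<delta>_scale\<close>)
  have diff: "x - y \<in> L" "\<gamma> (x - y) = \<gamma> x - \<gamma> y" "\<delta> (x - y) = \<delta> x - \<delta> y" if "x \<in> L" "y \<in> L" for x y
  proof -
    show xy: "x - y \<in> L"
      using l.subspace_diff[OF L that] .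
    show "\<gamma> (x - y) = \<gamma> x - \<gamma> y"
      using \<gamma>_add[OF xy that(2)] by simp
    show "\<delta> (x - y) = \<delta> x - \<delta> y"
      using \<delta>_add[OF xy that(2)] by simp
  qed
  \<comment> \<open>All values of \<open>\<delta>\<close> over the preimage of a coset: this is again a coset, so no representative
      has to be chosen.\<close>
  define \<phi> where "\<phi> A = \<delta> ` {z \<in> L. \<gamma> z \<in> A}" for A
  have \<phi>: "\<phi> (coset W (\<gamma> z)) = coset W' (\<delta> z)" if z: "z \<in> L" for z
  proof (intro subset_antisym subsetI)
    fix d assume "d \<in> \<phi> (coset W (\<gamma> z))"
    then obtain y u where y: "y \<in> L" "d = \<delta> y" and u: "u \<in> K" "\<gamma> y = \<gamma> z + \<gamma> u"
      by (auto simp: \<phi>_def coset_def W_def)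
    have "u \<in> L" "\<delta> u = 0"
      using u by (auto simp: K_def)
    with y u z have "y - z - u \<in> K'" "\<delta> (y - z - u) = \<delta> y - \<delta> z"
      by (auto simp: K'_def diff)
    then have "\<delta> y - \<delta> z \<in> W'"
      unfolding W'_def by (metis imageI)
    then show "d \<in> coset W' (\<delta> z)"
      unfolding coset_def y(2) by (metis imageI add.commute diff_add_cancel)
  next
    fix d assume "d \<in> coset W' (\<delta> z)"
    then obtain u where u: "u \<in> K'" "d = \<delta> z + \<delta> u"
      by (auto simp: coset_def W'_def)
    then have "u \<in> L" "\<gamma> u = 0"
      by (auto simp: K'_def)
    with z u have "z + u \<in> L" "\<gamma> (z + u) = \<gamma> z + 0" "d = \<delta> (z + u)"
      using l.subspace_add[OF L] by (auto simp: \<gamma>_add \<delta>_add)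
    moreover have "\<gamma> z + 0 \<in> coset W (\<gamma> z)"
      unfolding coset_def using v.subspace_0[OF W] by blast
    ultimately show "d \<in> \<phi> (coset W (\<gamma> z))"
      unfolding \<phi>_def by (metis (mono_tags, lifting) imageI mem_Collect_eq)
  qed
  have \<gamma>_eq_iff: "coset W (\<gamma> x) = coset W (\<gamma> y) \<longleftrightarrow> \<gamma> (x - y) \<in> W" if "x \<in> L" "y \<in> L" for x y
    using that by (simp add: coset_eq_iff[OF m(2) W] diff)
  have bij: "bij_betw \<phi> (quotient_space (\<gamma> ` L) W) (quotient_space C W')"
    unfolding bij_betw_def
  proof
    show "inj_on \<phi> (quotient_space (\<gamma> ` L) W)"
    proof (rule inj_onI)
      fix A B assume A: "A \<in> quotient_space (\<gamma> ` L) W" and B: "B \<in> quotient_space (\<gamma> ` L) W"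
        and eq: "\<phi> A = \<phi> B"
      from A obtain x where x: "x \<in> L" "A = coset W (\<gamma> x)"
        by (auto simp: quotient_space_def)
      from B obtain y where y: "y \<in> L" "B = coset W (\<gamma> y)"
        by (auto simp: quotient_space_def)
      have "coset W' (\<delta> x) = coset W' (\<delta> y)"
        using eq x y by (simp add: \<phi>)
      then have "\<delta> x - \<delta> y \<in> W'"
        by (simp add: coset_eq_iff[OF m(3) W'])
      then obtain u where u: "u \<in> L" "\<gamma> u = 0" "\<delta> x - \<delta> y = \<delta> u"
        by (auto simp: W'_def K'_def)
      with x y have "x - y - u \<in> K" "\<gamma> (x - y - u) = \<gamma> (x - y)"
        by (auto simp: K_def diff)
      then have "\<gamma> (x - y) \<in> W"
        unfolding W_def by (metis imageI)
      then show "A = B"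
        using x y by (simp add: \<gamma>_eq_iff)
    qed
    show "\<phi> ` quotient_space (\<gamma> ` L) W = quotient_space C W'"
      unfolding quotient_space_def onto[symmetric] image_image using \<phi> by simp
  qed
  have hom_add: "\<phi> (coset_add A B) = coset_add (\<phi> A) (\<phi> B)"
    if AB: "A \<in> quotient_space (\<gamma> ` L) W" "B \<in> quotient_space (\<gamma> ` L) W" for A B
  proof -
    from AB obtain x y where xy: "x \<in> L" "y \<in> L" "A = coset W (\<gamma> x)" "B = coset W (\<gamma> y)"
      by (auto simp: quotient_space_def)
    then have "coset_add A B = coset W (\<gamma> (x + y))"
      by (simp add: coset_add_coset[OF m(2) W] \<gamma>_add)
    with xy show ?thesis
      by (simp add: coset_add_coset[OF m(3) W'] \<phi> \<delta>_add l.subspace_add[OF L])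
  qed
  have hom_scale: "\<phi> (coset_scale sv W c A) = coset_scale sw W' c (\<phi> A)"
    if A: "A \<in> quotient_space (\<gamma> ` L) W" for c A
  proof -
    from A obtain x where x: "x \<in> L" "A = coset W (\<gamma> x)"
      by (auto simp: quotient_space_def)
    then have "coset_scale sv W c A = coset W (\<gamma> (sl c x))"
      by (simp add: coset_scale_coset[OF m(2) W] \<gamma>_scale)
    with x show ?thesis
      by (simp add: coset_scale_coset[OF m(3) W'] \<phi> \<delta>_scale l.subspace_scale[OF L])
  qed
  have "quotients_isomorphic sv (\<gamma> ` L) W sw C W'"
    unfolding quotients_isomorphic_def
    using V W C W' bij hom_add hom_scale KL onto by (auto simp: W_def W'_def)
  then show ?thesis
    by (simp add: W_def W'_def K_def K'_def)
qed

section \<open>Alternating forms of top degree\<close>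

lemma linear_expand_axis:
  fixes f :: "'k::field ^ 'q::finite \<Rightarrow> 'k"
  assumes "Vector_Spaces.linear (*s) (*) f"
  shows "f w = (\<Sum>i\<in>UNIV. w $ i * f (axis i 1))"
proof -
  interpret Vector_Spaces.linear "(*s)" "(*)" f by fact
  have "f w = f (\<Sum>i\<in>UNIV. w $ i *s axis i 1)"
    by (simp only: basis_expansion)
  then show ?thesis
    by (simp only: sum scale)
qed

lemma alternating_form_expand:
  assumes "alternating_form k \<omega>"
  shows "\<omega> (us @ w # ws) = (\<Sum>i\<in>UNIV. w $ i * \<omega> (us @ axis i 1 # ws))"
  using assms unfolding alternating_form_def by (intro linear_expand_axis) blast

lemma alternating_form_not_distinct: "alternating_form k \<omega> \<Longrightarrow> \<not> distinct vs \<Longrightarrow> \<omega> vs = 0"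
  by (simp add: alternating_form_def)

lemma alternating_form_swap:
  assumes "alternating_form k \<omega>"
  shows "\<omega> (us @ a # b # ws) = - \<omega> (us @ b # a # ws)"
proof -
  have add1: "\<omega> (us @ (x + y) # z # ws) = \<omega> (us @ x # z # ws) + \<omega> (us @ y # z # ws)" for x y z
  proof -
    interpret Vector_Spaces.linear "(*s)" "(*)" "\<lambda>v. \<omega> (us @ v # z # ws)"
      using assms by (simp add: alternating_form_def)
    show ?thesis by (rule add)
  qed
  have add2: "\<omega> (us @ z # (x + y) # ws) = \<omega> (us @ z # x # ws) + \<omega> (us @ z # y # ws)" for x y z
  proof -
    interpret Vector_Spaces.linear "(*s)" "(*)" "\<lambda>v. \<omega> ((us @ [z]) @ v # ws)"
      using assms unfolding alternating_form_def by blast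
    show ?thesis using add[of x y] by simp
  qed
  have eq0: "\<omega> (us @ x # x # ws) = 0" for x
    by (rule alternating_form_not_distinct[OF assms]) simp
  have "0 = \<omega> (us @ (a + b) # (a + b) # ws)"
    by (simp add: eq0)
  also have "\<dots> = \<omega> (us @ a # b # ws) + \<omega> (us @ b # a # ws)"
    by (simp only: add1 add2) (simp add: eq0)
  finally show ?thesis
    by (metis eq_neg_iff_add_eq_0)
qed

lemma alternating_form_move_front:
  assumes "alternating_form k \<omega>"
  shows "\<omega> (us @ a # ws) = (- 1) ^ length us * \<omega> (a # us @ ws)"
proof (induction us arbitrary: ws rule: rev_induct)
  case (snoc x us)
  have "\<omega> ((us @ [x]) @ a # ws) = - \<omega> (us @ a # x # ws)"
    using alternating_form_swap[OF assms, of us x a ws] by simp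
  also have "\<dots> = - ((- 1) ^ length us * \<omega> (a # us @ x # ws))"
    by (simp only: snoc)
  finally show ?case by simp
qed simp

text \<open>Replacing the arguments by coordinate vectors one at a time, from left to right, reduces a
  multilinear identity to coordinate vectors.\<close>

lemma multilinear_eq_0:
  fixes F :: "('k::field ^ 'q::finite) list \<Rightarrow> 'k"
  assumes expand: "\<And>us w ws. length us + Suc (length ws) = m \<Longrightarrow>
      F (us @ w # ws) = (\<Sum>i\<in>UNIV. w $ i * F (us @ axis i 1 # ws))"
    and basis: "\<And>us. length us = m \<Longrightarrow> set us \<subseteq> range (\<lambda>i. axis i 1) \<Longrightarrow> F us = 0"
    and "length vs = m"
  shows "F vs = 0"
proof -
  have "F (us @ ws) = 0" if "set us \<subseteq> range (\<lambda>i. axis i 1)" "length us + length ws = m" for us ws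
    using that
  proof (induction ws arbitrary: us)
    case Nil
    then show ?case by (simp add: basis)
  next
    case (Cons w ws)
    have "F (us @ axis i 1 # ws) = 0" for i
      using Cons.IH[of "us @ [axis i 1]"] Cons.prems by auto
    then show ?case
      using expand[of us ws w] Cons.prems by simp
  qed
  from this[of "[]" vs] assms(3) show ?thesis by simp
qed

text \<open>Deleting entry \<open>j\<close> of a list, according to whether the distinguished entry \<open>w\<close> comes after it, is
  deleted itself, or comes before it.\<close>

lemma nth_take_drop_middle:
  assumes "j < length us + Suc (length ws)"
  obtains "j < length us" "\<And>w. (us @ w # ws) ! j = us ! j"
      "\<And>w. take j (us @ w # ws) @ drop (Suc j) (us @ w # ws) = (take j us @ drop (Suc j) us) @ w # ws"
    | "j = length us" "\<And>w. (us @ w # ws) ! j = w"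
      "\<And>w. take j (us @ w # ws) @ drop (Suc j) (us @ w # ws) = us @ ws"
    | l where "j = length us + Suc l" "l < length ws" "\<And>w. (us @ w # ws) ! j = ws ! l"
      "\<And>w. take j (us @ w # ws) @ drop (Suc j) (us @ w # ws) = us @ w # (take l ws @ drop (Suc l) ws)"
proof -
  consider "j < length us" | "j = length us" | l where "j = length us + Suc l"
    by (metis less_imp_Suc_add linorder_neqE_nat add_Suc_right)
  then show thesis
  proof cases
    case 1
    then show ?thesis by (intro that(1)) (auto simp: nth_append)
  next
    case 2
    then show ?thesis by (intro that(2)) auto
  next
    case 3
    then show ?thesis using assms by (intro that(3)[of l]) (auto simp: nth_append)
  qed
qed

text \<open>The sum is the value of \<open>\<phi> \<and> \<omega>\<close>, a form of degree one more than the dimension.  It is multilinear,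
  and among that many coordinate vectors two coincide; then all but two terms contain a repeated
  argument, and the two remaining ones differ by a sign.\<close>

lemma wedge_top_form_eq_0:
  fixes \<omega> :: "('k::field ^ 'q::finite) list \<Rightarrow> 'k"
  assumes \<omega>: "alternating_form CARD('q) \<omega>" and \<phi>: "\<And>w. \<phi> w = (\<Sum>i\<in>UNIV. w $ i * \<phi> (axis i 1))"
    and len: "length vs = Suc CARD('q)"
  shows "(\<Sum>j<length vs. (- 1) ^ j * (\<phi> (vs ! j) * \<omega> (take j vs @ drop (Suc j) vs))) = 0"
proof -
  define T where "T j vs = (- 1) ^ j * (\<phi> (vs ! j) * \<omega> (take j vs @ drop (Suc j) vs))" for j vs
  have T_expand: "T j (us @ w # ws) = (\<Sum>i\<in>UNIV. w $ i * T j (us @ axis i 1 # ws))"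
    if "j < length us + Suc (length ws)" for j us w ws
    using that
  proof (cases rule: nth_take_drop_middle)
    case 1
    have "T j (us @ w # ws) = (- 1) ^ j * (\<phi> (us ! j) * (\<Sum>i\<in>UNIV. w $ i * \<omega> ((take j us @ drop (Suc j) us) @ axis i 1 # ws)))"
      unfolding T_def 1 by (subst alternating_form_expand[OF \<omega>]) (rule refl)
    also have "\<dots> = (\<Sum>i\<in>UNIV. w $ i * T j (us @ axis i 1 # ws))"
      unfolding T_def 1 sum_distrib_left by (intro sum.cong refl) (simp only: mult_ac)
    finally show ?thesis .
  next
    case 2
    have "T j (us @ w # ws) = (- 1) ^ j * ((\<Sum>i\<in>UNIV. w $ i * \<phi> (axis i 1)) * \<omega> (us @ ws))"
      unfolding T_def 2(2,3) by (subst \<phi>[of w]) (rule refl)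
    also have "\<dots> = (\<Sum>i\<in>UNIV. w $ i * T j (us @ axis i 1 # ws))"
      unfolding T_def 2(2,3) sum_distrib_left sum_distrib_right by (intro sum.cong refl) (simp only: mult_ac)
    finally show ?thesis .
  next
    case (3 l)
    have "T j (us @ w # ws) = (- 1) ^ j * (\<phi> (ws ! l) * (\<Sum>i\<in>UNIV. w $ i * \<omega> (us @ axis i 1 # (take l ws @ drop (Suc l) ws))))"
      unfolding T_def 3(3,4) by (subst alternating_form_expand[OF \<omega>]) (rule refl)
    also have "\<dots> = (\<Sum>i\<in>UNIV. w $ i * T j (us @ axis i 1 # ws))"
      unfolding T_def 3(3,4) sum_distrib_left by (intro sum.cong refl) (simp only: mult_ac)
    finally show ?thesis .
  qed
  have "(\<Sum>j<Suc CARD('q). T j vs) = 0"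
  proof (rule multilinear_eq_0[where F = "\<lambda>vs. \<Sum>j<Suc CARD('q). T j vs", OF _ _ len])
    fix us ws :: "('k ^ 'q) list" and w assume *: "length us + Suc (length ws) = Suc CARD('q)"
    have "(\<Sum>j<Suc CARD('q). T j (us @ w # ws)) = (\<Sum>j<Suc CARD('q). \<Sum>i\<in>UNIV. w $ i * T j (us @ axis i 1 # ws))"
      using * by (intro sum.cong refl T_expand) auto
    also have "\<dots> = (\<Sum>i\<in>UNIV. w $ i * (\<Sum>j<Suc CARD('q). T j (us @ axis i 1 # ws)))"
      unfolding sum_distrib_left by (rule sum.swap)
    finally show "(\<Sum>j<Suc CARD('q). T j (us @ w # ws)) = (\<Sum>i\<in>UNIV. w $ i * (\<Sum>j<Suc CARD('q). T j (us @ axis i 1 # ws)))" .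
  next
    fix us :: "('k ^ 'q) list" assume us: "length us = Suc CARD('q)" "set us \<subseteq> range (\<lambda>i. axis i 1)"
    have "card (set us) \<le> card (range (\<lambda>i. axis i 1 :: 'k ^ 'q))"
      using us(2) by (intro card_mono) auto
    also have "\<dots> \<le> CARD('q)"
      by (rule card_image_le) simp
    finally have "\<not> distinct us"
      using us(1) distinct_card[of us] by auto
    then obtain p x q r where eq: "us = p @ [x] @ q @ [x] @ r"
      using not_distinct_decomp by blast
    then have eq1: "us = p @ x # (q @ x # r)" and eq2: "us = (p @ x # q) @ x # r"
      by auto
    \<comment> \<open>Deleting any entry other than the two copies of \<open>x\<close> leaves both copies in place.\<close>
    let ?a = "length p" and ?b = "length (p @ x # q)"
    have zero: "T j us = 0" if "j < Suc CARD('q)" "j \<noteq> ?a" "j \<noteq> ?b" for j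
    proof -
      have "j < length p + Suc (length (q @ x # r))"
        using that us(1) eq1 by simp
      then have "\<not> distinct (take j us @ drop (Suc j) us)"
      proof (cases rule: nth_take_drop_middle)
        case 1
        show ?thesis unfolding eq1 1 by simp
      next
        case 2
        with that show ?thesis by simp
      next
        case (3 l)
        from 3(2) have "l < length q + Suc (length r)" by simp
        then have "x \<in> set (take l (q @ x # r) @ drop (Suc l) (q @ x # r))"
        proof (cases rule: nth_take_drop_middle)
          case 1
          show ?thesis unfolding 1 by simp
        next
          case 2
          with 3 that show ?thesis by simp
        next
          case (3 l')
          show ?thesis unfolding 3 by simp
        qed
        then show ?thesis unfolding eq1 3 by simp
      qed
      then show ?thesis
        by (simp add: T_def alternating_form_not_distinct[OF \<omega>])
    qed
    have "(\<Sum>j<Suc CARD('q). T j us) = (\<Sum>j\<in>{?a, ?b}. T j us)"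
    proof (intro sum.mono_neutral_right ballI)
      show "{?a, ?b} \<subseteq> {..<Suc CARD('q)}"
        using us(1) eq by auto
      show "T j us = 0" if "j \<in> {..<Suc CARD('q)} - {?a, ?b}" for j
        using that by (intro zero) auto
    qed simp
    also have "\<dots> = T ?a us + T ?b us"
      by simp
    also have "T ?a us = (- 1) ^ length p * (\<phi> x * \<omega> ((p @ q) @ x # r))"
      unfolding T_def eq1 by simp
    also have "\<omega> ((p @ q) @ x # r) = (- 1) ^ (length p + length q) * \<omega> (x # p @ q @ r)"
      by (subst alternating_form_move_front[OF \<omega>]) simp
    also have "T ?b us = (- 1) ^ (length p + Suc (length q)) * (\<phi> x * \<omega> (p @ x # (q @ r)))"
      unfolding T_def eq2 nth_append_length by simp
    also have "\<omega> (p @ x # (q @ r)) = (- 1) ^ length p * \<omega> (x # p @ q @ r)"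
      by (subst alternating_form_move_front[OF \<omega>]) simp
    finally show "(\<Sum>j<Suc CARD('q). T j us) = 0"
      by (simp add: power_add)
  qed
  then show ?thesis
    by (simp only: T_def len)
qed

text \<open>Expanding \<open>(\<phi> \<and> \<omega>)(w, v\<^sub>1, \<dots>, v\<^sub>n) = 0\<close> along \<open>w\<close>: the term where \<open>\<phi>\<close> takes \<open>w\<close> equals the sum
  of the others.  With \<open>\<phi> = dY\<^sub>j\<close> and \<open>w = e\<^sub>j\<close>, summed over \<open>j\<close>, the left hand side is
  \<open>d(Y \<rfloor> \<omega>)\<close> for a constant form \<open>\<omega>\<close>, and the right hand side is \<open>(\<Sum>j. \<partial>\<^sub>j Y\<^sub>j) \<omega>\<close>.\<close>

lemma top_form_contraction:
  fixes \<omega> :: "('k::field ^ 'q::finite) list \<Rightarrow> 'k"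
  assumes \<omega>: "alternating_form CARD('q) \<omega>" and \<phi>: "\<And>w. \<phi> w = (\<Sum>i\<in>UNIV. w $ i * \<phi> (axis i 1))"
    and len: "length vs = CARD('q)"
  shows "(\<Sum>j<length vs. (- 1) ^ j * (\<phi> (vs ! j) * \<omega> (w # take j vs @ drop (Suc j) vs))) = \<phi> w * \<omega> vs"
proof -
  have "(\<Sum>j<length (w # vs). (- 1) ^ j * (\<phi> ((w # vs) ! j) * \<omega> (take j (w # vs) @ drop (Suc j) (w # vs)))) = 0"
    using len by (intro wedge_top_form_eq_0[OF \<omega> \<phi>]) simp
  then show ?thesis
    by (simp add: sum.lessThan_Suc_shift sum_negf del: sum.lessThan_Suc)
qed

text \<open>Reordering the arguments changes a value at most by a sign.  Stating this for vanishing
  avoids the sign of a permutation; the prefix \<open>us\<close> holds the arguments already in place.\<close>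

lemma alternating_form_eq_0_mset:
  assumes \<omega>: "alternating_form k \<omega>" and "mset xs = mset ys" "\<omega> (us @ ys) = 0"
  shows "\<omega> (us @ xs) = 0"
  using assms(2,3)
proof (induction xs arbitrary: us ys)
  case (Cons x xs)
  then have "x \<in> set ys"
    by (metis list.set_intros(1) set_mset_mset)
  then obtain ys1 ys2 where ys: "ys = ys1 @ x # ys2"
    by (auto dest: split_list)
  have "\<omega> ((us @ ys1) @ x # ys2) = 0"
    using Cons.prems ys by simp
  then have "\<omega> (x # us @ ys1 @ ys2) = 0"
    by (subst (asm) alternating_form_move_front[OF \<omega>]) simp
  then have "\<omega> ((us @ [x]) @ ys1 @ ys2) = 0"
    using alternating_form_move_front[OF \<omega>, of us x "ys1 @ ys2"] by simp
  moreover have "mset xs = mset (ys1 @ ys2)"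
    using Cons.prems ys by simp
  ultimately have "\<omega> ((us @ [x]) @ xs) = 0"
    using Cons.IH by blast
  then show ?case by simp
qed simp

text \<open>By multilinearity only coordinate vectors matter, and a list of distinct coordinate vectors of full
  length is a rearrangement of \<open>bs\<close>.\<close>

lemma top_form_eq_0:
  fixes \<omega> :: "('k::field ^ 'q::finite) list \<Rightarrow> 'k"
  assumes \<omega>: "alternating_form CARD('q) \<omega>" and bs: "distinct bs" "set bs = range (\<lambda>i. axis i 1)"
    and 0: "\<omega> bs = 0"
  shows "\<omega> vs = 0"
proof (cases "length vs = CARD('q)")
  case True
  then show ?thesis
  proof (rule multilinear_eq_0[where F = \<omega>, rotated 2])
    fix us w ws
    show "\<omega> (us @ w # ws) = (\<Sum>i\<in>UNIV. w $ i * \<omega> (us @ axis i 1 # ws))"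
      by (rule alternating_form_expand[OF \<omega>])
  next
    fix us :: "('k ^ 'q) list" assume us: "length us = CARD('q)" "set us \<subseteq> range (\<lambda>i. axis i 1)"
    show "\<omega> us = 0"
    proof (cases "distinct us")
      case True
      have "inj (\<lambda>i. axis i 1 :: 'k ^ 'q)"
        by (auto simp: inj_on_def axis_eq_axis)
      then have "card (range (\<lambda>i. axis i 1 :: 'k ^ 'q)) = card (set us)"
        using us True by (simp add: card_image distinct_card)
      then have "set us = set bs"
        using us bs by (simp add: card_subset_eq)
      then have "mset us = mset bs"
        using True bs set_eq_iff_mset_eq_distinct by blast
      then show ?thesis
        using alternating_form_eq_0_mset[OF \<omega>, of us bs "[]"] 0 by simp
    qed (simp add: alternating_form_not_distinct[OF \<omega>])
  qed
next
  case False
  with \<omega> show ?thesis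
    by (simp add: alternating_form_def)
qed

lemma linear_combination_linear:
  assumes "Vector_Spaces.linear (*s) (*) f" "Vector_Spaces.linear (*s) (*) g"
  shows "Vector_Spaces.linear (*s) (*) (\<lambda>v :: 'k::field ^ 'q. f v * a - b * g v)"
proof -
  interpret f: Vector_Spaces.linear "(*s)" "(*)" f by fact
  interpret g: Vector_Spaces.linear "(*s)" "(*)" g by fact
  show ?thesis
    by unfold_locales (simp_all add: f.add f.scale g.add g.scale algebra_simps)
qed

text \<open>The difference of the two sides is an alternating form in \<open>vs\<close> vanishing on the basis \<open>bs\<close>, hence
  everywhere.  So the space of top forms is a line, and a volume form is determined by one density.\<close>

lemma top_form_proportional:
  fixes \<omega> \<eta> :: "('k::field ^ 'q::finite) list \<Rightarrow> 'k"
  assumes \<omega>: "alternating_form CARD('q) \<omega>" and \<eta>: "alternating_form CARD('q) \<eta>"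
    and bs: "distinct bs" "set bs = range (\<lambda>i. axis i 1)"
  shows "\<omega> vs * \<eta> bs = \<omega> bs * \<eta> vs"
proof -
  have "alternating_form CARD('q) (\<lambda>vs. \<omega> vs * \<eta> bs - \<omega> bs * \<eta> vs)"
    using \<omega> \<eta> unfolding alternating_form_def by (auto intro!: linear_combination_linear)
  from top_form_eq_0[OF this bs, of vs] show ?thesis
    by simp
qed

section \<open>The divergence in terms of a density\<close>

lemma germ_cases:
  obtains f where "g = abs_germ f"
  using Quotient3_abs_rep[OF Quotient3_germ, of g] by metis

lemma abs_germ_eqI: "\<forall>\<^sub>F x in nhds 0. f x = g x \<Longrightarrow> abs_germ f = abs_germ g"
  by (simp add: germ.abs_eq_iff)

lemma rep_abs_germ: "\<forall>\<^sub>F x in nhds 0. rep_germ (abs_germ g) x = g x"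
  using Quotient3_abs_rep[OF Quotient3_germ, of "abs_germ g"] by (simp add: germ.abs_eq_iff)

lemma abs_germ_add: "abs_germ f + abs_germ g = abs_germ (\<lambda>x. f x + g x)"
  by (simp add: plus_germ_def germ_map2.abs_eq)

lemma eventually_nhds_line:
  fixes x v :: "'k::real_normed_field ^ 'm"
  assumes "\<forall>\<^sub>F y in nhds x. P y"
  shows "\<forall>\<^sub>F t in nhds 0. P (x + t *s v)"
proof -
  have "((\<lambda>t. x + t *s v) \<longlongrightarrow> x + 0 *s v) (nhds 0)"
    unfolding vector_scalar_mult_def
    by (intro tendsto_intros tendsto_vec_lambda filterlim_ident)
  then have "filterlim (\<lambda>t. x + t *s v) (nhds x) (nhds 0)"
    by simp
  then show ?thesis
    using assms by (rule filterlim_iff[THEN iffD1, rule_format])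
qed

lemma has_field_derivative_line_cong:
  fixes x v :: "'k::real_normed_field ^ 'm"
  assumes "\<forall>\<^sub>F y in nhds x. f y = g y" "((\<lambda>t. f (x + t *s v)) has_field_derivative d) (at 0)"
  shows "((\<lambda>t. g (x + t *s v)) has_field_derivative d) (at 0)"
  using DERIV_cong_ev[OF refl eventually_nhds_line[OF assms(1)] refl] assms(2) by blast

text \<open>By multilinearity \<open>X \<rfloor> \<Omega> = \<Sum>j. \<omega> X\<^sub>j \<cdot> (e\<^sub>j \<rfloor> \<eta>)\<close> with constant forms \<open>e\<^sub>j \<rfloor> \<eta>\<close>, so only the functions
  \<open>\<omega> X\<^sub>j\<close> are differentiated, and \<open>top_form_contraction\<close> collapses the alternating sum.  \<open>D j k\<close> is
  \<open>\<partial>\<^sub>k (\<omega> X\<^sub>j)\<close>; total differentiability enters through derivatives along all lines.  The quotient by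
  \<open>\<Omega>\<close> is unique because \<open>\<omega>\<close> does not vanish.\<close>

lemma divergence_formula:
  fixes \<omega> :: "'k::real_normed_field ^ 'q::finite \<Rightarrow> 'k" and X :: "'k ^ 'q \<Rightarrow> 'k ^ 'q"
  assumes \<eta>: "alternating_form CARD('q) \<eta>" "\<eta> vs0 \<noteq> 0" and \<omega>: "\<forall>\<^sub>F x in nhds 0. \<omega> x \<noteq> 0"
    and D: "\<forall>\<^sub>F x in nhds 0. \<forall>j v. ((\<lambda>t. \<omega> (x + t *s v) * X (x + t *s v) $ j) has_field_derivative
      (\<Sum>k\<in>UNIV. v $ k * D j k x)) (at 0)"
  shows "divergence (abs_germ (\<lambda>x vs. \<omega> x * \<eta> vs)) (abs_germ X) =
    abs_germ (\<lambda>x. (\<Sum>j\<in>UNIV. D j j x) * inverse (\<omega> x))"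
proof -
  define g where "g x = (\<Sum>j\<in>UNIV. D j j x) * inverse (\<omega> x)" for x
  define E where "E x vs = (\<Sum>i<length vs. (- 1) ^ i *
      dir_deriv (\<lambda>y. \<omega> y * \<eta> (X y # take i vs @ drop (Suc i) vs)) x (vs ! i))" for x vs
  have key: "\<forall>\<^sub>F x in nhds 0. E x = (\<lambda>vs. g x * (\<omega> x * \<eta> vs))"
    using D \<omega>
  proof (rule eventually_elim2, intro ext)
    fix x :: "'k ^ 'q" and vs :: "('k ^ 'q) list"
    assume D: "\<forall>j v. ((\<lambda>t. \<omega> (x + t *s v) * X (x + t *s v) $ j) has_field_derivative
        (\<Sum>k\<in>UNIV. v $ k * D j k x)) (at 0)" and \<omega>: "\<omega> x \<noteq> 0"
    define \<phi> where "\<phi> j v = (\<Sum>k\<in>UNIV. v $ k * D j k x)" for j and v :: "'k ^ 'q"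
    have \<phi>_axis: "\<phi> j (axis i 1) = D j i x" for i j
    proof -
      have "\<phi> j (axis i 1) = (\<Sum>k\<in>UNIV. if k = i then D j k x else 0)"
        unfolding \<phi>_def by (intro sum.cong) (auto simp: axis_def)
      then show ?thesis by simp
    qed
    have dd: "dir_deriv (\<lambda>y. \<omega> y * \<eta> (X y # us)) x v = (\<Sum>j\<in>UNIV. \<phi> j v * \<eta> (axis j 1 # us))" for us v
    proof -
      have eq: "\<omega> y * \<eta> (X y # us) = (\<Sum>j\<in>UNIV. (\<omega> y * X y $ j) * \<eta> (axis j 1 # us))" for y
        using alternating_form_expand[OF \<eta>(1), of "[]" "X y" us] by (simp add: sum_distrib_left mult.assoc)
      show ?thesis
        unfolding dir_deriv_def eq \<phi>_def using D by (intro DERIV_imp_deriv DERIV_sum DERIV_cmult_right) auto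
    qed
    have E: "E x vs = (\<Sum>j\<in>UNIV. \<Sum>i<length vs. (- 1) ^ i * (\<phi> j (vs ! i) * \<eta> (axis j 1 # take i vs @ drop (Suc i) vs)))"
      unfolding E_def dd sum_distrib_left by (rule sum.swap)
    show "E x vs = g x * (\<omega> x * \<eta> vs)"
    proof (cases "length vs = CARD('q)")
      case True
      \<comment> \<open>The contraction identity applies to forms of full degree; off that degree both sides are zero by
        the convention for lists of the wrong length.\<close>
      have "\<phi> j w = (\<Sum>i\<in>UNIV. w $ i * \<phi> j (axis i 1))" for j w
        unfolding \<phi>_axis by (simp add: \<phi>_def)
      then have "E x vs = (\<Sum>j\<in>UNIV. \<phi> j (axis j 1) * \<eta> vs)"
        unfolding E by (intro sum.cong refl top_form_contraction[OF \<eta>(1) _ True])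
      also have "\<dots> = (\<Sum>j\<in>UNIV. D j j x) * (inverse (\<omega> x) * \<omega> x) * \<eta> vs"
        using \<omega> by (simp add: \<phi>_axis sum_distrib_right)
      finally show ?thesis
        by (simp only: g_def mult.assoc)
    next
      case False
      have "\<eta> vs = 0" and "\<eta> (axis j 1 # take i vs @ drop (Suc i) vs) = 0" if "i < length vs" for i j
        using \<eta>(1) False that by (auto simp: alternating_form_def)
      moreover have "\<eta> vs = 0"
        using \<eta>(1) False by (auto simp: alternating_form_def)
      ultimately show ?thesis
        unfolding E by simp
    qed
  qed
  have ext: "ext_deriv (interior_product (abs_germ X) (abs_germ (\<lambda>x vs. \<omega> x * \<eta> vs))) = abs_germ E"
    unfolding interior_product_def germ_map2.abs_eq ext_deriv.abs_eq E_def[abs_def] ..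
  show ?thesis
    unfolding divergence_def ext g_def[symmetric]
  proof (rule the_equality)
    show "abs_germ E = germ_map2 (\<lambda>g \<omega> vs. g * \<omega> vs) (abs_germ g) (abs_germ (\<lambda>x vs. \<omega> x * \<eta> vs))"
      unfolding germ_map2.abs_eq using key by (rule abs_germ_eqI)
    fix h :: "('k ^ 'q, 'k) germ"
    assume h: "abs_germ E = germ_map2 (\<lambda>g \<omega> vs. g * \<omega> vs) h (abs_germ (\<lambda>x vs. \<omega> x * \<eta> vs))"
    obtain h' where h': "h = abs_germ h'"
      by (rule germ_cases)
    from h have "\<forall>\<^sub>F x in nhds 0. E x = (\<lambda>vs. h' x * (\<omega> x * \<eta> vs))"
      unfolding h' germ_map2.abs_eq germ.abs_eq_iff .
    with key have "\<forall>\<^sub>F x in nhds 0. h' x * \<omega> x = g x * \<omega> x"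
      by eventually_elim (metis \<eta>(2) mult.assoc mult_right_cancel)
    with \<omega> have "\<forall>\<^sub>F x in nhds 0. h' x = g x"
      by eventually_elim simp
    then show "h = abs_germ g"
      unfolding h' by (rule abs_germ_eqI)
  qed
qed

section \<open>Vector space structures on germs\<close>

lemma module_germ:
  fixes sc :: "'k::comm_ring_1 \<Rightarrow> 'b::ab_group_add \<Rightarrow> 'b"
  assumes "module sc"
  shows "module (\<lambda>c. germ_map (sc c) :: ('a::{topological_space, zero}, 'b) germ \<Rightarrow> ('a, 'b) germ)"
proof -
  interpret module sc by fact
  show ?thesis
  proof
    fix a b and x y :: "('a, 'b) germ"
    obtain f g where xy: "x = abs_germ f" "y = abs_germ g"
      using germ_cases[of x] germ_cases[of y] by metis
    show "germ_map (sc a) (x + y) = germ_map (sc a) x + germ_map (sc a) y"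
      by (simp add: xy abs_germ_add germ_map.abs_eq scale_right_distrib)
    show "germ_map (sc (a + b)) x = germ_map (sc a) x + germ_map (sc b) x"
      by (simp add: xy abs_germ_add germ_map.abs_eq scale_left_distrib)
    show "germ_map (sc a) (germ_map (sc b) x) = germ_map (sc (a * b)) x"
      by (simp add: xy germ_map.abs_eq)
    show "germ_map (sc 1) x = x"
      by (simp add: xy germ_map.abs_eq)
  qed
qed

lemma module_scalar: "module ((*) :: 'k::comm_ring_1 \<Rightarrow> 'k \<Rightarrow> 'k)"
  by unfold_locales (simp_all add: algebra_simps)

lemma module_vector: "module ((*s) :: 'k::comm_ring_1 \<Rightarrow> 'k ^ 'q \<Rightarrow> 'k ^ 'q)"
  by unfold_locales (simp_all add: vec_eq_iff algebra_simps)

definition matrix_scale :: "'k::comm_ring_1 \<Rightarrow> 'k ^ 'p ^ 'q \<Rightarrow> 'k ^ 'p ^ 'q"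
  where "matrix_scale c B = (\<chi> i. c *s B $ i)"

lemma module_matrix: "module (matrix_scale :: 'k::comm_ring_1 \<Rightarrow> 'k ^ 'p ^ 'q \<Rightarrow> 'k ^ 'p ^ 'q)"
  by unfold_locales (simp_all add: matrix_scale_def vec_eq_iff algebra_simps)

definition prod_scale :: "('k \<Rightarrow> 'a \<Rightarrow> 'a) \<Rightarrow> ('k \<Rightarrow> 'b \<Rightarrow> 'b) \<Rightarrow> 'k \<Rightarrow> 'a \<times> 'b \<Rightarrow> 'a \<times> 'b"
  where "prod_scale s1 s2 c z = (s1 c (fst z), s2 c (snd z))"

lemma module_prod:
  assumes "module s1" "module s2"
  shows "module (prod_scale s1 s2)"
proof -
  interpret s1: module s1 by fact
  interpret s2: module s2 by fact
  show ?thesis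
    by unfold_locales
      (simp_all add: prod_scale_def prod_eq_iff s1.scale_right_distrib s1.scale_left_distrib
        s2.scale_right_distrib s2.scale_left_distrib)
qed

lemma subspace_prod:
  assumes m: "module s1" "module s2" and "module.subspace s1 A" "module.subspace s2 B"
  shows "module.subspace (prod_scale s1 s2) (A \<times> B)"
  using assms(3,4) unfolding module.subspace_def[OF m(1)] module.subspace_def[OF m(2)]
    module.subspace_def[OF module_prod[OF m]]
  by (auto simp: prod_scale_def zero_prod_def)

lemma subspace_singleton_0: "module sc \<Longrightarrow> module.subspace sc {0}"
  by (simp add: module.subspace_single_0)

abbreviation vector_germ_scale :: "'k::comm_ring_1 \<Rightarrow> ('a::{topological_space, zero}, 'k ^ 'q) germ \<Rightarrow> ('a, 'k ^ 'q) germ"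
  where "vector_germ_scale c \<equiv> germ_map ((*s) c)"

lemma moduli_isoI:
  fixes \<gamma> :: "'l::ab_group_add \<Rightarrow> ('k::real_normed_field ^ 'n, 'k ^ 'p) germ"
    and dv :: "'c \<Rightarrow> ('k ^ 'r, 'k) germ"
  assumes "module sl" "module.subspace sl L"
    and "\<And>x y. \<gamma> (x + y) = \<gamma> x + \<gamma> y" "\<And>c x. \<gamma> (sl c x) = vector_germ_scale c (\<gamma> x)"
    and "\<And>x y. x \<in> L \<Longrightarrow> y \<in> L \<Longrightarrow> dv (\<pi> (x + y)) = dv (\<pi> x) + dv (\<pi> y)"
    and "\<And>c x. x \<in> L \<Longrightarrow> dv (\<pi> (sl c x)) = germ_map ((*) c) (dv (\<pi> x))"
    and "dv ` \<pi> ` L = C"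
  shows "moduli_iso \<gamma> L \<pi> dv C"
  unfolding moduli_iso_def image_image
  by (rule quotients_isomorphic_of_linear_pair[where \<delta> = "\<lambda>z. dv (\<pi> z)" and \<gamma> = \<gamma>,
        OF assms(1) module_germ[OF module_vector] module_germ[OF module_scalar] assms(2)])
    (use assms in \<open>simp_all add: image_image\<close>)

section \<open>Calculus of smooth germs\<close>

text \<open>The predicate \<open>smooth\<close> is \<open>smooth_at0 s\<close> at one scalar field and one dimension; having it as a
  parameter ties the types of an interpretation down, which allows two dimensions side by side.  The
  \<open>partials\<close> axiom is total differentiability near the origin with smooth partial derivatives,
  phrased along lines because \<open>dir_deriv\<close> is.\<close>

locale smooth_calculus =
  fixes s :: smoothness and smooth :: "('k::real_normed_field ^ 'm::finite \<Rightarrow> 'k) \<Rightarrow> bool"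
  assumes smooth_eq: "smooth = smooth_at0 s"
    and cong: "\<And>h h'. smooth h \<Longrightarrow> \<forall>\<^sub>F x in nhds 0. h x = h' x \<Longrightarrow> smooth h'"
    and const: "\<And>c. smooth (\<lambda>_ :: 'k ^ 'm. c)"
    and add: "\<And>g h. smooth g \<Longrightarrow> smooth h \<Longrightarrow> smooth (\<lambda>x. g x + h x)"
    and mult: "\<And>g h. smooth g \<Longrightarrow> smooth h \<Longrightarrow> smooth (\<lambda>x. g x * h x)"
    and inverse: "\<And>h. smooth h \<Longrightarrow> h 0 \<noteq> 0 \<Longrightarrow> smooth (\<lambda>x. inverse (h x))"
    and isCont: "\<And>h. smooth h \<Longrightarrow> isCont h 0"
    and partials: "\<And>h. smooth h \<Longrightarrow> \<exists>D. (\<forall>i. smooth (D i)) \<and>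
      (\<forall>\<^sub>F x in nhds 0. \<forall>v. ((\<lambda>t. h (x + t *s v)) has_field_derivative (\<Sum>i\<in>UNIV. v $ i * D i x)) (at 0))"
    and primitive: "\<And>(h :: 'k ^ 'm \<Rightarrow> 'k) i. smooth h \<Longrightarrow> \<exists>H. smooth H \<and> H 0 = 0 \<and>
      (\<forall>\<^sub>F x in nhds 0. ((\<lambda>t. H (x + t *s axis i 1)) has_field_derivative h x) (at 0))"
begin

declare smooth_eq [symmetric, simp]

lemma smooth_sum:
  "finite A \<Longrightarrow> (\<And>a. a \<in> A \<Longrightarrow> smooth (h a :: 'k ^ 'm \<Rightarrow> 'k)) \<Longrightarrow> smooth (\<lambda>x. \<Sum>a\<in>A. h a x)"
  by (induction A rule: finite_induct) (auto intro: const add)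

lemma tendsto_nhds: "smooth h \<Longrightarrow> (h \<longlongrightarrow> h 0) (nhds (0 :: 'k ^ 'm))"
  using isCont by (simp add: isCont_def tendsto_at_iff_tendsto_nhds)

lemma abs_germ_in_smooth_germs_iff: "abs_germ (h :: 'k ^ 'm \<Rightarrow> 'k) \<in> smooth_germs s \<longleftrightarrow> smooth h"
proof
  assume "abs_germ h \<in> smooth_germs s"
  then obtain g where "\<forall>\<^sub>F x in nhds 0. h x = g x" and g: "smooth g"
    by (auto simp: smooth_germs_def germ.abs_eq_iff)
  then show "smooth h"
    by (intro cong[OF g]) (auto elim: eventually_mono)
qed (auto simp: smooth_germs_def)

lemma abs_germ_in_theta_iff:
  "abs_germ (X :: 'k ^ 'm \<Rightarrow> 'k ^ 'q) \<in> theta s \<longleftrightarrow> (\<forall>i. smooth (\<lambda>x. X x $ i))"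
proof
  assume "abs_germ X \<in> theta s"
  then obtain Y where "\<forall>\<^sub>F x in nhds 0. X x = Y x" and Y: "\<And>i. smooth (\<lambda>x. Y x $ i)"
    by (auto simp: theta_def germ.abs_eq_iff)
  then show "\<forall>i. smooth (\<lambda>x. X x $ i)"
    by (auto intro!: cong[OF Y] elim!: eventually_mono)
qed (auto simp: theta_def)

lemma thetaE:
  fixes X :: "('k ^ 'm, 'k ^ 'q) germ"
  assumes "X \<in> theta s"
  obtains X' where "X = abs_germ X'" "\<And>i. smooth (\<lambda>x. X' x $ i)"
  using assms by (auto simp: theta_def)

lemma smooth_germsE:
  fixes h :: "('k ^ 'm, 'k) germ"
  assumes "h \<in> smooth_germs s"
  obtains h' where "h = abs_germ h'" "smooth h'"
  using assms by (auto simp: smooth_germs_def)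

lemma theta_zero: "(0 :: ('k ^ 'm, 'k ^ 'q) germ) \<in> theta s"
  by (simp add: zero_germ.abs_eq abs_germ_in_theta_iff const)

lemma theta_add: "X \<in> theta s \<Longrightarrow> Y \<in> theta s \<Longrightarrow> X + Y \<in> theta s" for X Y :: "('k ^ 'm, 'k ^ 'q) germ"
  by (elim thetaE) (simp add: abs_germ_add abs_germ_in_theta_iff add)

lemma theta_mult:
  "h \<in> smooth_germs s \<Longrightarrow> X \<in> theta s \<Longrightarrow> germ_map2 (*s) h X \<in> theta s" for X :: "('k ^ 'm, 'k ^ 'q) germ"
  by (elim thetaE smooth_germsE) (simp add: germ_map2.abs_eq abs_germ_in_theta_iff mult)

text \<open>An element of \<open>\<M> \<theta>\<close> is a finite sum of products, hence an honest smooth field; this is what makes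
  its divergence meaningful.\<close>

lemma M_theta_subset_theta: "(M_theta s :: ('k ^ 'm, 'k ^ 'm) germ set) \<subseteq> theta s"
proof
  fix X :: "('k ^ 'm, 'k ^ 'm) germ" assume "X \<in> M_theta s"
  then obtain hs where hs: "set hs \<subseteq> max_ideal s \<times> theta s"
    and X: "X = sum_list (map (\<lambda>(h, X). germ_map2 (*s) h X) hs)"
    by (auto simp: M_theta_def)
  from hs show "X \<in> theta s"
    unfolding X
    by (induction hs) (auto simp: theta_zero max_ideal_def intro!: theta_add theta_mult)
qed

lemma max_ideal_scale: "h \<in> max_ideal s \<Longrightarrow> germ_map ((*) c) h \<in> max_ideal s" for h :: "('k ^ 'm, 'k) germ"
  unfolding max_ideal_def
  by (auto elim!: smooth_germsE simp: germ_map.abs_eq germ_value.abs_eq abs_germ_in_smooth_germs_iff intro!: mult[OF const])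

lemma M_theta_zero: "(0 :: ('k ^ 'm, 'k ^ 'm) germ) \<in> M_theta s"
  unfolding M_theta_def by (auto intro!: exI[of _ "[]"])

lemma M_theta_add: "X \<in> M_theta s \<Longrightarrow> Y \<in> M_theta s \<Longrightarrow> X + Y \<in> M_theta s" for X Y :: "('k ^ 'm, 'k ^ 'm) germ"
proof -
  assume "X \<in> M_theta s" "Y \<in> M_theta s"
  then obtain hs ks where "set hs \<subseteq> max_ideal s \<times> theta s" "set ks \<subseteq> max_ideal s \<times> theta s"
    "X = sum_list (map (\<lambda>(h, X). germ_map2 (*s) h X) hs)" "Y = sum_list (map (\<lambda>(h, X). germ_map2 (*s) h X) ks)"
    by (auto simp: M_theta_def)
  then show "X + Y \<in> M_theta s"
    unfolding M_theta_def by (auto intro!: exI[of _ "hs @ ks"])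
qed

lemma germ_scale_add: "germ_map ((*s) c) (X + Y) = germ_map ((*s) c) X + germ_map ((*s) c) Y"
  for X Y :: "('k ^ 'm, 'k ^ 'q) germ"
  by (cases X rule: germ_cases, cases Y rule: germ_cases)
    (simp add: abs_germ_add germ_map.abs_eq vector_add_ldistrib)

lemma germ_scale_mult: "germ_map ((*s) c) (germ_map2 (*s) h X) = germ_map2 (*s) (germ_map ((*) c) h) X"
  for X :: "('k ^ 'm, 'k ^ 'q) germ"
  by (cases X rule: germ_cases, cases h rule: germ_cases)
    (simp add: germ_map2.abs_eq germ_map.abs_eq)

lemma M_theta_scale: "X \<in> M_theta s \<Longrightarrow> germ_map ((*s) c) X \<in> M_theta s" for X :: "('k ^ 'm, 'k ^ 'm) germ"
proof -
  assume "X \<in> M_theta s"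
  then obtain hs where hs: "set hs \<subseteq> max_ideal s \<times> theta s"
    and X: "X = sum_list (map (\<lambda>(h, X). germ_map2 (*s) h X) hs)"
    by (auto simp: M_theta_def)
  have zero: "germ_map ((*s) c) (0 :: ('k ^ 'm, 'k ^ 'm) germ) = 0"
    by (simp add: zero_germ.abs_eq germ_map.abs_eq)
  have "germ_map ((*s) c) X = sum_list (map (\<lambda>(h, X). germ_map2 (*s) h X) (map (\<lambda>(h, X). (germ_map ((*) c) h, X)) hs))"
    unfolding X by (induction hs) (auto simp: zero germ_scale_add germ_scale_mult)
  moreover have "set (map (\<lambda>(h, X). (germ_map ((*) c) h, X)) hs) \<subseteq> max_ideal s \<times> theta s"
    using hs max_ideal_scale by auto
  ultimately show ?thesis
    unfolding M_theta_def by blast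
qed

lemma M_theta_mult: "h \<in> max_ideal s \<Longrightarrow> X \<in> theta s \<Longrightarrow> germ_map2 (*s) h X \<in> M_theta s"
  for X :: "('k ^ 'm, 'k ^ 'm) germ"
  unfolding M_theta_def by (auto intro!: exI[of _ "[(h, X)]"])

text \<open>Every value \<open>\<Omega> x\<close> is a multiple of \<open>\<Omega> 0\<close> by \<open>top_form_proportional\<close>; the factor is the density.\<close>

lemma volume_form_density:
  assumes "\<Omega> \<in> volume_forms s"
  obtains \<omega> :: "'k ^ 'm \<Rightarrow> 'k" and \<eta> vs0
  where "\<Omega> = abs_germ (\<lambda>x vs. \<omega> x * \<eta> vs)" "smooth \<omega>" "\<omega> 0 \<noteq> 0"
    "alternating_form CARD('m) \<eta>" "\<eta> vs0 \<noteq> 0"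
proof -
  from assms obtain \<Omega>' where \<Omega>: "\<Omega> = abs_germ \<Omega>'" and alt: "\<And>x. alternating_form CARD('m) (\<Omega>' x)"
    and smooth: "\<And>vs. smooth (\<lambda>x. \<Omega>' x vs)" and "\<exists>vs. \<Omega>' 0 vs \<noteq> 0"
    unfolding volume_forms_def smooth_eq by blast
  then obtain vs0 where vs0: "\<Omega>' 0 vs0 \<noteq> 0"
    by blast
  obtain bs where bs: "distinct bs" "set bs = range (\<lambda>i. axis i 1 :: 'k ^ 'm)"
    using finite_distinct_list[of "range (\<lambda>i. axis i 1 :: 'k ^ 'm)"] by auto
  have bs0: "\<Omega>' 0 bs \<noteq> 0"
    using top_form_eq_0[OF alt bs] vs0 by blast
  have eq: "\<Omega>' x vs = (\<Omega>' x bs * inverse (\<Omega>' 0 bs)) * \<Omega>' 0 vs" for x vs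
    using top_form_proportional[OF alt alt bs, of x vs 0] bs0 by (simp add: field_simps)
  show thesis
  proof
    show "\<Omega> = abs_germ (\<lambda>x vs. (\<Omega>' x bs * inverse (\<Omega>' 0 bs)) * \<Omega>' 0 vs)"
      unfolding \<Omega> using eq by (intro abs_germ_eqI always_eventually allI ext)
    show "smooth (\<lambda>x. \<Omega>' x bs * inverse (\<Omega>' 0 bs))"
      by (intro mult smooth const)
  qed (use bs0 alt vs0 in auto)
qed

lemma divergence_representation:
  fixes X :: "('k ^ 'm, 'k ^ 'm) germ"
  assumes X: "X \<in> theta s" and \<omega>: "smooth \<omega>"
  obtains X' D where "X = abs_germ X'" "\<And>j k. smooth (D j k)"
    "\<forall>\<^sub>F x in nhds 0. \<forall>j v. ((\<lambda>t. \<omega> (x + t *s v) * X' (x + t *s v) $ j) has_field_derivative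
      (\<Sum>k\<in>UNIV. v $ k * D j k x)) (at 0)"
proof -
  from X obtain X' where X': "X = abs_germ X'" "\<And>i. smooth (\<lambda>x. X' x $ i)"
    by (rule thetaE) (use that in blast)
  have "\<forall>j. \<exists>D. (\<forall>k. smooth (D k)) \<and> (\<forall>\<^sub>F x in nhds 0. \<forall>v. ((\<lambda>t. \<omega> (x + t *s v) * X' (x + t *s v) $ j)
      has_field_derivative (\<Sum>k\<in>UNIV. v $ k * D k x)) (at 0))"
    using partials[OF mult[OF \<omega> X'(2)]] by (rule allI)
  from choice[OF this] obtain D where D: "\<And>j k. smooth (D j k)"
      "\<And>j. \<forall>\<^sub>F x in nhds 0. \<forall>v. ((\<lambda>t. \<omega> (x + t *s v) * X' (x + t *s v) $ j)
        has_field_derivative (\<Sum>k\<in>UNIV. v $ k * D j k x)) (at 0)"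
    by blast
  from D(2) have "\<forall>\<^sub>F x in nhds 0. \<forall>j v. ((\<lambda>t. \<omega> (x + t *s v) * X' (x + t *s v) $ j)
        has_field_derivative (\<Sum>k\<in>UNIV. v $ k * D j k x)) (at 0)"
    by (rule eventually_all_finite)
  with X'(1) D(1) show thesis
    by (rule that)
qed

lemma eventually_density_nonzero:
  "smooth \<omega> \<Longrightarrow> \<omega> 0 \<noteq> 0 \<Longrightarrow> \<forall>\<^sub>F x :: 'k ^ 'm in nhds 0. \<omega> x \<noteq> 0"
  using tendsto_nhds by (rule tendsto_imp_eventually_ne)

context
  fixes \<Omega> :: "('k, 'm) form_germ"
  assumes \<Omega>: "\<Omega> \<in> volume_forms s"
begin

lemma divergence_smooth:
  assumes "X \<in> theta s"
  shows "divergence \<Omega> X \<in> smooth_germs s"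
proof -
  obtain \<omega> \<eta> vs0 where vol: "\<Omega> = abs_germ (\<lambda>x vs. \<omega> x * \<eta> vs)" "smooth \<omega>" "\<omega> 0 \<noteq> 0"
    "alternating_form CARD('m) \<eta>" "\<eta> vs0 \<noteq> 0"
    by (rule volume_form_density[OF \<Omega>])
  obtain X' D where X: "X = abs_germ X'" "\<And>j k. smooth (D j k)"
    "\<forall>\<^sub>F x in nhds 0. \<forall>j v. ((\<lambda>t. \<omega> (x + t *s v) * X' (x + t *s v) $ j) has_field_derivative
      (\<Sum>k\<in>UNIV. v $ k * D j k x)) (at 0)"
    by (rule divergence_representation[OF assms vol(2)]) (use that in blast)
  have "divergence \<Omega> X = abs_germ (\<lambda>x. (\<Sum>j\<in>UNIV. D j j x) * inverse (\<omega> x))"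
    unfolding vol(1) X(1) by (rule divergence_formula[OF vol(4,5) eventually_density_nonzero[OF vol(2,3)] X(3)])
  then show ?thesis
    by (simp add: abs_germ_in_smooth_germs_iff mult smooth_sum X(2) inverse vol)
qed

lemma divergence_add:
  assumes "X \<in> theta s" "Y \<in> theta s"
  shows "divergence \<Omega> (X + Y) = divergence \<Omega> X + divergence \<Omega> Y"
proof -
  obtain \<omega> \<eta> vs0 where vol: "\<Omega> = abs_germ (\<lambda>x vs. \<omega> x * \<eta> vs)" "smooth \<omega>" "\<omega> 0 \<noteq> 0"
    "alternating_form CARD('m) \<eta>" "\<eta> vs0 \<noteq> 0"
    by (rule volume_form_density[OF \<Omega>])
  note formula = divergence_formula[OF vol(4,5) eventually_density_nonzero[OF vol(2,3)]]
  obtain X' D where X: "X = abs_germ X'"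
    "\<forall>\<^sub>F x in nhds 0. \<forall>j v. ((\<lambda>t. \<omega> (x + t *s v) * X' (x + t *s v) $ j) has_field_derivative
      (\<Sum>k\<in>UNIV. v $ k * D j k x)) (at 0)"
    by (rule divergence_representation[OF assms(1) vol(2)]) (use that in blast)
  obtain Y' E where Y: "Y = abs_germ Y'"
    "\<forall>\<^sub>F x in nhds 0. \<forall>j v. ((\<lambda>t. \<omega> (x + t *s v) * Y' (x + t *s v) $ j) has_field_derivative
      (\<Sum>k\<in>UNIV. v $ k * E j k x)) (at 0)"
    by (rule divergence_representation[OF assms(2) vol(2)]) (use that in blast)
  have "\<forall>\<^sub>F x in nhds 0. \<forall>j v. ((\<lambda>t. \<omega> (x + t *s v) * (X' (x + t *s v) + Y' (x + t *s v)) $ j) has_field_derivative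
      (\<Sum>k\<in>UNIV. v $ k * (D j k x + E j k x))) (at 0)"
    using X(2) Y(2)
  proof eventually_elim
    case (elim x)
    show ?case
    proof (intro allI)
      fix j v
      from DERIV_add[OF elim(1)[rule_format, of v j] elim(2)[rule_format, of v j]]
      show "((\<lambda>t. \<omega> (x + t *s v) * (X' (x + t *s v) + Y' (x + t *s v)) $ j) has_field_derivative
          (\<Sum>k\<in>UNIV. v $ k * (D j k x + E j k x))) (at 0)"
        by (simp add: distrib_left sum.distrib)
    qed
  qed
  from formula[OF this] show ?thesis
    unfolding vol(1) X(1) Y(1) abs_germ_add formula[OF X(2)] formula[OF Y(2)]
    by (simp add: sum.distrib distrib_right)
qed

lemma divergence_scale:
  assumes "X \<in> theta s"
  shows "divergence \<Omega> (germ_map ((*s) c) X) = germ_map ((*) c) (divergence \<Omega> X)"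
proof -
  obtain \<omega> \<eta> vs0 where vol: "\<Omega> = abs_germ (\<lambda>x vs. \<omega> x * \<eta> vs)" "smooth \<omega>" "\<omega> 0 \<noteq> 0"
    "alternating_form CARD('m) \<eta>" "\<eta> vs0 \<noteq> 0"
    by (rule volume_form_density[OF \<Omega>])
  note formula = divergence_formula[OF vol(4,5) eventually_density_nonzero[OF vol(2,3)]]
  obtain X' D where X: "X = abs_germ X'"
    "\<forall>\<^sub>F x in nhds 0. \<forall>j v. ((\<lambda>t. \<omega> (x + t *s v) * X' (x + t *s v) $ j) has_field_derivative
      (\<Sum>k\<in>UNIV. v $ k * D j k x)) (at 0)"
    by (rule divergence_representation[OF assms(1) vol(2)]) (use that in blast)
  have "\<forall>\<^sub>F x in nhds 0. \<forall>j v. ((\<lambda>t. \<omega> (x + t *s v) * (c *s X' (x + t *s v)) $ j) has_field_derivative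
      (\<Sum>k\<in>UNIV. v $ k * (c * D j k x))) (at 0)"
    using X(2)
  proof eventually_elim
    case (elim x)
    show ?case
    proof (intro allI)
      fix j v
      from DERIV_cmult[OF elim[rule_format, of v j], of c]
      show "((\<lambda>t. \<omega> (x + t *s v) * (c *s X' (x + t *s v)) $ j) has_field_derivative
          (\<Sum>k\<in>UNIV. v $ k * (c * D j k x))) (at 0)"
        by (simp add: sum_distrib_left mult.left_commute)
    qed
  qed
  from formula[OF this] show ?thesis
    unfolding vol(1) X(1) germ_map.abs_eq formula[OF X(2)]
    by (simp add: mult.assoc flip: sum_distrib_left)
qed

text \<open>A field pointing in one coordinate direction suffices: \<open>X = (H / \<omega>) e\<close> with \<open>H\<close> the primitive of
  \<open>\<omega> g\<close> in that direction.  As \<open>H\<close> vanishes at the origin, \<open>X\<close> is a single product of an element of the maximal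
  ideal with a constant field, so it lies in \<open>\<M> \<theta>\<close>.\<close>

lemma divergence_onto: "divergence \<Omega> ` M_theta s = smooth_germs s"
proof (intro subset_antisym subsetI)
  fix g assume "g \<in> divergence \<Omega> ` M_theta s"
  then show "g \<in> smooth_germs s"
    using divergence_smooth M_theta_subset_theta by blast
next
  fix g :: "('k ^ 'm, 'k) germ" assume "g \<in> smooth_germs s"
  then obtain g' where g: "g = abs_germ g'" "smooth g'"
    by (rule smooth_germsE) (use that in blast)
  obtain \<omega> \<eta> vs0 where vol: "\<Omega> = abs_germ (\<lambda>x vs. \<omega> x * \<eta> vs)" "smooth \<omega>" "\<omega> 0 \<noteq> 0"
    "alternating_form CARD('m) \<eta>" "\<eta> vs0 \<noteq> 0"
    by (rule volume_form_density[OF \<Omega>])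
  note nonzero = eventually_density_nonzero[OF vol(2,3)]
  fix i0 :: 'm
  obtain H where H: "smooth H" "H 0 = 0"
    "\<forall>\<^sub>F x in nhds 0. ((\<lambda>t. H (x + t *s axis i0 1)) has_field_derivative \<omega> x * g' x) (at 0)"
    using primitive[OF mult[OF vol(2) g(2)], of i0] by blast
  obtain D where D: "\<forall>\<^sub>F x in nhds 0. \<forall>v. ((\<lambda>t. H (x + t *s v)) has_field_derivative (\<Sum>i\<in>UNIV. v $ i * D i x)) (at 0)"
    using partials[OF H(1)] by blast
  define X where "X x = (H x * inverse (\<omega> x)) *s (axis i0 1 :: 'k ^ 'm)" for x
  define E where "E j k x = (if j = i0 then D k x else 0)" for j k x
  have "abs_germ (\<lambda>x. H x * inverse (\<omega> x)) \<in> max_ideal s"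
    by (simp add: max_ideal_def abs_germ_in_smooth_germs_iff germ_value.abs_eq H vol mult inverse)
  moreover have "abs_germ (\<lambda>_. axis i0 1) \<in> (theta s :: ('k ^ 'm, 'k ^ 'm) germ set)"
    by (simp add: abs_germ_in_theta_iff const)
  ultimately have "abs_germ X \<in> M_theta s"
    using M_theta_mult by (force simp: germ_map2.abs_eq X_def[abs_def])
  have "\<forall>\<^sub>F x in nhds 0. \<forall>\<^sub>F y in nhds x. \<omega> y \<noteq> 0"
    using nonzero by (simp add: eventually_eventually)
  with D have E: "\<forall>\<^sub>F x in nhds 0. \<forall>j v. ((\<lambda>t. \<omega> (x + t *s v) * X (x + t *s v) $ j) has_field_derivative
      (\<Sum>k\<in>UNIV. v $ k * E j k x)) (at 0)"
  proof eventually_elim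
    case (elim x)
    show ?case
    proof (intro allI)
      fix j v
      show "((\<lambda>t. \<omega> (x + t *s v) * X (x + t *s v) $ j) has_field_derivative (\<Sum>k\<in>UNIV. v $ k * E j k x)) (at 0)"
      proof (cases "j = i0")
        case True
        have "\<forall>\<^sub>F y in nhds x. H y = \<omega> y * X y $ j"
          using elim(2) by (rule eventually_mono) (simp add: X_def True axis_def)
        then show ?thesis
          by (rule has_field_derivative_line_cong) (use elim(1) True in \<open>simp add: E_def\<close>)
      qed (simp add: X_def E_def axis_def)
    qed
  qed
  have "\<forall>\<^sub>F x in nhds 0. (\<Sum>j\<in>UNIV. E j j x) * inverse (\<omega> x) = g' x"
    using D H(3) nonzero
  proof eventually_elim
    case (elim x)
    \<comment> \<open>Both \<open>\<partial>H/\<partial>x\<close> in direction \<open>i0\<close> and \<open>\<omega> g\<close> are the derivative along the same line.\<close>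
    have "((\<lambda>t. H (x + t *s axis i0 1)) has_field_derivative (\<Sum>i\<in>UNIV. axis i0 1 $ i * D i x)) (at 0)"
      using elim(1) by blast
    then have "(\<Sum>i\<in>UNIV. axis i0 1 $ i * D i x) = \<omega> x * g' x"
      using elim(2) by (rule DERIV_unique)
    moreover have "(\<Sum>i\<in>UNIV. axis i0 1 $ i * D i x) = (\<Sum>j\<in>UNIV. E j j x)"
      by (intro sum.cong) (auto simp: E_def axis_def)
    ultimately show ?case
      using elim(3) by simp
  qed
  then have "divergence \<Omega> (abs_germ X) = g"
    unfolding vol(1) g(1) divergence_formula[OF vol(4,5) nonzero E] by (rule abs_germ_eqI)
  with \<open>abs_germ X \<in> M_theta s\<close> show "g \<in> divergence \<Omega> ` M_theta s"
    by blast
qed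

end

text \<open>The directional derivative of a smooth map is linear in the direction, so \<open>tf\<close> is a matrix of
  partial derivatives applied to the field.\<close>

lemma tf_abs_germ:
  fixes f :: "'k ^ 'm \<Rightarrow> 'k ^ 'p"
  assumes "\<And>i. smooth (\<lambda>x. f x $ i)"
  obtains D where "\<And>a. tf (abs_germ f) (abs_germ a) = abs_germ (\<lambda>x. \<chi> i. \<Sum>k\<in>UNIV. a x $ k * D i k x)"
proof -
  have "\<forall>i. \<exists>D. (\<forall>k. smooth (D k)) \<and> (\<forall>\<^sub>F x in nhds 0. \<forall>v. ((\<lambda>t. f (x + t *s v) $ i)
      has_field_derivative (\<Sum>k\<in>UNIV. v $ k * D k x)) (at 0))"
    using partials[OF assms] by (rule allI)
  from choice[OF this] obtain D where "\<And>i. \<forall>\<^sub>F x in nhds 0. \<forall>v. ((\<lambda>t. f (x + t *s v) $ i)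
        has_field_derivative (\<Sum>k\<in>UNIV. v $ k * D i k x)) (at 0)"
    by blast
  then have D: "\<forall>\<^sub>F x in nhds 0. \<forall>i v. ((\<lambda>t. f (x + t *s v) $ i)
        has_field_derivative (\<Sum>k\<in>UNIV. v $ k * D i k x)) (at 0)"
    by (rule eventually_all_finite)
  show thesis
  proof (rule that[of D])
    fix a :: "'k ^ 'm \<Rightarrow> 'k ^ 'm"
    show "tf (abs_germ f) (abs_germ a) = abs_germ (\<lambda>x. \<chi> i. \<Sum>k\<in>UNIV. a x $ k * D i k x)"
      unfolding tf.abs_eq
    proof (rule abs_germ_eqI)
      show "\<forall>\<^sub>F x in nhds 0. (\<chi> i. dir_deriv (\<lambda>y. f y $ i) x (a x)) = (\<chi> i. \<Sum>k\<in>UNIV. a x $ k * D i k x)"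
        using D
      proof eventually_elim
        case (elim x)
        have "dir_deriv (\<lambda>y. f y $ i) x (a x) = (\<Sum>k\<in>UNIV. a x $ k * D i k x)" for i
          unfolding dir_deriv_def using elim by (intro DERIV_imp_deriv) blast
        then show ?case by simp
      qed
    qed
  qed
qed

lemma tf_add:
  fixes f :: "('k ^ 'm, 'k ^ 'p) germ"
  assumes "f \<in> theta s"
  shows "tf f (a + b) = tf f a + tf f b"
proof -
  from assms obtain f' where f: "f = abs_germ f'" "\<And>i. smooth (\<lambda>x. f' x $ i)"
    by (rule thetaE) (use that in blast)
  obtain D where D: "\<And>a. tf (abs_germ f') (abs_germ a) = abs_germ (\<lambda>x. \<chi> i. \<Sum>k\<in>UNIV. a x $ k * D i k x)"
    by (rule tf_abs_germ[OF f(2)]) (use that in blast)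
  show ?thesis
    by (cases a rule: germ_cases, cases b rule: germ_cases)
      (simp add: f(1) D abs_germ_add distrib_right sum.distrib plus_vec_def)
qed

lemma tf_scale:
  fixes f :: "('k ^ 'm, 'k ^ 'p) germ"
  assumes "f \<in> theta s"
  shows "tf f (germ_map ((*s) c) a) = germ_map ((*s) c) (tf f a)"
proof -
  from assms obtain f' where f: "f = abs_germ f'" "\<And>i. smooth (\<lambda>x. f' x $ i)"
    by (rule thetaE) (use that in blast)
  obtain D where D: "\<And>a. tf (abs_germ f') (abs_germ a) = abs_germ (\<lambda>x. \<chi> i. \<Sum>k\<in>UNIV. a x $ k * D i k x)"
    by (rule tf_abs_germ[OF f(2)]) (use that in blast)
  show ?thesis
    by (cases a rule: germ_cases)
      (simp add: f(1) D germ_map.abs_eq vector_scalar_mult_def sum_distrib_left mult.assoc)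
qed

text \<open>Composition is defined with chosen representatives.  Since \<open>f\<close> is continuous and fixes the origin, a
  neighbourhood on which two representatives of \<open>b\<close> agree pulls back to a neighbourhood, and any
  representatives give the same germ.\<close>

lemma germ_comp_abs_germ:
  fixes f :: "('k ^ 'm, 'k ^ 'p::finite) germ"
  assumes "f \<in> map_germs s"
  shows "\<exists>f'. \<forall>b. germ_comp (abs_germ b) f = abs_germ (\<lambda>x. b (f' x))"
proof -
  from assms obtain f' where f: "f = abs_germ f'" "\<And>i. smooth (\<lambda>x. f' x $ i)" and "f' 0 = 0"
    unfolding map_germs_def by (auto simp: theta_def germ_value.abs_eq)
  have "((\<lambda>x. f' x $ i) \<longlongrightarrow> 0 $ i) (nhds 0)" for i
    using tendsto_nhds[OF f(2)[of i]] \<open>f' 0 = 0\<close> by simp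
  then have lim: "filterlim f' (nhds 0) (nhds 0)"
    by (rule vec_tendstoI)
  have "germ_comp (abs_germ b) f = abs_germ (\<lambda>x. b (f' x))" for b
    unfolding germ_comp_def f(1) o_def
  proof (rule abs_germ_eqI)
    have "\<forall>\<^sub>F x in nhds 0. rep_germ (abs_germ b) (f' x) = b (f' x)"
      using lim rep_abs_germ by (rule filterlim_iff[THEN iffD1, rule_format])
    with rep_abs_germ[of f'] show "\<forall>\<^sub>F x in nhds 0. rep_germ (abs_germ b) (rep_germ (abs_germ f') x) = b (f' x)"
      by eventually_elim simp
  qed
  then show ?thesis by blast
qed

section \<open>The infinitesimal actions\<close>

lemma subspace_M_theta: "module.subspace vector_germ_scale (M_theta s :: ('k ^ 'm, 'k ^ 'm) germ set)"
  unfolding module.subspace_def[OF module_germ[OF module_vector]]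
  by (auto intro: M_theta_zero M_theta_add M_theta_scale)

lemma gl_germs_iff:
  "abs_germ (B :: 'k ^ 'm \<Rightarrow> 'k ^ 'p ^ 'p) \<in> gl_germs s \<longleftrightarrow> (\<forall>i j. smooth (\<lambda>x. B x $ i $ j))"
proof
  assume "abs_germ B \<in> gl_germs s"
  then obtain A where "\<forall>\<^sub>F x in nhds 0. B x = A x" and A: "\<And>i j. smooth (\<lambda>x. A x $ i $ j)"
    by (auto simp: gl_germs_def germ.abs_eq_iff)
  then show "\<forall>i j. smooth (\<lambda>x. B x $ i $ j)"
    by (auto intro!: cong[OF A] elim!: eventually_mono)
qed (auto simp: gl_germs_def)

lemma subspace_gl_germs:
  "module.subspace (\<lambda>c. germ_map (matrix_scale c)) (gl_germs s :: ('k ^ 'm, 'k ^ 'p ^ 'p) germ set)"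
  unfolding module.subspace_def[OF module_germ[OF module_matrix]]
proof (intro conjI ballI allI)
  show "(0 :: ('k ^ 'm, 'k ^ 'p ^ 'p) germ) \<in> gl_germs s"
    by (simp add: zero_germ.abs_eq gl_germs_iff const)
  fix A B :: "('k ^ 'm, 'k ^ 'p ^ 'p) germ" and c
  assume A: "A \<in> gl_germs s"
  obtain A' where A': "A = abs_germ A'"
    by (rule germ_cases)
  with A show "germ_map (matrix_scale c) A \<in> gl_germs s"
    by (simp add: germ_map.abs_eq gl_germs_iff matrix_scale_def mult[OF const])
  assume B: "B \<in> gl_germs s"
  obtain B' where "B = abs_germ B'"
    by (rule germ_cases)
  with A A' B show "A + B \<in> gl_germs s"
    by (simp add: abs_germ_add gl_germs_iff add)
qed

lemma trace_germ_onto: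
  "germ_map trace ` (gl_germs s :: ('k ^ 'm, 'k ^ 'p::finite ^ 'p) germ set) = smooth_germs s"
proof (intro subset_antisym subsetI)
  fix g assume "g \<in> germ_map trace ` (gl_germs s :: ('k ^ 'm, 'k ^ 'p ^ 'p) germ set)"
  then obtain B :: "'k ^ 'm \<Rightarrow> 'k ^ 'p ^ 'p" where "abs_germ B \<in> gl_germs s" "g = germ_map trace (abs_germ B)"
    by (metis germ_cases imageE)
  then show "g \<in> smooth_germs s"
    by (simp add: gl_germs_iff germ_map.abs_eq abs_germ_in_smooth_germs_iff trace_def smooth_sum)
next
  fix g :: "('k ^ 'm, 'k) germ" assume "g \<in> smooth_germs s"
  then obtain g' where g: "g = abs_germ g'" "smooth g'"
    by (rule smooth_germsE) (use that in blast)
  fix i0 :: 'p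
  define B :: "'k ^ 'm \<Rightarrow> 'k ^ 'p ^ 'p" where "B x = (\<chi> i j. if i = i0 \<and> j = i0 then g' x else 0)" for x
  have "smooth (\<lambda>x. B x $ i $ j)" for i j
    by (cases "i = i0 \<and> j = i0") (auto simp: B_def g const)
  then have "abs_germ B \<in> gl_germs s"
    by (simp add: gl_germs_iff)
  moreover have "germ_map trace (abs_germ B) = g"
    by (simp add: germ_map.abs_eq g trace_def B_def)
  ultimately show "g \<in> germ_map trace ` (gl_germs s :: ('k ^ 'm, 'k ^ 'p ^ 'p) germ set)"
    by blast
qed

lemma germ_comp_add:
  fixes f :: "('k ^ 'm, 'k ^ 'p::finite) germ" and a b :: "('k ^ 'p, 'k ^ 'p) germ"
  assumes "f \<in> map_germs s"
  shows "germ_comp (a + b) f = germ_comp a f + germ_comp b f"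
proof -
  obtain f' where f': "\<And>b :: 'k ^ 'p \<Rightarrow> 'k ^ 'p. germ_comp (abs_germ b) f = abs_germ (\<lambda>x. b (f' x))"
    using germ_comp_abs_germ[OF assms] by blast
  show ?thesis
    by (cases a rule: germ_cases, cases b rule: germ_cases) (simp add: abs_germ_add f')
qed

lemma germ_comp_scale:
  fixes f :: "('k ^ 'm, 'k ^ 'p::finite) germ" and b :: "('k ^ 'p, 'k ^ 'p) germ"
  assumes "f \<in> map_germs s"
  shows "germ_comp (vector_germ_scale c b) f = vector_germ_scale c (germ_comp b f)"
proof -
  obtain f' where f': "\<And>b :: 'k ^ 'p \<Rightarrow> 'k ^ 'p. germ_comp (abs_germ b) f = abs_germ (\<lambda>x. b (f' x))"
    using germ_comp_abs_germ[OF assms] by blast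
  show ?thesis
    by (cases b rule: germ_cases) (simp add: germ_map.abs_eq f')
qed

lemma vector_germ_scale_diff:
  "vector_germ_scale c (X - Y) = vector_germ_scale c X - vector_germ_scale c Y"
  for X Y :: "('k ^ 'm, 'k ^ 'p) germ"
  by (rule module.scale_right_diff_distrib[OF module_germ[OF module_vector]])

lemma map_germs_subset_theta: "f \<in> map_germs s \<Longrightarrow> f \<in> theta s"
  by (simp add: map_germs_def)

lemma gamma_A_add: "f \<in> map_germs s \<Longrightarrow> gamma_A f (z + w) = gamma_A f z + gamma_A f w"
  for f :: "('k ^ 'm, 'k ^ 'p::finite) germ"
  by (simp add: gamma_A_def case_prod_unfold tf_add[OF map_germs_subset_theta] germ_comp_add)

lemma gamma_A_scale:
  "f \<in> map_germs s \<Longrightarrow> gamma_A f (prod_scale vector_germ_scale vector_germ_scale c z) = vector_germ_scale c (gamma_A f z)"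
  for f :: "('k ^ 'm, 'k ^ 'p::finite) germ"
  by (simp add: gamma_A_def case_prod_unfold prod_scale_def tf_scale[OF map_germs_subset_theta] germ_comp_scale
      vector_germ_scale_diff)

lemma matrix_germ_add: "germ_map2 (*v) (A + B) f = germ_map2 (*v) A f + germ_map2 (*v) B f"
  for f :: "('k ^ 'm, 'k ^ 'p::finite) germ" and A :: "('k ^ 'm, 'k ^ 'p ^ 'p) germ"
  by (cases A rule: germ_cases, cases B rule: germ_cases, cases f rule: germ_cases)
    (simp add: abs_germ_add germ_map2.abs_eq matrix_vector_mult_add_rdistrib)

lemma matrix_germ_scale: "germ_map2 (*v) (germ_map (matrix_scale c) A) f = vector_germ_scale c (germ_map2 (*v) A f)"
  for f :: "('k ^ 'm, 'k ^ 'p::finite) germ" and A :: "('k ^ 'm, 'k ^ 'p ^ 'p) germ"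
  by (cases A rule: germ_cases, cases f rule: germ_cases)
    (simp add: germ_map.abs_eq germ_map2.abs_eq matrix_vector_mult_def matrix_scale_def vector_scalar_mult_def
      sum_distrib_left mult.assoc)

lemma gamma_K_add: "f \<in> map_germs s \<Longrightarrow> gamma_K f (z + w) = gamma_K f z + gamma_K f w"
  for f :: "('k ^ 'm, 'k ^ 'p::finite) germ"
  by (simp add: gamma_K_def case_prod_unfold tf_add[OF map_germs_subset_theta] matrix_germ_add)

lemma gamma_K_scale:
  "f \<in> map_germs s \<Longrightarrow>
    gamma_K f (prod_scale vector_germ_scale (\<lambda>c. germ_map (matrix_scale c)) c z) = vector_germ_scale c (gamma_K f z)"
  for f :: "('k ^ 'm, 'k ^ 'p::finite) germ"
  by (simp add: gamma_K_def case_prod_unfold prod_scale_def tf_scale[OF map_germs_subset_theta] matrix_germ_scale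
      vector_germ_scale_diff)

lemma moduli_iso_gamma_A:
  fixes f :: "('k ^ 'm, 'k ^ 'p::finite) germ"
  assumes f: "f \<in> map_germs s"
    and A: "module.subspace vector_germ_scale A" and B: "module.subspace vector_germ_scale B"
    and dv: "\<And>x y. x \<in> A \<times> B \<Longrightarrow> y \<in> A \<times> B \<Longrightarrow> dv (\<pi> (x + y)) = dv (\<pi> x) + dv (\<pi> y)"
      "\<And>c x. x \<in> A \<times> B \<Longrightarrow> dv (\<pi> (prod_scale vector_germ_scale vector_germ_scale c x)) = germ_map ((*) c) (dv (\<pi> x))"
      "dv ` \<pi> ` (A \<times> B) = C"
  shows "moduli_iso (gamma_A f) (A \<times> B) \<pi> dv C"
  by (rule moduli_isoI[OF module_prod[OF module_germ[OF module_vector] module_germ[OF module_vector]]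
        subspace_prod[OF module_germ[OF module_vector] module_germ[OF module_vector] A B]
        gamma_A_add[OF f] gamma_A_scale[OF f] dv])

lemma moduli_iso_gamma_K:
  fixes f :: "('k ^ 'm, 'k ^ 'p::finite) germ"
  assumes f: "f \<in> map_germs s"
    and A: "module.subspace vector_germ_scale A" and B: "module.subspace (\<lambda>c. germ_map (matrix_scale c)) B"
    and dv: "\<And>x y. x \<in> A \<times> B \<Longrightarrow> y \<in> A \<times> B \<Longrightarrow> dv (\<pi> (x + y)) = dv (\<pi> x) + dv (\<pi> y)"
      "\<And>c x. x \<in> A \<times> B \<Longrightarrow> dv (\<pi> (prod_scale vector_germ_scale (\<lambda>c. germ_map (matrix_scale c)) c x)) = germ_map ((*) c) (dv (\<pi> x))"
      "dv ` \<pi> ` (A \<times> B) = C"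
  shows "moduli_iso (gamma_K f) (A \<times> B) \<pi> dv C"
  by (rule moduli_isoI[OF module_prod[OF module_germ[OF module_vector] module_germ[OF module_matrix]]
        subspace_prod[OF module_germ[OF module_vector] module_germ[OF module_matrix] A B]
        gamma_K_add[OF f] gamma_K_scale[OF f] dv])

lemma trace_germ_add: "germ_map trace (A + B) = germ_map trace A + germ_map trace B"
  for A :: "('k ^ 'm, 'k ^ 'p::finite ^ 'p) germ"
  by (cases A rule: germ_cases, cases B rule: germ_cases) (simp add: abs_germ_add germ_map.abs_eq trace_add)

lemma trace_germ_scale: "germ_map trace (germ_map (matrix_scale c) A) = germ_map ((*) c) (germ_map trace A)"
  for A :: "('k ^ 'm, 'k ^ 'p::finite ^ 'p) germ"
  by (cases A rule: germ_cases) (simp add: germ_map.abs_eq trace_def matrix_scale_def sum_distrib_left)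

end

section \<open>The isomorphism from the calculus axioms\<close>

text \<open>All seven cases have the same shape: \<open>L\<close> is a product of subspaces, one of which may be \<open>0\<close>, and the
  divergence depends only on the \<open>q\<close>-factor, which it maps onto \<open>C\<^sub>r\<close>.  Source and target dimensions each need
  their own instance of the calculus.\<close>

lemma moduli_space_iso_of_calculus:
  fixes f :: "('k::real_normed_field ^ 'n::finite, 'k ^ 'p::finite) germ"
  assumes "smooth_calculus s (smooth_at0 s :: ('k ^ 'n \<Rightarrow> 'k) \<Rightarrow> bool)"
    and "smooth_calculus s (smooth_at0 s :: ('k ^ 'p \<Rightarrow> 'k) \<Rightarrow> bool)"
    and f: "f \<in> map_germs s" and G: "valid_subgroup s G"
  shows "moduli_space_iso s G f"
proof -
  interpret n: smooth_calculus s "smooth_at0 s :: ('k ^ 'n \<Rightarrow> 'k) \<Rightarrow> bool" by fact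
  interpret p: smooth_calculus s "smooth_at0 s :: ('k ^ 'p \<Rightarrow> 'k) \<Rightarrow> bool" by fact
  note sub_n = n.M_theta_subset_theta[THEN subsetD] and sub_p = p.M_theta_subset_theta[THEN subsetD]
  note zero = subspace_singleton_0[OF module_germ[OF module_vector]]
  note trace = n.trace_germ_add n.trace_germ_scale n.trace_germ_onto
  have nonempty: "M_theta s \<noteq> ({} :: ('k ^ 'n, 'k ^ 'n) germ set)" "M_theta s \<noteq> ({} :: ('k ^ 'p, 'k ^ 'p) germ set)"
    "gl_germs s \<noteq> ({} :: ('k ^ 'n, 'k ^ 'p ^ 'p) germ set)"
    using n.M_theta_zero p.M_theta_zero module.subspace_0[OF module_germ[OF module_matrix] n.subspace_gl_germs] by blast+
  show ?thesis
  proof (cases G)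
    case (A_source \<Omega>)
    with G have \<Omega>: "\<Omega> \<in> volume_forms s" by simp
    show ?thesis
      unfolding A_source moduli_space_iso.simps
      by (rule n.moduli_iso_gamma_A[OF f n.subspace_M_theta p.subspace_M_theta])
        (auto simp: nonempty prod_scale_def n.divergence_add[OF \<Omega>] n.divergence_scale[OF \<Omega>] n.divergence_onto[OF \<Omega>] sub_n)
  next
    case (A_target \<Omega>)
    with G have \<Omega>: "\<Omega> \<in> volume_forms s" by simp
    show ?thesis
      unfolding A_target moduli_space_iso.simps
      by (rule n.moduli_iso_gamma_A[OF f n.subspace_M_theta p.subspace_M_theta])
        (auto simp: nonempty prod_scale_def p.divergence_add[OF \<Omega>] p.divergence_scale[OF \<Omega>] p.divergence_onto[OF \<Omega>] sub_p)
  next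
    case (K_source \<Omega>)
    with G have \<Omega>: "\<Omega> \<in> volume_forms s" by simp
    show ?thesis
      unfolding K_source moduli_space_iso.simps
      by (rule n.moduli_iso_gamma_K[OF f n.subspace_M_theta n.subspace_gl_germs])
        (auto simp: nonempty prod_scale_def n.divergence_add[OF \<Omega>] n.divergence_scale[OF \<Omega>] n.divergence_onto[OF \<Omega>] sub_n)
  next
    case K_target
    show ?thesis
      unfolding K_target moduli_space_iso.simps
      by (rule n.moduli_iso_gamma_K[OF f n.subspace_M_theta n.subspace_gl_germs])
        (auto simp: nonempty prod_scale_def trace)
  next
    case (R_source \<Omega>)
    with G have \<Omega>: "\<Omega> \<in> volume_forms s" by simp
    show ?thesis
      unfolding R_source moduli_space_iso.simps
      by (rule n.moduli_iso_gamma_A[OF f n.subspace_M_theta zero])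
        (auto simp: nonempty prod_scale_def n.divergence_add[OF \<Omega>] n.divergence_scale[OF \<Omega>] n.divergence_onto[OF \<Omega>] sub_n)
  next
    case (L_target \<Omega>)
    with G have \<Omega>: "\<Omega> \<in> volume_forms s" by simp
    show ?thesis
      unfolding L_target moduli_space_iso.simps
      by (rule n.moduli_iso_gamma_A[OF f zero p.subspace_M_theta])
        (auto simp: nonempty prod_scale_def p.divergence_add[OF \<Omega>] p.divergence_scale[OF \<Omega>] p.divergence_onto[OF \<Omega>] sub_p)
  next
    case C_target
    show ?thesis
      unfolding C_target moduli_space_iso.simps
      by (rule n.moduli_iso_gamma_K[OF f zero n.subspace_gl_germs])
        (auto simp: nonempty prod_scale_def trace)
  qed
qed

section \<open>Infinitely differentiable functions\<close>

lemma Ck_on_SucD: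
  assumes "Ck_on (Suc k) U h" "x \<in> U"
  shows "(h has_derivative frechet_derivative h (at x)) (at x)"
  using assms by (auto simp: frechet_derivative_works)

lemma Ck_on_Suc_imp: "Ck_on (Suc k) U h \<Longrightarrow> Ck_on k U h"
proof (induction k arbitrary: h)
  case 0
  then show ?case
    by (auto intro!: continuous_at_imp_continuous_on differentiable_imp_continuous_within)
next
  case (Suc k)
  show ?case
    unfolding Ck_on.simps(2)[of k]
  proof (intro conjI allI ballI)
    show "h differentiable (at x)" if "x \<in> U" for x
      using Suc.prems that by simp
    show "Ck_on k U (\<lambda>x. frechet_derivative h (at x) v)" for v
      using Suc.prems by (intro Suc.IH) (simp del: Ck_on.simps add: Ck_on.simps(2)[of "Suc k"])
  qed
qed

lemma Ck_on_imp_continuous_on: "Ck_on k U h \<Longrightarrow> continuous_on U h"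
proof (induction k)
  case (Suc k)
  then show ?case
    using Ck_on_Suc_imp by blast
qed simp

lemma Ck_on_subset: "Ck_on k U h \<Longrightarrow> V \<subseteq> U \<Longrightarrow> Ck_on k V h"
  by (induction k arbitrary: h) (auto intro: continuous_on_subset)

text \<open>Openness of \<open>U\<close> is what lets the derivatives of \<open>f\<close> and \<open>g\<close> agree as well.\<close>

lemma Ck_on_cong:
  assumes U: "open U" and "\<And>x. x \<in> U \<Longrightarrow> f x = g x" "Ck_on k U f"
  shows "Ck_on k U g"
  using assms(2,3)
proof (induction k arbitrary: f g)
  case 0
  then show ?case
    using continuous_on_cong by force
next
  case (Suc k)
  have f: "(f has_derivative frechet_derivative f (at x)) (at x)" if "x \<in> U" for x
    using Suc.prems(2) that by (rule Ck_on_SucD)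
  have g: "(g has_derivative frechet_derivative f (at x)) (at x)" if "x \<in> U" for x
    by (rule has_derivative_transform_within_open[OF f U]) (use that Suc.prems in auto)
  have eq: "frechet_derivative g (at x) = frechet_derivative f (at x)" if "x \<in> U" for x
    using frechet_derivative_at[OF g[OF that]] by simp
  show ?case
    unfolding Ck_on.simps
  proof (intro conjI ballI allI)
    show "g differentiable (at x)" if "x \<in> U" for x
      using g[OF that] by (rule differentiableI)
    show "Ck_on k U (\<lambda>x. frechet_derivative g (at x) v)" for v
      by (rule Suc.IH[of "\<lambda>x. frechet_derivative f (at x) v"]) (use Suc.prems eq in auto)
  qed
qed

lemma Ck_on_SucI:
  assumes U: "open U" and D: "\<And>x. x \<in> U \<Longrightarrow> (h has_derivative D x) (at x)"
    and Ck: "\<And>v. Ck_on k U (\<lambda>x. D x v)"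
  shows "Ck_on (Suc k) U h"
  unfolding Ck_on.simps
proof (intro conjI ballI allI)
  show "h differentiable (at x)" if "x \<in> U" for x
    using D[OF that] by (rule differentiableI)
  show "Ck_on k U (\<lambda>x. frechet_derivative h (at x) v)" for v
    by (rule Ck_on_cong[OF U _ Ck[of v]]) (use frechet_derivative_at[OF D] in metis)
qed

lemma Ck_on_const: "open U \<Longrightarrow> Ck_on k U (\<lambda>_. c)"
proof (induction k arbitrary: c)
  case (Suc k)
  then show ?case
    by (intro Ck_on_SucI[where D = "\<lambda>_ _. 0"]) auto
qed simp

lemma Ck_on_add:
  assumes U: "open U" and "Ck_on k U f" "Ck_on k U g"
  shows "Ck_on k U (\<lambda>x. f x + g x)"
  using assms(2,3)
proof (induction k arbitrary: f g)
  case 0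
  then show ?case
    by (auto intro: continuous_on_add)
next
  case (Suc k)
  show ?case
    by (rule Ck_on_SucI[OF U has_derivative_add[OF Ck_on_SucD[OF Suc.prems(1)] Ck_on_SucD[OF Suc.prems(2)]]])
      (use Suc in auto)
qed

lemma Ck_on_mult:
  fixes f g :: "'a::real_normed_vector \<Rightarrow> real"
  assumes U: "open U" and "Ck_on k U f" "Ck_on k U g"
  shows "Ck_on k U (\<lambda>x. f x * g x)"
  using assms(2,3)
proof (induction k arbitrary: f g)
  case 0
  then show ?case
    by (auto intro: continuous_on_mult)
next
  case (Suc k)
  have "Ck_on k U f" "Ck_on k U g"
    using Suc.prems Ck_on_Suc_imp by blast+
  with Suc show ?case
    by (intro Ck_on_SucI[OF U has_derivative_mult[OF Ck_on_SucD[OF Suc.prems(1)] Ck_on_SucD[OF Suc.prems(2)]]]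
        Ck_on_add[OF U] Suc.IH) auto
qed

lemma Ck_on_inverse:
  fixes f :: "'a::real_normed_vector \<Rightarrow> real"
  assumes U: "open U" and "Ck_on k U f" "\<And>x. x \<in> U \<Longrightarrow> f x \<noteq> 0"
  shows "Ck_on k U (\<lambda>x. inverse (f x))"
  using assms(2,3)
proof (induction k)
  case 0
  then show ?case
    by (auto intro: continuous_on_inverse)
next
  case (Suc k)
  have IH: "Ck_on k U (\<lambda>x. inverse (f x))"
    using Suc Ck_on_Suc_imp by blast
  show ?case
  proof (rule Ck_on_SucI[OF U])
    fix x assume x: "x \<in> U"
    show "((\<lambda>x. inverse (f x)) has_derivative
        (\<lambda>v. (- 1) * (inverse (f x) * frechet_derivative f (at x) v * inverse (f x)))) (at x)"
      using Deriv.has_derivative_inverse[OF Suc.prems(2)[OF x] Ck_on_SucD[OF Suc.prems(1) x]] by simp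
  next
    show "Ck_on k U (\<lambda>x. (- 1) * (inverse (f x) * frechet_derivative f (at x) v * inverse (f x)))" for v
      using Suc.prems by (intro Ck_on_mult Ck_on_const IH U) auto
  qed
qed

lemma Ck_on_nth: "open U \<Longrightarrow> Ck_on k U (\<lambda>x :: real ^ 'm::finite. x $ i)"
proof (induction k)
  case 0
  then show ?case
    by (auto intro!: continuous_intros)
next
  case (Suc k)
  have "((\<lambda>x. x $ i) has_derivative (\<lambda>v :: real ^ 'm. v $ i)) (at x)" for x
    by (rule bounded_linear_imp_has_derivative[OF bounded_linear_vec_nth])
  with Suc show ?case
    by (intro Ck_on_SucI[where D = "\<lambda>_ v. v $ i"] Ck_on_const) auto
qed

text \<open>Scales the \<open>i\<close>-th coordinate by \<open>t\<close>; written as a perturbation of \<open>x\<close>, which makes linearity and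
  continuity evident.\<close>

definition contract_axis :: "'m::finite \<Rightarrow> real \<Rightarrow> real ^ 'm \<Rightarrow> real ^ 'm"
  where "contract_axis i t x = x + ((t - 1) * x $ i) *\<^sub>R axis i 1"

lemma contract_axis_nth: "contract_axis i t x $ j = (if j = i then t * x $ j else x $ j)"
  by (simp add: contract_axis_def axis_def algebra_simps)

lemma contract_axis_ball:
  assumes "x \<in> ball 0 r" "0 \<le> t" "t \<le> 1"
  shows "contract_axis i t x \<in> ball 0 r"
proof -
  have "norm (contract_axis i t x) \<le> norm x"
    using assms by (intro norm_le_componentwise_cart) (auto simp: contract_axis_nth abs_mult mult_left_le_one_le)
  with assms show ?thesis by simp
qed

lemma continuous_on_contract_axis: "continuous_on S (\<lambda>(x, t). contract_axis i t x)"
  unfolding contract_axis_def case_prod_unfold by (intro continuous_intros)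

lemma bounded_linear_contract_axis: "bounded_linear (contract_axis i t)"
  unfolding linear_conv_bounded_linear[symmetric] contract_axis_def
  by (rule linearI) (auto simp: algebra_simps)

text \<open>With \<open>w = 1\<close>, multiplying by \<open>x\<^sub>i\<close> gives the integral of \<open>h\<close> over the \<open>i\<close>-th coordinate from \<open>0\<close> to
  \<open>x\<^sub>i\<close>, rescaled to the fixed interval \<open>[0, 1]\<close>.  The weight is there for the induction on the order of
  differentiability: each derivative produces a
  mean with the additional factor \<open>t - 1\<close>.\<close>

definition axis_mean :: "'m::finite \<Rightarrow> (real \<Rightarrow> real) \<Rightarrow> (real ^ 'm \<Rightarrow> real) \<Rightarrow> real ^ 'm \<Rightarrow> real"
  where "axis_mean i w h x = integral (cbox 0 1) (\<lambda>t. w t * h (contract_axis i t x))"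

lemma continuous_on_axis_mean_integrand:
  fixes h :: "real ^ 'm::finite \<Rightarrow> real" and w :: "real \<Rightarrow> real"
  assumes "continuous_on (ball 0 r) h" "continuous_on (cbox 0 1) w"
  shows "continuous_on (ball 0 r \<times> cbox 0 1) (\<lambda>(x, t). w t * h (contract_axis i t x))"
proof -
  have "continuous_on (ball 0 r \<times> cbox 0 1) (\<lambda>z. h (case z of (x, t) \<Rightarrow> contract_axis i t x))"
    by (rule continuous_on_compose2[OF assms(1) continuous_on_contract_axis])
      (auto intro: contract_axis_ball simp del: mem_ball)
  moreover have "continuous_on (ball 0 r \<times> cbox 0 1) (\<lambda>z. w (snd z))"
    by (rule continuous_on_compose2[OF assms(2)]) (auto intro: continuous_intros)
  ultimately show ?thesis
    unfolding case_prod_unfold by (rule continuous_on_mult[rotated])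
qed

lemma axis_mean_integrable:
  fixes h :: "real ^ 'm::finite \<Rightarrow> real" and w :: "real \<Rightarrow> real"
  assumes h: "continuous_on (ball 0 r) h" and w: "continuous_on (cbox 0 1) w" and x: "x \<in> ball 0 r"
  shows "(\<lambda>t. w t * h (contract_axis i t x)) integrable_on cbox 0 1"
proof (rule Henstock_Kurzweil_Integration.integrable_continuous)
  have "continuous_on (cbox 0 1) (\<lambda>t. case (x, t) of (x, t) \<Rightarrow> w t * h (contract_axis i t x))"
    by (rule continuous_on_compose2[OF continuous_on_axis_mean_integrand[OF h w]])
      (use x in \<open>auto intro!: continuous_intros\<close>)
  then show "continuous_on (cbox 0 1) (\<lambda>t. w t * h (contract_axis i t x))"
    by simp
qed

text \<open>Differentiation under the integral sign.  The chain rule produces \<open>Dh\<close> in the direction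
  \<open>contract_axis i t v = v + (t - 1) v\<^sub>i e\<^sub>i\<close>, and splitting it by linearity expresses the derivative by
  two means of directional derivatives of \<open>h\<close>.\<close>

lemma has_derivative_axis_mean:
  fixes h :: "real ^ 'm::finite \<Rightarrow> real"
  assumes Ck: "Ck_on (Suc k) (ball 0 r) h" and w: "continuous_on (cbox 0 1) w" and x: "x \<in> ball 0 r"
  shows "(axis_mean i w h has_derivative
    (\<lambda>v. axis_mean i w (\<lambda>x. frechet_derivative h (at x) v) x +
      v $ i * axis_mean i (\<lambda>t. w t * (t - 1)) (\<lambda>x. frechet_derivative h (at x) (axis i 1)) x)) (at x)"
proof -
  let ?U = "ball 0 r :: (real ^ 'm) set"
  let ?h' = "\<lambda>x. frechet_derivative h (at x)"
  let ?g = "\<lambda>x t v. w t * ?h' (contract_axis i t x) (contract_axis i t v)"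
  have h': "bounded_linear (?h' y)" if "y \<in> ?U" for y
    using Ck_on_SucD[OF Ck that] by (rule has_derivative_bounded_linear)
  have cont: "continuous_on ?U (\<lambda>x. ?h' x v)" for v
    using Ck Ck_on_imp_continuous_on by (metis Ck_on.simps(2))
  have w': "continuous_on (cbox 0 1) (\<lambda>t. w t * (t - 1))"
    by (intro continuous_intros w)
  have mem: "contract_axis i t y \<in> ?U" if "y \<in> ?U" "t \<in> cbox 0 1" for y t
    using that by (intro contract_axis_ball) auto
  have blin: "bounded_linear (?g y t)" if "y \<in> ?U" "t \<in> cbox 0 1" for y t
    by (intro bounded_linear_mult_right[THEN bounded_linear_compose]
        bounded_linear_compose[OF h' bounded_linear_contract_axis] mem that)
  have g: "?g y t v = w t * ?h' (contract_axis i t y) v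
      + v $ i * ((w t * (t - 1)) * ?h' (contract_axis i t y) (axis i 1))"
    if "y \<in> ?U" "t \<in> cbox 0 1" for y t v
  proof -
    interpret bounded_linear "?h' (contract_axis i t y)"
      by (intro h' mem that)
    show ?thesis
      by (simp only: contract_axis_def[of i t v] add scaleR) (simp add: algebra_simps)
  qed
  define B where "B y t = Blinfun (?g y t)" for y t
  have B: "blinfun_apply (B y t) = ?g y t" if "y \<in> ?U" "t \<in> cbox 0 1" for y t
    unfolding B_def by (rule bounded_linear_Blinfun_apply[OF blin[OF that]])
  have contB: "continuous_on (?U \<times> cbox 0 1) (\<lambda>(y, t). B y t)"
  proof (rule continuous_on_blinfun_componentwise)
    fix v :: "real ^ 'm"
    have "continuous_on (?U \<times> cbox 0 1) (\<lambda>z. (case z of (y, t) \<Rightarrow> w t * ?h' (contract_axis i t y) v)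
        + v $ i * (case z of (y, t) \<Rightarrow> (w t * (t - 1)) * ?h' (contract_axis i t y) (axis i 1)))"
      by (intro continuous_on_add continuous_on_mult continuous_on_const continuous_on_axis_mean_integrand cont w w')
    then show "continuous_on (?U \<times> cbox 0 1) (\<lambda>z. blinfun_apply (case z of (y, t) \<Rightarrow> B y t) v)"
      by (rule continuous_on_eq) (auto simp: B g simp del: mem_ball)
  qed
  have "(axis_mean i w h has_derivative integral (cbox 0 1) (B x)) (at x within ?U)"
    unfolding axis_mean_def[abs_def]
  proof (rule leibniz_rule[OF _ _ contB x])
    fix y t assume yt: "y \<in> ?U" "t \<in> cbox (0::real) 1"
    have "((\<lambda>y. h (contract_axis i t y)) has_derivative (\<lambda>v. ?h' (contract_axis i t y) (contract_axis i t v))) (at y)"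
      by (rule has_derivative_compose[OF bounded_linear_imp_has_derivative[OF bounded_linear_contract_axis]
          Ck_on_SucD[OF Ck mem[OF yt]]])
    then have "((\<lambda>y. w t * h (contract_axis i t y)) has_derivative ?g y t) (at y)"
      by (rule has_derivative_mult_right)
    then show "((\<lambda>y. w t * h (contract_axis i t y)) has_derivative blinfun_apply (B y t)) (at y within ?U)"
      unfolding B[OF yt] by (rule has_derivative_at_withinI)
  next
    fix y assume "y \<in> ?U"
    then show "(\<lambda>t. w t * h (contract_axis i t y)) integrable_on cbox 0 1"
      by (intro axis_mean_integrable[OF Ck_on_imp_continuous_on[OF Ck] w])
  qed simp
  then have D: "(axis_mean i w h has_derivative integral (cbox 0 1) (B x)) (at x)"
    using x by (simp add: at_within_open[OF x open_ball])
  have "blinfun_apply (integral (cbox 0 1) (B x)) v =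
      axis_mean i w (\<lambda>x. ?h' x v) x + v $ i * axis_mean i (\<lambda>t. w t * (t - 1)) (\<lambda>x. ?h' x (axis i 1)) x" for v
  proof -
    have "continuous_on (cbox 0 1) (\<lambda>t. case (x, t) of (y, t) \<Rightarrow> B y t)"
      by (rule continuous_on_compose2[OF contB]) (use x in \<open>auto intro!: continuous_intros\<close>)
    then have "B x integrable_on cbox 0 1"
      by (intro Henstock_Kurzweil_Integration.integrable_continuous) simp
    then have "blinfun_apply (integral (cbox 0 1) (B x)) v = integral (cbox 0 1) (\<lambda>t. blinfun_apply (B x t) v)"
      by (rule blinfun_apply_integral)
    also have "\<dots> = integral (cbox 0 1) (\<lambda>t. w t * ?h' (contract_axis i t x) v
      + v $ i * ((w t * (t - 1)) * ?h' (contract_axis i t x) (axis i 1)))"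
      by (intro integral_cong) (simp only: B[OF x] g[OF x])
    also have "\<dots> = axis_mean i w (\<lambda>x. ?h' x v) x + v $ i * axis_mean i (\<lambda>t. w t * (t - 1)) (\<lambda>x. ?h' x (axis i 1)) x"
      unfolding axis_mean_def
      by (subst Henstock_Kurzweil_Integration.integral_add)
        (simp_all only: axis_mean_integrable[OF cont w x] axis_mean_integrable[OF cont w' x]
          integrable_on_mult_right integral_mult_right)
    finally show ?thesis .
  qed
  with D show ?thesis
    by (simp add: has_derivative_eq_rhs[OF D] fun_eq_iff)
qed

lemma Ck_on_axis_mean:
  fixes h :: "real ^ 'm::finite \<Rightarrow> real"
  assumes "Ck_on k (ball 0 r) h" "continuous_on (cbox 0 1) w"
  shows "Ck_on k (ball 0 r) (axis_mean i w h)"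
  using assms
proof (induction k arbitrary: h w)
  case 0
  then show ?case
    unfolding axis_mean_def[abs_def] Ck_on.simps
    by (intro integral_continuous_on_param continuous_on_axis_mean_integrand)
next
  case (Suc k)
  have w: "continuous_on (cbox 0 1) (\<lambda>t. w t * (t - 1))"
    by (intro continuous_intros Suc.prems)
  show ?case
    by (rule Ck_on_SucI[OF open_ball has_derivative_axis_mean[OF Suc.prems]])
      (use Suc w in \<open>auto intro!: Ck_on_add Ck_on_mult Ck_on_const Suc.IH\<close>)
qed

lemma has_field_derivative_line:
  fixes h :: "real ^ 'm::finite \<Rightarrow> real"
  assumes "(h has_derivative D) (at x)"
  shows "((\<lambda>s. h (x + s *s v)) has_field_derivative D v) (at 0)"
proof -
  have "((\<lambda>s. x + s *\<^sub>R v) has_derivative (\<lambda>s. s *\<^sub>R v)) (at 0)"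
    by (auto intro!: derivative_eq_intros)
  then have "((\<lambda>s. h (x + s *\<^sub>R v)) has_derivative (\<lambda>s. D (s *\<^sub>R v))) (at 0)"
    by (rule has_derivative_compose) (use assms in simp)
  moreover have "D (s *\<^sub>R v) = D v * s" for s
    using linear_scale[OF has_derivative_linear[OF assms]] by simp
  ultimately show ?thesis
    by (simp add: has_field_derivative_def scalar_mult_eq_scaleR)
qed

text \<open>The derivative at \<open>x\<close> comes out as the integral of \<open>d/dt (t h(x\<^sub>1, \<dots>, t x\<^sub>i, \<dots>, x\<^sub>n))\<close> over \<open>[0, 1]\<close>,
  which is \<open>h x\<close>.\<close>

lemma axis_primitive:
  fixes h :: "real ^ 'm::finite \<Rightarrow> real"
  assumes Ck: "Ck_on (Suc 0) (ball 0 r) h" and x: "x \<in> ball 0 r"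
  shows "((\<lambda>s. (\<lambda>y. y $ i * axis_mean i (\<lambda>_. 1) h y) (x + s *s axis i 1)) has_field_derivative h x) (at 0)"
proof -
  let ?U = "ball 0 r :: (real ^ 'm) set"
  let ?d = "\<lambda>x. frechet_derivative h (at x) (axis i 1)"
  let ?D = "\<lambda>v. axis_mean i (\<lambda>_. 1) (\<lambda>x. frechet_derivative h (at x) v) x +
      v $ i * axis_mean i (\<lambda>t. 1 * (t - 1)) ?d x"
  have cont: "continuous_on ?U h" "continuous_on ?U ?d"
    using Ck Ck_on_imp_continuous_on by (metis Ck_on.simps(2))+
  have "((\<lambda>y. y $ i * axis_mean i (\<lambda>_. 1) h y) has_derivative
      (\<lambda>v. x $ i * ?D v + v $ i * axis_mean i (\<lambda>_. 1) h x)) (at x)"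
    by (intro has_derivative_mult has_derivative_axis_mean[OF Ck _ x]
        bounded_linear_imp_has_derivative[OF bounded_linear_vec_nth] continuous_on_const)
  then have "((\<lambda>s. (\<lambda>y. y $ i * axis_mean i (\<lambda>_. 1) h y) (x + s *s axis i 1)) has_field_derivative
      x $ i * ?D (axis i 1) + axis i 1 $ i * axis_mean i (\<lambda>_. 1) h x) (at 0)"
    by (rule has_field_derivative_line)
  moreover have "x $ i * ?D (axis i 1) + axis i 1 $ i * axis_mean i (\<lambda>_. 1) h x = h x"
  proof -
    have int: "(\<lambda>t. w t * h (contract_axis i t x)) integrable_on cbox 0 1"
      "(\<lambda>t. w t * ?d (contract_axis i t x)) integrable_on cbox 0 1" if "continuous_on (cbox 0 1) w" for w
      by (rule axis_mean_integrable[OF cont(1) that x]) (rule axis_mean_integrable[OF cont(2) that x])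
    have "((\<lambda>t. h (contract_axis i t x) + x $ i * (t * ?d (contract_axis i t x))) has_integral
        1 * h (contract_axis i 1 x) - 0 * h (contract_axis i 0 x)) {0..1}"
    proof (rule fundamental_theorem_of_calculus)
      fix t :: real assume t: "t \<in> {0..1}"
      then have "contract_axis i t x \<in> ?U"
        by (intro contract_axis_ball x) auto
      then have hd: "(h has_derivative frechet_derivative h (at (contract_axis i t x))) (at (contract_axis i t x))"
        by (rule Ck_on_SucD[OF Ck])
      have "((\<lambda>t. contract_axis i t x) has_derivative (\<lambda>s. (s * x $ i) *\<^sub>R axis i 1)) (at t)"
        unfolding contract_axis_def by (auto intro!: derivative_eq_intros)
      then have "((\<lambda>t. h (contract_axis i t x)) has_derivative
          (\<lambda>s. frechet_derivative h (at (contract_axis i t x)) ((s * x $ i) *\<^sub>R axis i 1))) (at t)"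
        by (rule has_derivative_compose) (rule hd)
      then have "((\<lambda>t. h (contract_axis i t x)) has_derivative (\<lambda>s. s * x $ i * ?d (contract_axis i t x))) (at t)"
        by (simp add: linear_scale[OF has_derivative_linear[OF hd]])
      then have "((\<lambda>t. h (contract_axis i t x)) has_real_derivative x $ i * ?d (contract_axis i t x)) (at t)"
        by (simp add: has_field_derivative_def mult_ac fun_eq_iff has_derivative_eq_rhs)
      then have "((\<lambda>t. t * h (contract_axis i t x)) has_real_derivative
          h (contract_axis i t x) + x $ i * (t * ?d (contract_axis i t x))) (at t)"
        by (auto intro!: derivative_eq_intros)
      then show "((\<lambda>t. t * h (contract_axis i t x)) has_vector_derivative
          h (contract_axis i t x) + x $ i * (t * ?d (contract_axis i t x))) (at t within {0..1})"
        by (simp add: has_real_derivative_iff_has_vector_derivative has_vector_derivative_at_within)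
    qed simp
    moreover have "contract_axis i 1 x = x"
      by (simp add: contract_axis_def)
    ultimately have "h x = integral (cbox 0 1) (\<lambda>t. h (contract_axis i t x) + x $ i * (t * ?d (contract_axis i t x)))"
      by (simp add: integral_unique)
    also have "\<dots> = integral (cbox 0 1) (\<lambda>t. 1 * h (contract_axis i t x) +
        x $ i * (1 * ?d (contract_axis i t x) + (1 * (t - 1)) * ?d (contract_axis i t x)))"
      by (intro integral_cong) (simp add: algebra_simps)
    also have "\<dots> = axis_mean i (\<lambda>_. 1) h x + x $ i * (axis_mean i (\<lambda>_. 1) ?d x + axis_mean i (\<lambda>t. 1 * (t - 1)) ?d x)"
      unfolding axis_mean_def
      by (simp only: integral_mult_right Henstock_Kurzweil_Integration.integral_add integrable_on_mult_right
          integrable_add int continuous_on_const continuous_on_mult continuous_on_diff continuous_on_id)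
    finally show ?thesis
      by (simp add: axis_def)
  qed
  ultimately show ?thesis by simp
qed

lemma smooth_at0_C_infinity_ball:
  assumes "smooth_at0 C_infinity h"
  obtains r where "0 < r" "\<And>k. Ck_on k (ball 0 r) h"
proof -
  from assms obtain U where U: "open U" "0 \<in> U" "\<And>k. Ck_on k U h"
    by auto
  then obtain r where "0 < r" "ball 0 r \<subseteq> U"
    using open_contains_ball by blast
  with U that show thesis
    using Ck_on_subset by blast
qed

lemma smooth_at0_C_infinity_cong:
  fixes h h' :: "real ^ 'm::finite \<Rightarrow> real"
  assumes "smooth_at0 C_infinity h" "\<forall>\<^sub>F x in nhds 0. h x = h' x"
  shows "smooth_at0 C_infinity h'"
proof -
  from assms(1) obtain U where U: "open U" "0 \<in> U" "\<And>k. Ck_on k U h"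
    by auto
  from assms(2) obtain V where V: "open V" "0 \<in> V" "\<And>x. x \<in> V \<Longrightarrow> h x = h' x"
    by (auto simp: eventually_nhds)
  have "Ck_on k (U \<inter> V) h'" for k
    by (rule Ck_on_cong[OF _ _ Ck_on_subset[OF U(3)]]) (use U V in auto)
  with U V show ?thesis
    by (auto intro!: exI[of _ "U \<inter> V"])
qed

lemma smooth_at0_C_infinity_binary:
  fixes g h :: "real ^ 'm::finite \<Rightarrow> real"
  assumes "smooth_at0 C_infinity g" "smooth_at0 C_infinity h"
    and F: "\<And>U k. open U \<Longrightarrow> Ck_on k U g \<Longrightarrow> Ck_on k U h \<Longrightarrow> Ck_on k U F"
  shows "smooth_at0 C_infinity F"
proof -
  from assms obtain U V where "open U" "0 \<in> U" "\<And>k. Ck_on k U g" "open V" "0 \<in> V" "\<And>k. Ck_on k V h"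
    by auto
  then show ?thesis
    by (auto intro!: exI[of _ "U \<inter> V"] F intro: Ck_on_subset)
qed

lemma smooth_at0_C_infinity_inverse:
  fixes h :: "real ^ 'm::finite \<Rightarrow> real"
  assumes "smooth_at0 C_infinity h" "h 0 \<noteq> 0"
  shows "smooth_at0 C_infinity (\<lambda>x. inverse (h x))"
proof -
  from assms(1) obtain U where U: "open U" "0 \<in> U" "\<And>k. Ck_on k U h"
    by auto
  have "continuous_on U h"
    using U(3) by (rule Ck_on_imp_continuous_on)
  then have V: "open (U \<inter> h -` (- {0}))"
    using U(1) by (intro continuous_open_preimage) auto
  have "Ck_on k (U \<inter> h -` (- {0})) (\<lambda>x. inverse (h x))" for k
    by (rule Ck_on_inverse[OF V Ck_on_subset[OF U(3)]]) auto
  with U(2) V assms(2) show ?thesis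
    by (auto intro!: exI[of _ "U \<inter> h -` (- {0})"])
qed

lemma smooth_at0_C_infinity_isCont:
  fixes h :: "real ^ 'm::finite \<Rightarrow> real"
  assumes "smooth_at0 C_infinity h"
  shows "isCont h 0"
proof -
  from assms obtain U where U: "open U" "0 \<in> U" "\<And>k. Ck_on k U h"
    by auto
  have "continuous_on U h"
    using U(3) by (rule Ck_on_imp_continuous_on)
  with U show ?thesis
    by (simp add: continuous_on_eq_continuous_at)
qed

lemma smooth_at0_C_infinity_partials:
  fixes h :: "real ^ 'm::finite \<Rightarrow> real"
  assumes "smooth_at0 C_infinity h"
  shows "\<exists>D. (\<forall>i. smooth_at0 C_infinity (D i)) \<and>
    (\<forall>\<^sub>F x in nhds 0. \<forall>v. ((\<lambda>s. h (x + s *s v)) has_field_derivative (\<Sum>i\<in>UNIV. v $ i * D i x)) (at 0))"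
proof -
  from assms obtain U where U: "open U" "0 \<in> U" "\<And>k. Ck_on k U h"
    by auto
  let ?D = "\<lambda>i x. frechet_derivative h (at x) (axis i 1)"
  have "smooth_at0 C_infinity (?D i)" for i
    using U(1,2) U(3)[of "Suc _"] by auto
  moreover have "((\<lambda>s. h (x + s *s v)) has_field_derivative (\<Sum>i\<in>UNIV. v $ i * ?D i x)) (at 0)"
    if x: "x \<in> U" for x v
  proof -
    have hd: "(h has_derivative frechet_derivative h (at x)) (at x)"
      by (rule Ck_on_SucD[OF U(3) x])
    note lin = has_derivative_linear[OF hd]
    have "frechet_derivative h (at x) v = frechet_derivative h (at x) (\<Sum>i\<in>UNIV. v $ i *s axis i 1)"
      by (simp only: basis_expansion)
    also have "\<dots> = (\<Sum>i\<in>UNIV. v $ i * ?D i x)"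
      by (simp add: linear_sum[OF lin] scalar_mult_eq_scaleR linear_scale[OF lin])
    finally show ?thesis
      using has_field_derivative_line[OF hd, of v] by simp
  qed
  ultimately show ?thesis
    using U(1,2) by (intro exI[of _ ?D]) (auto simp: eventually_nhds)
qed

lemma smooth_at0_C_infinity_primitive:
  fixes h :: "real ^ 'm::finite \<Rightarrow> real"
  assumes "smooth_at0 C_infinity h"
  shows "\<exists>H. smooth_at0 C_infinity H \<and> H 0 = 0 \<and>
    (\<forall>\<^sub>F x in nhds 0. ((\<lambda>s. H (x + s *s axis i 1)) has_field_derivative h x) (at 0))"
proof -
  from assms obtain r where r: "0 < r" "\<And>k. Ck_on k (ball 0 r) h"
    by (rule smooth_at0_C_infinity_ball) (use that in blast)
  let ?H = "\<lambda>x. x $ i * axis_mean i (\<lambda>_. 1) h x"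
  have "Ck_on k (ball 0 r) ?H" for k
    by (intro Ck_on_mult Ck_on_nth Ck_on_axis_mean r open_ball continuous_on_const)
  then have "smooth_at0 C_infinity ?H"
    using r by (auto intro!: exI[of _ "ball 0 r"])
  moreover have "\<forall>\<^sub>F x in nhds 0. x \<in> ball (0 :: real ^ 'm) r"
    using r by (intro eventually_nhds_in_open) auto
  then have "\<forall>\<^sub>F x in nhds 0. ((\<lambda>s. ?H (x + s *s axis i 1)) has_field_derivative h x) (at 0)"
    by (rule eventually_mono) (rule axis_primitive[OF r(2)])
  ultimately show ?thesis
    by (intro exI[of _ ?H]) simp
qed

lemma smooth_calculus_C_infinity:
  "smooth_calculus C_infinity (smooth_at0 C_infinity :: (real ^ 'm::finite \<Rightarrow> real) \<Rightarrow> bool)"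
proof
  fix g h :: "real ^ 'm \<Rightarrow> real"
  show "smooth_at0 C_infinity (\<lambda>_ :: real ^ 'm. c)" for c
    by (auto intro!: exI[of _ UNIV] Ck_on_const)
  assume h: "smooth_at0 C_infinity h"
  show "smooth_at0 C_infinity k" if "\<forall>\<^sub>F x in nhds 0. h x = k x" for k
    using h that by (rule smooth_at0_C_infinity_cong)
  show "smooth_at0 C_infinity (\<lambda>x. inverse (h x))" if "h 0 \<noteq> 0"
    using h that by (rule smooth_at0_C_infinity_inverse)
  show "isCont h 0"
    using h by (rule smooth_at0_C_infinity_isCont)
  show "\<exists>D. (\<forall>i. smooth_at0 C_infinity (D i)) \<and>
      (\<forall>\<^sub>F x in nhds 0. \<forall>v. ((\<lambda>t. h (x + t *s v)) has_field_derivative (\<Sum>i\<in>UNIV. v $ i * D i x)) (at 0))"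
    using h by (rule smooth_at0_C_infinity_partials)
  show "\<exists>H. smooth_at0 C_infinity H \<and> H 0 = 0 \<and>
      (\<forall>\<^sub>F x in nhds 0. ((\<lambda>t. H (x + t *s axis i 1)) has_field_derivative h x) (at 0))" for i
    using h by (rule smooth_at0_C_infinity_primitive)
  assume g: "smooth_at0 C_infinity g"
  show "smooth_at0 C_infinity (\<lambda>x. g x + h x)" "smooth_at0 C_infinity (\<lambda>x. g x * h x)"
    using smooth_at0_C_infinity_binary[OF g h] Ck_on_add Ck_on_mult by blast+
qed (rule refl)

section \<open>Convergent power series\<close>

definition mdeg :: "('m::finite \<Rightarrow> nat) \<Rightarrow> nat"
  where "mdeg \<alpha> = (\<Sum>i\<in>UNIV. \<alpha> i)"

definition monomial :: "'k::comm_monoid_mult ^ 'm::finite \<Rightarrow> ('m \<Rightarrow> nat) \<Rightarrow> 'k"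
  where "monomial x \<alpha> = (\<Prod>i\<in>UNIV. x $ i ^ \<alpha> i)"

lemma finite_multiindex_le: "finite {\<beta>::'m::finite \<Rightarrow> nat. \<beta> \<le> \<alpha>}"
proof -
  have "{\<beta>. \<beta> \<le> \<alpha>} = PiE UNIV (\<lambda>i. {..\<alpha> i})"
    by (auto simp: le_fun_def PiE_def)
  then show ?thesis
    by (simp add: finite_PiE)
qed

lemma mdeg_diff: "\<beta> \<le> \<alpha> \<Longrightarrow> mdeg \<beta> + mdeg (\<lambda>i. \<alpha> i - \<beta> i) = mdeg \<alpha>"
  unfolding mdeg_def sum.distrib[symmetric] by (intro sum.cong) (auto simp: le_fun_def)

lemma mdeg_zero [simp]: "mdeg (\<lambda>_. 0) = 0"
  by (simp add: mdeg_def)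

text \<open>A finite set of multi-indices lies in a box, where the sum factors into truncated geometric series,
  one for each coordinate.\<close>

lemma sum_power_mdeg_le:
  fixes F :: "('m::finite \<Rightarrow> nat) set" and q :: real
  assumes q: "0 \<le> q" "q < 1" and F: "finite F"
  shows "(\<Sum>\<alpha>\<in>F. q ^ mdeg \<alpha>) \<le> (1 / (1 - q)) ^ CARD('m)"
proof -
  define N where "N = Max (\<Union>\<alpha>\<in>F. range \<alpha>)"
  have "\<alpha> i \<le> N" if "\<alpha> \<in> F" for \<alpha> i
    unfolding N_def by (rule Max_ge) (use F that in auto)
  then have "F \<subseteq> PiE UNIV (\<lambda>_. {..N})"
    by (auto simp: PiE_def)
  then have "(\<Sum>\<alpha>\<in>F. q ^ mdeg \<alpha>) \<le> (\<Sum>\<alpha>\<in>PiE UNIV (\<lambda>_::'m. {..N}). q ^ mdeg \<alpha>)"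
    using q by (intro sum_mono2 finite_PiE) auto
  also have "\<dots> = (\<Prod>i\<in>(UNIV::'m set). \<Sum>k\<le>N. q ^ k)"
    by (subst prod_sum_PiE) (auto simp: mdeg_def power_sum)
  also have "\<dots> \<le> (\<Prod>i\<in>(UNIV::'m set). 1 / (1 - q))"
  proof (intro prod_mono conjI)
    have "(\<Sum>k\<le>N. q ^ k) \<le> (\<Sum>k. q ^ k)"
      using q by (intro sum_le_suminf summable_geometric) auto
    also have "\<dots> = 1 / (1 - q)"
      using q by (intro suminf_geometric) auto
    finally show "(\<Sum>k\<le>N. q ^ k) \<le> 1 / (1 - q)" .
  qed (use q in \<open>auto intro: sum_nonneg\<close>)
  finally show ?thesis
    by simp
qed

lemma summable_power_mdeg:
  fixes q :: real
  assumes q: "0 \<le> q" "q < 1"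
  shows "(\<lambda>\<alpha>::'m::finite \<Rightarrow> nat. q ^ mdeg \<alpha>) summable_on UNIV"
  using q sum_power_mdeg_le[OF q]
  by (intro nonneg_bdd_above_summable_on bdd_aboveI2) auto

lemma norm_monomial_le:
  fixes x :: "'k::real_normed_field ^ 'm::finite"
  assumes "\<And>i. norm (x $ i) \<le> t"
  shows "norm (monomial x \<alpha>) \<le> t ^ mdeg \<alpha>"
  unfolding monomial_def mdeg_def power_sum prod_norm[symmetric] norm_power
  by (intro prod_mono conjI power_mono assms) auto

lemma monomial_add: "monomial x (\<lambda>i. \<alpha> i + \<beta> i) = monomial x \<alpha> * monomial x \<beta>"
  by (simp add: monomial_def power_add prod.distrib)

text \<open>The bound says that the series converges absolutely on the polydisc \<open>\<bar>x\<^sub>i\<bar> < 1 / R\<close>, so that only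
  coefficients have to be estimated, and \<open>R\<close> may be enlarged freely.  It involves no loss, see
  \<open>smooth_at0_Analytic_iff\<close>.\<close>

definition power_series_rep :: "real \<Rightarrow> real \<Rightarrow> (('m::finite \<Rightarrow> nat) \<Rightarrow> 'k::real_normed_field)
    \<Rightarrow> ('k ^ 'm \<Rightarrow> 'k) \<Rightarrow> bool"
  where "power_series_rep M R c h \<longleftrightarrow> 0 < R \<and> (\<forall>\<alpha>. norm (c \<alpha>) \<le> M * R ^ mdeg \<alpha>) \<and>
    (\<forall>x. (\<forall>i. norm (x $ i) * R < 1) \<longrightarrow> ((\<lambda>\<alpha>. c \<alpha> * monomial x \<alpha>) has_sum h x) UNIV)"

lemma polydisc_radius:
  fixes x :: "'k::real_normed_field ^ 'm::finite"
  assumes "\<And>i. norm (x $ i) * R < 1"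
  obtains t where "0 \<le> t" "t * R < 1" "\<And>i. norm (x $ i) \<le> t"
proof
  let ?t = "Max (range (\<lambda>i. norm (x $ i)))"
  have "?t \<in> range (\<lambda>i. norm (x $ i))"
    by (intro Max_in) auto
  then obtain i where i: "?t = norm (x $ i)"
    by (rule rangeE)
  then show "0 \<le> ?t" "?t * R < 1"
    using assms[of i] by auto
  show "norm (x $ i) \<le> ?t" for i
    by (intro Max_ge) auto
qed

lemma norm_term_le:
  fixes x :: "'k::real_normed_field ^ 'm::finite"
  assumes "norm a \<le> M * R ^ mdeg \<alpha>" "\<And>i. norm (x $ i) \<le> t" "0 < R"
  shows "norm (a * monomial x \<alpha>) \<le> M * (t * R) ^ mdeg \<alpha>"
proof -
  have "norm a * norm (monomial x \<alpha>) \<le> (M * R ^ mdeg \<alpha>) * t ^ mdeg \<alpha>"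
    using assms(1) by (intro mult_mono norm_monomial_le assms order_trans[OF norm_ge_zero]) auto
  then show ?thesis
    by (simp add: norm_mult power_mult_distrib mult_ac)
qed

lemma power_series_abs_summable:
  fixes x :: "'k::real_normed_field ^ 'm::finite"
  assumes "\<And>\<alpha>. norm (c \<alpha>) \<le> M * R ^ mdeg \<alpha>" "0 < R" "\<And>i. norm (x $ i) * R < 1"
  shows "(\<lambda>\<alpha>. norm (c \<alpha> * monomial x \<alpha>)) summable_on UNIV"
proof -
  obtain t where t: "0 \<le> t" "t * R < 1" "\<And>i. norm (x $ i) \<le> t"
    using polydisc_radius assms(3) by blast
  have "(\<lambda>\<alpha>::'m \<Rightarrow> nat. M * (t * R) ^ mdeg \<alpha>) summable_on UNIV"
    using t assms(2) by (intro summable_on_cmult_right summable_power_mdeg) auto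
  then show ?thesis
    by (rule Infinite_Sum.abs_summable_on_comparison_test') (intro norm_term_le t assms)
qed

lemma power_series_rep_infsum:
  fixes c :: "('m::finite \<Rightarrow> nat) \<Rightarrow> 'k::{real_normed_field, banach}"
  assumes "\<And>\<alpha>. norm (c \<alpha>) \<le> M * R ^ mdeg \<alpha>" "0 < R"
  shows "power_series_rep M R c (\<lambda>x. \<Sum>\<^sub>\<infinity>\<alpha>. c \<alpha> * monomial x \<alpha>)"
  unfolding power_series_rep_def
  using assms
  by (intro conjI allI impI has_sum_infsum abs_summable_summable[OF power_series_abs_summable]) auto

lemma power_series_rep_weaken:
  assumes "power_series_rep M R c h" "M \<le> M'" "R \<le> R'"
  shows "power_series_rep M' R' c h"
  unfolding power_series_rep_def
proof (intro conjI allI impI)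
  from assms have R: "0 < R" and b: "\<And>\<alpha>. norm (c \<alpha>) \<le> M * R ^ mdeg \<alpha>"
    and s: "\<And>x. (\<forall>i. norm (x $ i) * R < 1) \<Longrightarrow> ((\<lambda>\<alpha>. c \<alpha> * monomial x \<alpha>) has_sum h x) UNIV"
    by (auto simp: power_series_rep_def)
  show "0 < R'"
    using R assms by simp
  have "0 \<le> M"
    using b[of "\<lambda>_. 0"] order_trans[OF norm_ge_zero] by fastforce
  then show "norm (c \<alpha>) \<le> M' * R' ^ mdeg \<alpha>" for \<alpha>
    using R assms by (intro order_trans[OF b] mult_mono power_mono) auto
  fix x :: "'b ^ 'a" assume x: "\<forall>i. norm (x $ i) * R' < 1"
  show "((\<lambda>\<alpha>. c \<alpha> * monomial x \<alpha>) has_sum h x) UNIV"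
    using x assms(3) by (intro s) (meson le_less_trans mult_left_mono norm_ge_zero)
qed

lemma has_sum_imp_bounded:
  fixes f :: "'a \<Rightarrow> 'b::real_normed_vector"
  assumes "(f has_sum S) A"
  obtains M where "\<And>x. x \<in> A \<Longrightarrow> norm (f x) \<le> M"
proof -
  have "\<forall>\<^sub>F F in finite_subsets_at_top A. dist (sum f F) S < 1"
    using assms unfolding has_sum_def by (rule tendstoD) simp
  then obtain X where X: "finite X" "X \<subseteq> A"
      "\<forall>F. finite F \<and> X \<subseteq> F \<and> F \<subseteq> A \<longrightarrow> dist (sum f F) S < 1"
    by (auto simp: eventually_finite_subsets_at_top)
  have "norm (f x) \<le> 2 + (\<Sum>y\<in>X. norm (f y))" if x: "x \<in> A" for x
  proof (cases "x \<in> X")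
    case True
    then have "norm (f x) \<le> (\<Sum>y\<in>X. norm (f y))"
      using X(1) by (intro member_le_sum) auto
    then show ?thesis by simp
  next
    case False
    have "dist (sum f (insert x X)) (sum f X) \<le> 2"
      using X(3)[rule_format, of X] X(3)[rule_format, of "insert x X"] X(1,2) x
        subset_insertI[of X x] dist_triangle2[of "sum f (insert x X)" "sum f X" S] by simp
    then have "norm (f x) \<le> 2"
      using False X(1) by (simp add: dist_norm)
    then show ?thesis
      by (intro add_increasing2 sum_nonneg) auto
  qed
  with that show thesis by blast
qed

text \<open>Evaluating a series that converges for \<open>\<bar>x\<^sub>i\<bar> < r\<close> at the point with all coordinates \<open>r / 2\<close> shows that its
  coefficients are bounded by a multiple of \<open>(2 / r)\<^sup>|\<^sup>\<alpha>\<^sup>|\<close>.\<close>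

lemma smooth_at0_Analytic_iff:
  fixes h :: "'k::real_normed_field ^ 'm::finite \<Rightarrow> 'k"
  shows "smooth_at0 Analytic h \<longleftrightarrow> (\<exists>M R c. power_series_rep M R c h)"
proof
  assume "smooth_at0 Analytic h"
  then obtain r c where r: "r > 0"
    and c: "\<And>x. (\<And>i. norm (x $ i) < r) \<Longrightarrow> ((\<lambda>\<alpha>. c \<alpha> * monomial x \<alpha>) has_sum h x) UNIV"
    unfolding smooth_at0.simps monomial_def by blast
  let ?x = "(\<chi> i. of_real (r / 2)) :: 'k ^ 'm"
  have "((\<lambda>\<alpha>. c \<alpha> * monomial ?x \<alpha>) has_sum h ?x) UNIV"
    using r by (intro c) (simp del: of_real_divide)
  then obtain M where M: "\<And>\<alpha>. \<alpha> \<in> UNIV \<Longrightarrow> norm (c \<alpha> * monomial ?x \<alpha>) \<le> M"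
    by (rule has_sum_imp_bounded) metis
  have "norm (monomial ?x \<alpha>) = (r / 2) ^ mdeg \<alpha>" for \<alpha>
    unfolding monomial_def mdeg_def power_sum prod_norm[symmetric] norm_power
    using r by (simp del: of_real_divide)
  then have "norm (c \<alpha>) * (r / 2) ^ mdeg \<alpha> \<le> M" for \<alpha>
    using M[of \<alpha>] by (simp add: norm_mult)
  then have "norm (c \<alpha>) \<le> M * (2 / r) ^ mdeg \<alpha>" for \<alpha>
    using r by (simp add: power_divide field_simps)
  moreover have "((\<lambda>\<alpha>. c \<alpha> * monomial x \<alpha>) has_sum h x) UNIV" if "\<forall>i. norm (x $ i) * (2 / r) < 1" for x
  proof (rule c)
    fix i
    from that have "norm (x $ i) * (2 / r) < 1" by blast
    then show "norm (x $ i) < r"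
      using r norm_ge_zero[of "x $ i"] by (simp add: field_simps del: norm_ge_zero)
  qed
  ultimately have "power_series_rep M (2 / r) c h"
    using r by (simp add: power_series_rep_def)
  then show "\<exists>M R c. power_series_rep M R c h"
    by blast
next
  assume "\<exists>M R c. power_series_rep M R c h"
  then obtain M R c where rep: "power_series_rep M R c h"
    by blast
  then show "smooth_at0 Analytic h"
    unfolding smooth_at0.simps power_series_rep_def monomial_def
    by (intro exI[of _ "1 / R"] conjI exI[of _ c]) (auto simp: field_simps)
qed

lemma eventually_polydisc:
  assumes "0 < r"
  shows "\<forall>\<^sub>F x in nhds (0 :: 'k::real_normed_vector ^ 'm::finite). \<forall>i. norm (x $ i) < r"
proof -
  have "\<forall>\<^sub>F x in nhds (0 :: 'k ^ 'm). dist x 0 < r"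
    using assms eventually_nhds_metric by blast
  then show ?thesis
    by (rule eventually_mono) (auto intro: order_le_less_trans[OF Finite_Cartesian_Product.norm_nth_le])
qed

lemma eventually_nhds_0_polydisc:
  fixes P :: "'k::real_normed_vector ^ 'm::finite \<Rightarrow> bool"
  assumes "\<forall>\<^sub>F x in nhds 0. P x"
  obtains r where "0 < r" "\<And>x. (\<And>i. norm (x $ i) < r) \<Longrightarrow> P x"
proof -
  from assms obtain d where d: "d > 0" "\<And>x. norm x < d \<Longrightarrow> P x"
    by (auto simp: eventually_nhds_metric)
  show thesis
  proof
    show "0 < d / CARD('m)"
      using d by simp
    fix x :: "'k ^ 'm" assume "\<And>i. norm (x $ i) < d / CARD('m)"
    then have "(\<Sum>i\<in>UNIV. norm (x $ i)) < (\<Sum>i\<in>(UNIV::'m set). d / CARD('m))"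
      by (intro sum_strict_mono) auto
    moreover have "norm x \<le> (\<Sum>i\<in>UNIV. norm (x $ i))"
      unfolding norm_vec_def by (rule L2_set_le_sum) simp
    ultimately show "P x"
      by (intro d) simp
  qed
qed

lemma power_series_rep_cong:
  assumes rep: "power_series_rep M R c h" and eq: "\<forall>\<^sub>F x in nhds 0. h x = h' x"
  shows "\<exists>M R. power_series_rep M R c h'"
proof -
  from eq obtain r where r: "0 < r" "\<And>x. (\<And>i. norm (x $ i) < r) \<Longrightarrow> h x = h' x"
    by (rule eventually_nhds_0_polydisc) metis
  have rep': "power_series_rep M (max R (1 / r)) c h"
    by (rule power_series_rep_weaken[OF rep]) auto
  have "h x = h' x" if "\<forall>i. norm (x $ i) * max R (1 / r) < 1" for x
  proof (rule r)
    fix i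
    have "norm (x $ i) * (1 / r) \<le> norm (x $ i) * max R (1 / r)"
      by (intro mult_left_mono) auto
    also have "\<dots> < 1"
      using that by blast
    finally show "norm (x $ i) < r"
      using r by (simp add: field_simps)
  qed
  with rep' have "power_series_rep M (max R (1 / r)) c h'"
    by (auto simp: power_series_rep_def)
  then show ?thesis by blast
qed

lemma power_series_rep_const:
  "power_series_rep (norm a) 1 (\<lambda>\<alpha>. if \<alpha> = (\<lambda>_. 0) then a else 0) (\<lambda>_. a)"
  unfolding power_series_rep_def
proof (intro conjI allI impI)
  fix x
  show "((\<lambda>\<alpha>. (if \<alpha> = (\<lambda>_. 0) then a else 0) * monomial x \<alpha>) has_sum a) UNIV"
    by (rule has_sum_finite_neutralI[of "{\<lambda>_. 0}"]) (auto simp: monomial_def)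
qed auto

lemma power_series_rep_add:
  assumes "power_series_rep M R c h" "power_series_rep M' R d k"
  shows "power_series_rep (M + M') R (\<lambda>\<alpha>. c \<alpha> + d \<alpha>) (\<lambda>x. h x + k x)"
  using assms unfolding power_series_rep_def
  by (auto simp: distrib_right intro!: has_sum_add norm_triangle_le add_mono)

definition cauchy_product :: "(('m::finite \<Rightarrow> nat) \<Rightarrow> 'k::comm_semiring_0) \<Rightarrow> (('m \<Rightarrow> nat) \<Rightarrow> 'k) \<Rightarrow> ('m \<Rightarrow> nat) \<Rightarrow> 'k"
  where "cauchy_product c d \<alpha> = (\<Sum>\<beta> | \<beta> \<le> \<alpha>. c \<beta> * d (\<lambda>i. \<alpha> i - \<beta> i))"

lemma card_multiindex_le: "card {\<beta>::'m::finite \<Rightarrow> nat. \<beta> \<le> \<alpha>} \<le> 2 ^ mdeg \<alpha>"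
proof -
  have "{\<beta>. \<beta> \<le> \<alpha>} = PiE UNIV (\<lambda>i. {..\<alpha> i})"
    by (auto simp: le_fun_def PiE_def)
  then have "card {\<beta>. \<beta> \<le> \<alpha>} = (\<Prod>i\<in>UNIV. Suc (\<alpha> i))"
    by (simp add: card_PiE)
  also have "\<dots> \<le> (\<Prod>i\<in>UNIV. 2 ^ \<alpha> i)"
    by (intro prod_mono) (auto simp: Suc_le_eq)
  finally show ?thesis
    by (simp add: mdeg_def power_sum)
qed

text \<open>Each term is bounded by \<open>M M' R\<^sup>|\<^sup>\<alpha>\<^sup>|\<close>, and there are at most \<open>2\<^sup>|\<^sup>\<alpha>\<^sup>|\<close> terms.\<close>

lemma norm_cauchy_product_le:
  fixes c :: "('m::finite \<Rightarrow> nat) \<Rightarrow> 'k::real_normed_field"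
  assumes c: "\<And>\<alpha>. norm (c \<alpha>) \<le> M * R ^ mdeg \<alpha>" and d: "\<And>\<alpha>. norm (d \<alpha>) \<le> M' * R ^ mdeg \<alpha>" and R: "0 < R"
  shows "norm (cauchy_product c d \<alpha>) \<le> M * M' * (2 * R) ^ mdeg \<alpha>"
proof -
  have M: "0 \<le> M" "0 \<le> M'"
    using c[of "\<lambda>_. 0"] d[of "\<lambda>_. 0"] order_trans[OF norm_ge_zero] by fastforce+
  have "norm (cauchy_product c d \<alpha>) \<le> (\<Sum>\<beta> | \<beta> \<le> \<alpha>. M * M' * R ^ mdeg \<alpha>)"
    unfolding cauchy_product_def
  proof (rule sum_norm_le)
    fix \<beta> assume "\<beta> \<in> {\<beta>. \<beta> \<le> \<alpha>}"
    then have "R ^ mdeg \<alpha> = R ^ mdeg \<beta> * R ^ mdeg (\<lambda>i. \<alpha> i - \<beta> i)"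
      by (simp add: power_add[symmetric] mdeg_diff)
    moreover have "norm (c \<beta>) * norm (d (\<lambda>i. \<alpha> i - \<beta> i))
        \<le> (M * R ^ mdeg \<beta>) * (M' * R ^ mdeg (\<lambda>i. \<alpha> i - \<beta> i))"
      using M R by (intro mult_mono c d) auto
    ultimately show "norm (c \<beta> * d (\<lambda>i. \<alpha> i - \<beta> i)) \<le> M * M' * R ^ mdeg \<alpha>"
      by (simp add: norm_mult mult_ac)
  qed
  also have "\<dots> \<le> 2 ^ mdeg \<alpha> * (M * M' * R ^ mdeg \<alpha>)"
    using M R of_nat_mono[OF card_multiindex_le[of \<alpha>], where 'a = real] by (auto intro!: mult_right_mono)
  finally show ?thesis
    by (simp add: power_mult_distrib mult_ac)
qed

text \<open>The product of the sums is an absolutely convergent sum over pairs \<open>(\<beta>, \<gamma>)\<close>, which may be grouped by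
  \<open>\<alpha> = \<beta> + \<gamma>\<close>.\<close>

lemma has_sum_cauchy_product:
  fixes x :: "'k::{real_normed_field, banach} ^ 'm::finite"
  assumes c: "((\<lambda>\<alpha>. c \<alpha> * monomial x \<alpha>) has_sum a) UNIV" and d: "((\<lambda>\<alpha>. d \<alpha> * monomial x \<alpha>) has_sum b) UNIV"
    and c': "(\<lambda>\<alpha>. norm (c \<alpha> * monomial x \<alpha>)) summable_on UNIV" and d': "(\<lambda>\<alpha>. norm (d \<alpha> * monomial x \<alpha>)) summable_on UNIV"
  shows "((\<lambda>\<alpha>. cauchy_product c d \<alpha> * monomial x \<alpha>) has_sum a * b) UNIV"
proof -
  let ?F = "\<lambda>(\<beta>, \<gamma>). (c \<beta> * monomial x \<beta>) * (d \<gamma> * monomial x \<gamma>)"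
  let ?G = "\<lambda>(\<alpha>, \<beta>). c \<beta> * d (\<lambda>i. \<alpha> i - \<beta> i) * monomial x \<alpha>"
  have "(\<lambda>z. norm (?F z)) summable_on UNIV \<times> UNIV"
  proof (rule summable_on_SigmaI)
    show "((\<lambda>\<gamma>. norm (?F (\<beta>, \<gamma>))) has_sum
        norm (c \<beta> * monomial x \<beta>) * (\<Sum>\<^sub>\<infinity>\<gamma>. norm (d \<gamma> * monomial x \<gamma>))) UNIV" for \<beta>
      unfolding case_prod_conv norm_mult[of "c \<beta> * monomial x \<beta>"]
      by (intro has_sum_cmult_right has_sum_infsum d')
    show "(\<lambda>\<beta>. norm (c \<beta> * monomial x \<beta>) * (\<Sum>\<^sub>\<infinity>\<gamma>. norm (d \<gamma> * monomial x \<gamma>))) summable_on UNIV"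
      by (intro summable_on_cmult_left c')
  qed simp
  then have "?F summable_on UNIV \<times> UNIV"
    by (rule abs_summable_summable)
  then have F: "(?F has_sum a * b) (UNIV \<times> UNIV)"
    by (intro has_sum_SigmaI[where g = "\<lambda>\<beta>. (c \<beta> * monomial x \<beta>) * b"])
      (auto intro!: has_sum_cmult_right has_sum_cmult_left c d)
  have "(?F has_sum a * b) (UNIV \<times> UNIV) \<longleftrightarrow> (?G has_sum a * b) (SIGMA \<alpha>:UNIV. {\<beta>. \<beta> \<le> \<alpha>})"
  proof (rule has_sum_reindex_bij_witness[where j = "\<lambda>(\<beta>, \<gamma>). (\<lambda>i. \<beta> i + \<gamma> i, \<beta>)"
        and i = "\<lambda>(\<alpha>, \<beta>). (\<beta>, \<lambda>i. \<alpha> i - \<beta> i)"])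
  qed (auto simp: le_fun_def monomial_add mult_ac)
  with F have "(?G has_sum a * b) (SIGMA \<alpha>:UNIV. {\<beta>. \<beta> \<le> \<alpha>})"
    by blast
  then show ?thesis
    by (rule has_sum_SigmaD)
      (auto simp: cauchy_product_def sum_distrib_right finite_multiindex_le intro!: has_sum_finiteI)
qed

lemma power_series_rep_mult:
  fixes h :: "'k::{real_normed_field, banach} ^ 'm::finite \<Rightarrow> 'k"
  assumes h: "power_series_rep M R c h" and k: "power_series_rep M' R d k"
  shows "power_series_rep (M * M') (2 * R) (cauchy_product c d) (\<lambda>x. h x * k x)"
proof -
  from h k have R: "0 < R" and c: "\<And>\<alpha>. norm (c \<alpha>) \<le> M * R ^ mdeg \<alpha>"
    and d: "\<And>\<alpha>. norm (d \<alpha>) \<le> M' * R ^ mdeg \<alpha>"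
    by (auto simp: power_series_rep_def)
  have "((\<lambda>\<alpha>. cauchy_product c d \<alpha> * monomial x \<alpha>) has_sum h x * k x) UNIV"
    if x: "\<forall>i. norm (x $ i) * (2 * R) < 1" for x :: "'k ^ 'm"
  proof -
    have x': "norm (x $ i) * R < 1" for i
    proof -
      have "norm (x $ i) * R \<le> norm (x $ i) * (2 * R)"
        using R by (intro mult_left_mono) auto
      with x show ?thesis
        using le_less_trans by blast
    qed
    show ?thesis
      by (rule has_sum_cauchy_product)
        (use h k x' in \<open>auto simp: power_series_rep_def intro!: power_series_abs_summable[OF c R]
           power_series_abs_summable[OF d R]\<close>)
  qed
  with R norm_cauchy_product_le[OF c d R] show ?thesis
    by (auto simp: power_series_rep_def)
qed

lemma mdeg_eq_0_iff: "mdeg \<alpha> = 0 \<longleftrightarrow> \<alpha> = (\<lambda>_. 0)"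
  by (auto simp: mdeg_def)

lemma mdeg_diff_less: "\<beta> \<le> \<alpha> \<Longrightarrow> \<beta> \<noteq> (\<lambda>_. 0) \<Longrightarrow> mdeg (\<lambda>i. \<alpha> i - \<beta> i) < mdeg \<alpha>"
  using mdeg_diff[of \<beta> \<alpha>] mdeg_eq_0_iff[of \<beta>] by linarith

text \<open>The coefficients of the reciprocal series, obtained by solving
  \<open>cauchy_product c d = 1\<close> for \<open>d\<close> degree by degree.\<close>

function inverse_coeff :: "(('m::finite \<Rightarrow> nat) \<Rightarrow> 'k::field) \<Rightarrow> ('m \<Rightarrow> nat) \<Rightarrow> 'k"
  where "inverse_coeff c \<alpha> = (if \<alpha> = (\<lambda>_. 0) then inverse (c (\<lambda>_. 0)) else
    - inverse (c (\<lambda>_. 0)) *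
      (\<Sum>\<beta> | \<beta> \<le> \<alpha> \<and> \<beta> \<noteq> (\<lambda>_. 0). c \<beta> * inverse_coeff c (\<lambda>i. \<alpha> i - \<beta> i)))"
  by auto
termination
  by (relation "Wellfounded.measure (\<lambda>(c, \<alpha>). mdeg \<alpha>)") (auto simp: mdeg_diff_less)

declare inverse_coeff.simps [simp del]

lemma multiindex_le_eq_insert_zero:
  "{\<beta>::'m \<Rightarrow> nat. \<beta> \<le> \<alpha>} = insert (\<lambda>_. 0) {\<beta>. \<beta> \<le> \<alpha> \<and> \<beta> \<noteq> (\<lambda>_. 0)}"
  by (auto simp: le_fun_def)

lemma finite_multiindex_le_nonzero: "finite {\<beta>::'m::finite \<Rightarrow> nat. \<beta> \<le> \<alpha> \<and> \<beta> \<noteq> (\<lambda>_. 0)}"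
  by (rule finite_subset[OF _ finite_multiindex_le[of \<alpha>]]) auto

lemma cauchy_product_inverse_coeff:
  assumes "c (\<lambda>_. 0) \<noteq> 0"
  shows "cauchy_product c (inverse_coeff c) \<alpha> = (if \<alpha> = (\<lambda>_. 0) then 1 else 0)"
proof (cases "\<alpha> = (\<lambda>_. 0)")
  case True
  then have "{\<beta>. \<beta> \<le> \<alpha>} = {\<lambda>_. 0}"
    by (auto simp: le_fun_def)
  with True assms show ?thesis
    by (simp add: cauchy_product_def inverse_coeff.simps)
next
  case False
  then show ?thesis
    using assms unfolding cauchy_product_def multiindex_le_eq_insert_zero
    by (subst sum.insert) (simp_all add: finite_multiindex_le_nonzero inverse_coeff.simps[of c \<alpha>])
qed

text \<open>Induction on the degree.  With \<open>L = R / q\<close> the recursion multiplies the claimed bound by at most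
  \<open>K M (\<Sum>\<beta> \<noteq> 0. q\<^sup>|\<^sup>\<beta>\<^sup>|) \<le> K M ((1 - q)\<^sup>-\<^sup>n - 1)\<close>, where \<open>K = \<bar>c\<^sub>0\<bar>\<^sup>-\<^sup>1\<close>, and this is less than one
  for small \<open>q\<close>.\<close>

lemma inverse_coeff_bound:
  fixes c :: "('m::finite \<Rightarrow> nat) \<Rightarrow> 'k::real_normed_field"
  assumes c: "\<And>\<alpha>. norm (c \<alpha>) \<le> M * R ^ mdeg \<alpha>" and R: "0 < R"
  obtains L where "0 < L" "\<And>\<alpha>. norm (inverse_coeff c \<alpha>) \<le> norm (inverse (c (\<lambda>_. 0))) * L ^ mdeg \<alpha>"
proof -
  define K where "K = norm (inverse (c (\<lambda>_. 0)))"
  have M: "0 \<le> M"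
    using c[of "\<lambda>_. 0"] order_trans[OF norm_ge_zero] by fastforce
  have K: "0 \<le> K"
    by (simp add: K_def)
  have "((\<lambda>q. K * M * ((1 / (1 - q)) ^ CARD('m) - 1)) \<longlongrightarrow> K * M * ((1 / (1 - 0)) ^ CARD('m) - 1)) (at_right (0::real))"
    by (intro tendsto_intros) auto
  then have "\<forall>\<^sub>F q in at_right (0::real). K * M * ((1 / (1 - q)) ^ CARD('m) - 1) < 1"
    by (rule order_tendstoD) simp
  moreover have "\<forall>\<^sub>F q in at_right (0::real). 0 < q \<and> q < 1"
    by (rule eventually_at_rightI[of _ 1]) auto
  ultimately have "\<forall>\<^sub>F q in at_right (0::real). 0 < q \<and> q < 1 \<and> K * M * ((1 / (1 - q)) ^ CARD('m) - 1) < 1"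
    by eventually_elim simp
  then obtain q :: real where q: "0 < q" "q < 1" "K * M * ((1 / (1 - q)) ^ CARD('m) - 1) < 1"
    using eventually_happens[of _ "at_right (0::real)"] by auto
  define L where "L = R / q"
  have L: "0 < L"
    using R q by (simp add: L_def)
  have "norm (inverse_coeff c \<alpha>) \<le> K * L ^ mdeg \<alpha>" for \<alpha>
  proof (induction \<alpha> rule: measure_induct_rule[of mdeg])
    case (less \<alpha>)
    show ?case
    proof (cases "\<alpha> = (\<lambda>_. 0)")
      case True
      then show ?thesis
        by (simp add: inverse_coeff.simps K_def)
    next
      case False
      let ?B = "{\<beta>. \<beta> \<le> \<alpha> \<and> \<beta> \<noteq> (\<lambda>_. 0)}"
      have "norm (\<Sum>\<beta>\<in>?B. c \<beta> * inverse_coeff c (\<lambda>i. \<alpha> i - \<beta> i)) \<le> (\<Sum>\<beta>\<in>?B. M * K * L ^ mdeg \<alpha> * q ^ mdeg \<beta>)"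
      proof (rule sum_norm_le)
        fix \<beta> assume \<beta>: "\<beta> \<in> ?B"
        have "norm (c \<beta>) * norm (inverse_coeff c (\<lambda>i. \<alpha> i - \<beta> i))
            \<le> (M * R ^ mdeg \<beta>) * (K * L ^ mdeg (\<lambda>i. \<alpha> i - \<beta> i))"
          using \<beta> M R by (intro mult_mono c less mdeg_diff_less) auto
        also have "\<dots> = M * K * L ^ mdeg \<alpha> * q ^ mdeg \<beta>"
          using \<beta> q mdeg_diff[of \<beta> \<alpha>, symmetric]
          by (simp add: L_def power_add power_divide)
        finally show "norm (c \<beta> * inverse_coeff c (\<lambda>i. \<alpha> i - \<beta> i)) \<le> M * K * L ^ mdeg \<alpha> * q ^ mdeg \<beta>"
          by (simp add: norm_mult)
      qed
      also have "\<dots> = M * K * L ^ mdeg \<alpha> * (\<Sum>\<beta>\<in>?B. q ^ mdeg \<beta>)"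
        by (simp add: sum_distrib_left)
      also have "\<dots> \<le> M * K * L ^ mdeg \<alpha> * ((1 / (1 - q)) ^ CARD('m) - 1)"
      proof (rule mult_left_mono)
        have "1 + (\<Sum>\<beta>\<in>?B. q ^ mdeg \<beta>) = (\<Sum>\<beta> | \<beta> \<le> \<alpha>. q ^ mdeg \<beta>)"
          unfolding multiindex_le_eq_insert_zero by (subst sum.insert) (auto simp: finite_multiindex_le_nonzero)
        also have "\<dots> \<le> (1 / (1 - q)) ^ CARD('m)"
          using q by (intro sum_power_mdeg_le finite_multiindex_le) auto
        finally show "(\<Sum>\<beta>\<in>?B. q ^ mdeg \<beta>) \<le> (1 / (1 - q)) ^ CARD('m) - 1"
          by simp
      qed (use M K L in auto)
      finally have "norm (inverse_coeff c \<alpha>) \<le> K * (M * K * L ^ mdeg \<alpha> * ((1 / (1 - q)) ^ CARD('m) - 1))"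
        using False K by (simp add: inverse_coeff.simps[of c \<alpha>] norm_mult K_def[symmetric] mult_left_mono)
      also have "\<dots> = K * L ^ mdeg \<alpha> * (K * M * ((1 / (1 - q)) ^ CARD('m) - 1))"
        by (simp add: mult_ac)
      also have "\<dots> \<le> K * L ^ mdeg \<alpha> * 1"
        using q K L by (intro mult_left_mono) auto
      finally show ?thesis by simp
    qed
  qed
  with L show thesis
    using that unfolding K_def by blast
qed

lemma power_series_rep_0: "power_series_rep M R c h \<Longrightarrow> h 0 = c (\<lambda>_. 0)"
proof -
  assume "power_series_rep M R c h"
  then have "((\<lambda>\<alpha>. c \<alpha> * monomial 0 \<alpha>) has_sum h 0) UNIV"
    by (auto simp: power_series_rep_def)
  moreover have "((\<lambda>\<alpha>. c \<alpha> * monomial 0 \<alpha>) has_sum c (\<lambda>_. 0)) UNIV"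
    by (rule has_sum_finite_neutralI[of "{\<lambda>_. 0}"]) (auto simp: monomial_def fun_eq_iff)
  ultimately show ?thesis
    by (rule has_sum_unique)
qed

lemma power_series_rep_unique:
  fixes h k :: "'k::real_normed_field ^ 'm::finite \<Rightarrow> 'k"
  assumes "power_series_rep M R c h" "power_series_rep M' R' c k"
  shows "\<forall>\<^sub>F x in nhds 0. h x = k x"
proof -
  from assms have "0 < 1 / R" "0 < 1 / R'"
    by (auto simp: power_series_rep_def)
  then have "\<forall>\<^sub>F x :: 'k ^ 'm in nhds 0. (\<forall>i. norm (x $ i) < 1 / R) \<and> (\<forall>i. norm (x $ i) < 1 / R')"
    by (intro eventually_conj eventually_polydisc)
  then show ?thesis
  proof (rule eventually_mono)
    fix x :: "'k ^ 'm"
    assume "(\<forall>i. norm (x $ i) < 1 / R) \<and> (\<forall>i. norm (x $ i) < 1 / R')"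
    with assms have "((\<lambda>\<alpha>. c \<alpha> * monomial x \<alpha>) has_sum h x) UNIV" "((\<lambda>\<alpha>. c \<alpha> * monomial x \<alpha>) has_sum k x) UNIV"
      by (auto simp: power_series_rep_def field_simps)
    then show "h x = k x"
      by (rule has_sum_unique)
  qed
qed

text \<open>The series with coefficients \<open>inverse_coeff c\<close> converges near the origin, and its product with \<open>h\<close>
  has the coefficients of the constant \<open>1\<close>.\<close>

lemma power_series_rep_inverse:
  fixes h :: "'k::{real_normed_field, banach} ^ 'm::finite \<Rightarrow> 'k"
  assumes rep: "power_series_rep M R c h" and "h 0 \<noteq> 0"
  shows "\<exists>M R d. power_series_rep M R d (\<lambda>x. inverse (h x))"
proof -
  from rep have R: "0 < R" and c: "\<And>\<alpha>. norm (c \<alpha>) \<le> M * R ^ mdeg \<alpha>"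
    by (auto simp: power_series_rep_def)
  obtain L where L: "0 < L"
    "\<And>\<alpha>. norm (inverse_coeff c \<alpha>) \<le> norm (inverse (c (\<lambda>_. 0))) * L ^ mdeg \<alpha>"
    by (rule inverse_coeff_bound[OF c R]) (use that in blast)
  have c0: "c (\<lambda>_. 0) \<noteq> 0"
    using assms power_series_rep_0 by metis
  define k where "k = (\<lambda>x. \<Sum>\<^sub>\<infinity>\<alpha>. inverse_coeff c \<alpha> * monomial x \<alpha>)"
  have k: "power_series_rep (norm (inverse (c (\<lambda>_. 0)))) L (inverse_coeff c) k"
    unfolding k_def by (rule power_series_rep_infsum[OF L(2,1)])
  have "power_series_rep (M * norm (inverse (c (\<lambda>_. 0)))) (2 * max R L)
      (cauchy_product c (inverse_coeff c)) (\<lambda>x. h x * k x)"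
    by (intro power_series_rep_mult power_series_rep_weaken[OF rep] power_series_rep_weaken[OF k]) auto
  then have "power_series_rep (M * norm (inverse (c (\<lambda>_. 0)))) (2 * max R L)
      (\<lambda>\<alpha>. if \<alpha> = (\<lambda>_. 0) then 1 else 0) (\<lambda>x. h x * k x)"
    by (simp add: cauchy_product_inverse_coeff[of c, OF c0, abs_def])
  then have "\<forall>\<^sub>F x in nhds 0. h x * k x = 1"
    by (rule power_series_rep_unique) (rule power_series_rep_const[of 1])
  then have "\<forall>\<^sub>F x in nhds 0. k x = inverse (h x)"
    by (rule eventually_mono) (metis inverse_unique)
  with power_series_rep_cong[OF k, of "\<lambda>x. inverse (h x)"] show ?thesis
    by blast
qed

text \<open>Each monomial of positive degree is at most \<open>\<bar>x\<bar> / T\<close> times its bound on the polydisc of radius \<open>T\<close>, so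
  \<open>h\<close> satisfies a Lipschitz estimate at the origin.\<close>

lemma isCont_power_series_rep:
  fixes h :: "'k::real_normed_field ^ 'm::finite \<Rightarrow> 'k"
  assumes rep: "power_series_rep M R c h"
  shows "isCont h 0"
proof -
  define T where "T = 1 / (2 * R)"
  from rep have R: "0 < R" and c: "\<And>\<alpha>. norm (c \<alpha>) \<le> M * R ^ mdeg \<alpha>"
    by (auto simp: power_series_rep_def)
  have T: "0 < T" "T * R = 1 / 2"
    using R by (auto simp: T_def)
  have M: "0 \<le> M"
    using c[of "\<lambda>_. 0"] order_trans[OF norm_ge_zero] by fastforce
  define B where "B = (\<Sum>\<^sub>\<infinity>\<alpha>::'m \<Rightarrow> nat. (1 / 2 :: real) ^ mdeg \<alpha>)"
  have B: "((\<lambda>\<alpha>::'m \<Rightarrow> nat. (1 / 2 :: real) ^ mdeg \<alpha>) has_sum B) UNIV"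
    unfolding B_def by (intro has_sum_infsum summable_power_mdeg) auto
  have bound: "norm (h x - h 0) \<le> (norm x / T) * M * B" if x: "norm x < T" for x
  proof -
    have xi: "norm (x $ i) * R < 1" for i
    proof -
      have "norm (x $ i) * R \<le> T * R"
        using x R Finite_Cartesian_Product.norm_nth_le[of x i] by (intro mult_right_mono) auto
      then show ?thesis
        by (simp add: T)
    qed
    have "((\<lambda>\<alpha>. c \<alpha> * monomial x \<alpha> - c \<alpha> * monomial 0 \<alpha>) has_sum (h x - h 0)) UNIV"
      using rep xi R unfolding diff_conv_add_uminus
      by (intro has_sum_add has_sum_uminus[THEN iffD2]) (auto simp: power_series_rep_def)
    then show ?thesis
    proof (rule norm_infsum_le)
      show "((\<lambda>\<alpha>::'m \<Rightarrow> nat. (norm x / T) * M * (1 / 2) ^ mdeg \<alpha>) has_sum (norm x / T) * M * B) UNIV"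
        by (intro has_sum_cmult_right B)
      fix \<alpha> :: "'m \<Rightarrow> nat"
      show "norm (c \<alpha> * monomial x \<alpha> - c \<alpha> * monomial 0 \<alpha>) \<le> (norm x / T) * M * (1 / 2) ^ mdeg \<alpha>"
      proof (cases "\<alpha> = (\<lambda>_. 0)")
        case True
        then show ?thesis
          using M T by (simp add: monomial_def)
      next
        case False
        then have 0: "monomial (0 :: 'k ^ 'm) \<alpha> = 0"
          by (auto simp: monomial_def fun_eq_iff)
        from False obtain d where d: "mdeg \<alpha> = Suc d"
          using mdeg_eq_0_iff[of \<alpha>] not0_implies_Suc by blast
        have "norm (c \<alpha> * monomial x \<alpha>) \<le> M * (norm x * R) ^ mdeg \<alpha>"
          by (intro norm_term_le c Finite_Cartesian_Product.norm_nth_le R)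
        also have "\<dots> \<le> M * ((norm x * R) * (T * R) ^ d)"
          unfolding d power_Suc using x R M by (intro mult_left_mono power_mono mult_right_mono) auto
        also have "\<dots> = (norm x / T) * M * (1 / 2) ^ mdeg \<alpha>"
          using R by (simp add: T(2) d) (simp add: T_def)
        finally show ?thesis
          by (simp add: 0)
      qed
    qed
  qed
  have "((\<lambda>x. h x - h 0) \<longlongrightarrow> 0) (at 0)"
  proof (rule Lim_null_comparison)
    have "\<forall>\<^sub>F x :: 'k ^ 'm in at 0. dist x 0 < T"
      unfolding eventually_at using T by blast
    then show "\<forall>\<^sub>F x in at 0. norm (h x - h 0) \<le> (norm x / T) * M * B"
      by (rule eventually_mono) (rule bound, simp)
    have "((\<lambda>x :: 'k ^ 'm. (norm x / T) * M * B) \<longlongrightarrow> (norm (0 :: 'k ^ 'm) / T) * M * B) (at 0)"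
      using T by (intro tendsto_intros) auto
    then show "((\<lambda>x :: 'k ^ 'm. (norm x / T) * M * B) \<longlongrightarrow> 0) (at 0)"
      by simp
  qed
  then show ?thesis
    unfolding isCont_def using LIM_zero_cancel by blast
qed

lemma mdeg_upd_Suc: "mdeg (\<beta>(i := Suc (\<beta> i))) = Suc (mdeg \<beta>)"
proof -
  have "mdeg (\<beta>(i := Suc (\<beta> i))) = (\<Sum>j\<in>UNIV. \<beta> j + (if j = i then 1 else 0))"
    unfolding mdeg_def by (intro sum.cong) auto
  then show ?thesis
    by (simp add: sum.distrib mdeg_def)
qed

text \<open>Terms of order zero in the \<open>i\<close>-th variable are lost under differentiation; the others correspond to
  all multi-indices by lowering the \<open>i\<close>-th exponent.\<close>

lemma has_sum_shift_multiindex: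
  fixes F :: "('m::finite \<Rightarrow> nat) \<Rightarrow> 'a::{comm_monoid_add, t2_space}"
  assumes "\<And>\<alpha>. \<alpha> i = 0 \<Longrightarrow> F \<alpha> = 0"
  shows "((\<lambda>\<beta>. F (\<beta>(i := Suc (\<beta> i)))) has_sum S) UNIV \<longleftrightarrow> (F has_sum S) UNIV"
proof -
  have "((\<lambda>\<beta>. F (\<beta>(i := Suc (\<beta> i)))) has_sum S) UNIV \<longleftrightarrow> (F has_sum S) {\<alpha>. \<alpha> i \<noteq> 0}"
    by (rule has_sum_reindex_bij_witness[where j = "\<lambda>\<beta>. \<beta>(i := Suc (\<beta> i))" and i = "\<lambda>\<alpha>. \<alpha>(i := \<alpha> i - 1)"])
      auto
  also have "\<dots> \<longleftrightarrow> (F has_sum S) UNIV"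
    using assms by (intro has_sum_cong_neutral) auto
  finally show ?thesis .
qed

definition partial_coeff :: "'m \<Rightarrow> (('m \<Rightarrow> nat) \<Rightarrow> 'k::real_normed_field) \<Rightarrow> ('m \<Rightarrow> nat) \<Rightarrow> 'k"
  where "partial_coeff i c \<beta> = of_nat (Suc (\<beta> i)) * c (\<beta>(i := Suc (\<beta> i)))"

text \<open>The factor \<open>\<beta>\<^sub>i + 1 \<le> 2\<^sup>|\<^sup>\<beta>\<^sup>|\<close> is absorbed by doubling \<open>R\<close>.\<close>

lemma norm_partial_coeff_le:
  fixes c :: "('m::finite \<Rightarrow> nat) \<Rightarrow> 'k::real_normed_field"
  assumes c: "\<And>\<alpha>. norm (c \<alpha>) \<le> M * R ^ mdeg \<alpha>" and R: "0 < R"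
  shows "norm (partial_coeff i c \<beta>) \<le> (M * R) * (2 * R) ^ mdeg \<beta>"
proof -
  have "Suc (\<beta> i) \<le> 2 ^ \<beta> i"
    by (simp add: Suc_le_eq)
  also have "\<dots> \<le> 2 ^ mdeg \<beta>"
    unfolding mdeg_def by (intro power_increasing member_le_sum) auto
  finally have "real (Suc (\<beta> i)) \<le> 2 ^ mdeg \<beta>"
    by (metis of_nat_le_iff of_nat_numeral of_nat_power)
  moreover have "norm (c (\<beta>(i := Suc (\<beta> i)))) \<le> M * R ^ Suc (mdeg \<beta>)"
    using c[of "\<beta>(i := Suc (\<beta> i))"] by (simp add: mdeg_upd_Suc)
  ultimately have "real (Suc (\<beta> i)) * norm (c (\<beta>(i := Suc (\<beta> i)))) \<le> 2 ^ mdeg \<beta> * (M * R ^ Suc (mdeg \<beta>))"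
    by (intro mult_mono) auto
  then show ?thesis
    by (simp add: partial_coeff_def norm_mult power_mult_distrib mult_ac del: of_nat_Suc)
qed

lemma monomial_upd: "monomial y (\<alpha>(i := a)) = y $ i ^ a * (\<Prod>j\<in>UNIV - {i}. y $ j ^ \<alpha> j)"
proof -
  have "monomial y (\<alpha>(i := a)) = y $ i ^ a * (\<Prod>j\<in>UNIV - {i}. y $ j ^ (\<alpha>(i := a)) j)"
    unfolding monomial_def by (subst prod.remove[of _ i]) auto
  also have "(\<Prod>j\<in>UNIV - {i}. y $ j ^ (\<alpha>(i := a)) j) = (\<Prod>j\<in>UNIV - {i}. y $ j ^ \<alpha> j)"
    by (intro prod.cong) auto
  finally show ?thesis .
qed

lemma has_field_derivative_monomial_line:
  fixes x v :: "'k::real_normed_field ^ 'm::finite"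
  shows "((\<lambda>s. monomial (x + s *s v) \<alpha>) has_field_derivative
    (\<Sum>i\<in>UNIV. v $ i * (of_nat (\<alpha> i) * monomial (x + s *s v) (\<alpha>(i := \<alpha> i - 1))))) (at s)"
proof -
  have "((\<lambda>s. \<Prod>i\<in>UNIV. (x $ i + s * v $ i) ^ \<alpha> i) has_field_derivative
    (\<Sum>i\<in>UNIV. of_nat (\<alpha> i) * v $ i * (x $ i + s * v $ i) ^ (\<alpha> i - 1) * (\<Prod>j\<in>UNIV - {i}. (x $ j + s * v $ j) ^ \<alpha> j))) (at s)"
    by (intro has_field_derivative_prod) (auto intro!: derivative_eq_intros)
  then show ?thesis
    unfolding monomial_upd by (simp add: monomial_def mult_ac)
qed

lemma multiindex_enumeration:
  obtains e :: "nat \<Rightarrow> ('m::finite \<Rightarrow> nat)" where "bij e"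
proof -
  have "inj (\<lambda>n. (\<lambda>_::'m. n :: nat))"
    by (auto simp: inj_on_def fun_eq_iff)
  then have "infinite (UNIV :: ('m \<Rightarrow> nat) set)"
    using infinite_UNIV_nat finite_subset[OF subset_UNIV] finite_imageD by blast
  then show thesis
    using that bij_betw_from_nat_into[of "UNIV :: ('m \<Rightarrow> nat) set"] by auto
qed

text \<open>Term by term differentiation along the line through \<open>x\<close> in direction \<open>v\<close>.  A small disc of parameters keeps the
  line in a polydisc of radius \<open>T < 1 / (2 R)\<close>, where the differentiated series is dominated by a
  convergent numerical series.  The theorem on differentiating series is about sequences, hence the
  enumeration \<open>e\<close> of the multi-indices.\<close>

lemma power_series_rep_line_derivative:
  fixes h :: "'k::{real_normed_field, banach} ^ 'm::finite \<Rightarrow> 'k"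
  assumes rep: "power_series_rep M R c h"
    and D: "\<And>i. power_series_rep M' R' (partial_coeff i c) (D i)"
  shows "\<forall>\<^sub>F x in nhds 0. \<forall>v. ((\<lambda>s. h (x + s *s v)) has_field_derivative (\<Sum>i\<in>UNIV. v $ i * D i x)) (at 0)"
proof -
  from rep have R: "0 < R" and c: "\<And>\<alpha>. norm (c \<alpha>) \<le> M * R ^ mdeg \<alpha>"
    by (auto simp: power_series_rep_def)
  from D have R': "0 < R'"
    by (auto simp: power_series_rep_def)
  define T where "T = min (1 / (4 * R)) (1 / (2 * R'))"
  have T: "0 < T" "T * (2 * R) < 1" "T * R < 1" "T * R' < 1"
    using R R' by (auto simp: T_def min_def field_simps)
  define F where "F i \<alpha> = c \<alpha> * of_nat (\<alpha> i)" for i \<alpha>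
  have partial_eq: "partial_coeff i c = (\<lambda>\<beta>. F i (\<beta>(i := Suc (\<beta> i))))" for i
    by (simp add: partial_coeff_def F_def fun_eq_iff mult_ac)
  obtain e :: "nat \<Rightarrow> ('m \<Rightarrow> nat)" where e: "bij e"
    by (rule multiindex_enumeration)
  let ?Y = "(\<chi> i. of_real T) :: 'k ^ 'm"
  have normY: "norm (monomial ?Y \<alpha>) = T ^ mdeg \<alpha>" for \<alpha>
    unfolding monomial_def mdeg_def power_sum prod_norm[symmetric] norm_power using T by simp
  have bound_summable: "(\<lambda>\<alpha>. norm (F i \<alpha>) * T ^ mdeg (\<alpha>(i := \<alpha> i - 1))) summable_on UNIV" for i
  proof -
    have "(\<lambda>\<beta>. norm (partial_coeff i c \<beta> * monomial ?Y \<beta>)) summable_on UNIV"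
      using R T by (intro power_series_abs_summable[OF norm_partial_coeff_le[OF c R]]) auto
    then obtain S where "((\<lambda>\<beta>. norm (partial_coeff i c \<beta>) * T ^ mdeg \<beta>) has_sum S) UNIV"
      unfolding norm_mult normY by (auto simp: summable_on_def)
    then have "((\<lambda>\<beta>. (\<lambda>\<alpha>. norm (F i \<alpha>) * T ^ mdeg (\<alpha>(i := \<alpha> i - 1))) (\<beta>(i := Suc (\<beta> i)))) has_sum S) UNIV"
      by (simp add: partial_eq)
    then show ?thesis
      by (subst (asm) has_sum_shift_multiindex) (auto simp: F_def summable_on_def)
  qed
  have "\<forall>\<^sub>F x :: 'k ^ 'm in nhds 0. \<forall>i. norm (x $ i) < T / 2"
    using T by (intro eventually_polydisc) simp
  then show ?thesis
  proof (rule eventually_mono, intro allI)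
    fix x v :: "'k ^ 'm"
    assume x: "\<forall>i. norm (x $ i) < T / 2"
    \<comment> \<open>\<open>\<bar>x\<^sub>i\<bar> < T / 2\<close> and \<open>\<bar>s v\<^sub>i\<bar> \<le> T / 2\<close> for \<open>\<bar>s\<bar> < \<delta>\<close>.\<close>
    define \<delta> where "\<delta> = T / 2 / (1 + norm v)"
    have \<delta>: "0 < \<delta>"
      using T by (auto simp: \<delta>_def intro!: divide_pos_pos add_pos_nonneg)
    have line: "norm ((x + s *s v) $ i) \<le> T" if s: "s \<in> ball 0 \<delta>" for s i
    proof -
      have "norm (s * v $ i) \<le> \<delta> * (1 + norm v)"
        using s \<delta> Finite_Cartesian_Product.norm_nth_le[of v i] unfolding norm_mult
        by (intro mult_mono) auto
      also have "\<dots> = T / 2"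
        unfolding \<delta>_def by (smt (verit) nonzero_eq_divide_eq norm_ge_zero)
      finally have "norm (x $ i + s * v $ i) \<le> T / 2 + T / 2"
        using x by (intro norm_triangle_le add_mono) (auto simp: less_imp_le)
      then show ?thesis by simp
    qed
    let ?f = "\<lambda>n s. c (e n) * monomial (x + s *s v) (e n)"
    let ?f' = "\<lambda>n s. \<Sum>i\<in>UNIV. v $ i * (F i (e n) * monomial (x + s *s v) ((e n)(i := e n i - 1)))"
    have f: "(\<lambda>n. ?f n s) sums h (x + s *s v)" if s: "s \<in> ball 0 \<delta>" for s
    proof (rule has_sum_imp_sums)
      have "norm ((x + s *s v) $ i) * R < 1" for i
        using line[OF s, of i] R T by (meson le_less_trans less_imp_le mult_right_mono)
      then have "((\<lambda>\<alpha>. c \<alpha> * monomial (x + s *s v) \<alpha>) has_sum h (x + s *s v)) UNIV"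
        using rep by (auto simp: power_series_rep_def)
      then show "((\<lambda>n. ?f n s) has_sum h (x + s *s v)) UNIV"
        by (subst has_sum_reindex_bij_betw[OF e, where f = "\<lambda>\<alpha>. c \<alpha> * monomial (x + s *s v) \<alpha>"])
    qed
    have f': "(\<lambda>n. ?f' n 0) sums (\<Sum>i\<in>UNIV. v $ i * D i x)"
    proof (intro sums_sum sums_mult has_sum_imp_sums)
      fix i
      have "norm (x $ i) * R' < 1" for i
        using x[rule_format, of i] R' T mult_right_mono[of "norm (x $ i)" T R'] by linarith
      then have "((\<lambda>\<beta>. partial_coeff i c \<beta> * monomial x \<beta>) has_sum D i x) UNIV"
        using D[of i] by (auto simp: power_series_rep_def)
      then have "((\<lambda>\<beta>. (\<lambda>\<alpha>. F i \<alpha> * monomial x (\<alpha>(i := \<alpha> i - 1))) (\<beta>(i := Suc (\<beta> i)))) has_sum D i x) UNIV"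
        by (simp add: partial_eq)
      then have "((\<lambda>\<alpha>. F i \<alpha> * monomial x (\<alpha>(i := \<alpha> i - 1))) has_sum D i x) UNIV"
        by (subst (asm) has_sum_shift_multiindex) (auto simp: F_def)
      then show "((\<lambda>n. F i (e n) * monomial (x + 0 *s v) ((e n)(i := e n i - 1))) has_sum D i x) UNIV"
        using has_sum_reindex_bij_betw[OF e, where f = "\<lambda>\<alpha>. F i \<alpha> * monomial x (\<alpha>(i := \<alpha> i - 1))"]
        by simp
    qed
    have "((\<lambda>s. \<Sum>n. ?f n s) has_field_derivative (\<Sum>n. ?f' n 0)) (at 0)"
    proof (rule has_field_derivative_series')
      show "convex (ball 0 \<delta> :: 'k set)"
        by simp
      show "0 \<in> ball 0 \<delta>" "0 \<in> interior (ball 0 \<delta>)"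
        using \<delta> by (auto simp: interior_open)
      show "summable (\<lambda>n. ?f n 0)"
        using f[of 0] \<delta> by (auto simp: sums_iff)
      show "(?f n has_field_derivative ?f' n s) (at s within ball 0 \<delta>)" for n s
      proof (rule has_field_derivative_at_within)
        have "?f' n s = c (e n) * (\<Sum>i\<in>UNIV. v $ i * (of_nat (e n i) * monomial (x + s *s v) ((e n)(i := e n i - 1))))"
          unfolding sum_distrib_left by (intro sum.cong refl) (simp only: F_def mult_ac)
        then show "(?f n has_field_derivative ?f' n s) (at s)"
          using DERIV_cmult[OF has_field_derivative_monomial_line[of x v "e n" s], of "c (e n)"] by (simp only:)
      qed
      show "uniformly_convergent_on (ball 0 \<delta>) (\<lambda>n s. \<Sum>k<n. ?f' k s)"
      proof (rule Weierstrass_m_test')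
        show "norm (?f' n s) \<le> (\<Sum>i\<in>UNIV. norm (v $ i) * (norm (F i (e n)) * T ^ mdeg ((e n)(i := e n i - 1))))"
          if "s \<in> ball 0 \<delta>" for n s
          unfolding norm_mult using line[OF that]
          by (intro sum_norm_le) (auto simp: norm_mult intro!: mult_left_mono norm_monomial_le)
        have "summable (\<lambda>n. norm (F i (e n)) * T ^ mdeg ((e n)(i := e n i - 1)))" for i
        proof -
          obtain S where "((\<lambda>\<alpha>. norm (F i \<alpha>) * T ^ mdeg (\<alpha>(i := \<alpha> i - 1))) has_sum S) UNIV"
            using bound_summable[of i] by (auto simp: summable_on_def)
          then have "((\<lambda>n. norm (F i (e n)) * T ^ mdeg ((e n)(i := e n i - 1))) has_sum S) UNIV"
            by (subst has_sum_reindex_bij_betw[OF e, where f = "\<lambda>\<alpha>. norm (F i \<alpha>) * T ^ mdeg (\<alpha>(i := \<alpha> i - 1))"])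
          then show ?thesis
            using has_sum_imp_sums sums_summable by blast
        qed
        then show "summable (\<lambda>n. \<Sum>i\<in>UNIV. norm (v $ i) * (norm (F i (e n)) * T ^ mdeg ((e n)(i := e n i - 1))))"
          by (intro summable_sum summable_mult)
      qed
    qed
    then have "((\<lambda>s. h (x + s *s v)) has_field_derivative (\<Sum>n. ?f' n 0)) (at 0)"
      by (rule has_field_derivative_transform_within_open[of _ _ _ "ball 0 \<delta>"])
        (use \<delta> f in \<open>auto simp: sums_iff\<close>)
    then show "((\<lambda>s. h (x + s *s v)) has_field_derivative (\<Sum>i\<in>UNIV. v $ i * D i x)) (at 0)"
      using f' by (simp add: sums_iff)
  qed
qed

lemma power_series_rep_partials:
  fixes h :: "'k::{real_normed_field, banach} ^ 'm::finite \<Rightarrow> 'k"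
  assumes rep: "power_series_rep M R c h"
  obtains D where "\<And>i. power_series_rep (M * R) (2 * R) (partial_coeff i c) (D i)"
    "\<forall>\<^sub>F x in nhds 0. \<forall>v. ((\<lambda>s. h (x + s *s v)) has_field_derivative (\<Sum>i\<in>UNIV. v $ i * D i x)) (at 0)"
proof -
  from rep have R: "0 < R" and c: "\<And>\<alpha>. norm (c \<alpha>) \<le> M * R ^ mdeg \<alpha>"
    by (auto simp: power_series_rep_def)
  define D where "D i x = (\<Sum>\<^sub>\<infinity>\<alpha>. partial_coeff i c \<alpha> * monomial x \<alpha>)" for i x
  have D: "power_series_rep (M * R) (2 * R) (partial_coeff i c) (D i)" for i
    unfolding D_def[abs_def] using R by (intro power_series_rep_infsum norm_partial_coeff_le c) auto
  show thesis
    using that[OF D power_series_rep_line_derivative[OF rep D]] .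
qed

text \<open>The formal primitive in the \<open>i\<close>-th variable has coefficients bounded by those of \<open>h\<close>, and its formal
  partial derivative is the series of \<open>h\<close> again.\<close>

lemma power_series_rep_primitive:
  fixes h :: "'k::{real_normed_field, banach} ^ 'm::finite \<Rightarrow> 'k"
  assumes rep: "power_series_rep M R c h"
  shows "\<exists>H M R d. power_series_rep M R d H \<and> H 0 = 0 \<and>
    (\<forall>\<^sub>F x in nhds 0. ((\<lambda>s. H (x + s *s axis i 1)) has_field_derivative h x) (at 0))"
proof -
  from rep have R: "0 < R" and c: "\<And>\<alpha>. norm (c \<alpha>) \<le> M * R ^ mdeg \<alpha>"
    by (auto simp: power_series_rep_def)
  have M: "0 \<le> M"
    using c[of "\<lambda>_. 0"] order_trans[OF norm_ge_zero] by fastforce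
  define d where "d \<alpha> = (if \<alpha> i = 0 then 0 else c (\<alpha>(i := \<alpha> i - 1)) / of_nat (\<alpha> i))" for \<alpha>
  define H where "H x = (\<Sum>\<^sub>\<infinity>\<alpha>. d \<alpha> * monomial x \<alpha>)" for x
  have d: "partial_coeff i d = c"
    by (auto simp: partial_coeff_def d_def fun_eq_iff simp del: of_nat_Suc)
  have "norm (d \<alpha>) \<le> (M / R) * R ^ mdeg \<alpha>" for \<alpha>
  proof (cases "\<alpha> i")
    case 0
    then show ?thesis
      using M R by (simp add: d_def)
  next
    case (Suc k)
    let ?\<beta> = "\<alpha>(i := k)"
    have deg: "mdeg \<alpha> = Suc (mdeg ?\<beta>)"
      using mdeg_upd_Suc[of ?\<beta> i] Suc by (simp add: fun_upd_idem)
    have "norm (d \<alpha>) \<le> norm (c ?\<beta>)"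
      using Suc mult_right_mono[of 1 "real (Suc k)" "norm (c ?\<beta>)"]
      by (simp add: d_def norm_divide field_simps del: of_nat_Suc)
    also have "\<dots> \<le> M * R ^ mdeg ?\<beta>"
      by (rule c)
    finally show ?thesis
      using R by (simp add: deg)
  qed
  then have H: "power_series_rep (M / R) R d H"
    unfolding H_def[abs_def] using R by (intro power_series_rep_infsum)
  obtain D where D: "\<And>j. power_series_rep (M / R * R) (2 * R) (partial_coeff j d) (D j)"
    "\<forall>\<^sub>F x in nhds 0. \<forall>v. ((\<lambda>s. H (x + s *s v)) has_field_derivative (\<Sum>j\<in>UNIV. v $ j * D j x)) (at 0)"
    by (rule power_series_rep_partials[OF H]) (use that in blast)
  have "\<forall>\<^sub>F x in nhds 0. D i x = h x"
    using D(1)[of i] rep unfolding d by (rule power_series_rep_unique)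
  with D(2) have "\<forall>\<^sub>F x in nhds 0. ((\<lambda>s. H (x + s *s axis i 1)) has_field_derivative h x) (at 0)"
  proof (rule eventually_elim2)
    fix x
    assume "\<forall>v. ((\<lambda>s. H (x + s *s v)) has_field_derivative (\<Sum>j\<in>UNIV. v $ j * D j x)) (at 0)" and eq: "D i x = h x"
    then have "((\<lambda>s. H (x + s *s axis i 1)) has_field_derivative (\<Sum>j\<in>UNIV. axis i 1 $ j * D j x)) (at 0)"
      by blast
    moreover have "(\<Sum>j\<in>UNIV. axis i 1 $ j * D j x) = (\<Sum>j\<in>UNIV. if j = i then D j x else 0)"
      by (intro sum.cong) (auto simp: axis_def)
    ultimately show "((\<lambda>s. H (x + s *s axis i 1)) has_field_derivative h x) (at 0)"
      using eq by simp
  qed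
  moreover have "H 0 = 0"
    using power_series_rep_0[OF H] by (simp add: d_def)
  ultimately show ?thesis
    using H by blast
qed

lemma smooth_calculus_Analytic:
  "smooth_calculus Analytic (smooth_at0 Analytic :: ('k::{real_normed_field, banach} ^ 'm::finite \<Rightarrow> 'k) \<Rightarrow> bool)"
proof
  fix g h :: "'k ^ 'm \<Rightarrow> 'k"
  show "smooth_at0 Analytic (\<lambda>_ :: 'k ^ 'm. c)" for c
    unfolding smooth_at0_Analytic_iff using power_series_rep_const by blast
  assume "smooth_at0 Analytic h"
  then obtain M R c where h: "power_series_rep M R c h"
    unfolding smooth_at0_Analytic_iff by blast
  show "smooth_at0 Analytic k" if "\<forall>\<^sub>F x in nhds 0. h x = k x" for k
    using power_series_rep_cong[OF h that] unfolding smooth_at0_Analytic_iff by blast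
  show "smooth_at0 Analytic (\<lambda>x. inverse (h x))" if "h 0 \<noteq> 0"
    using power_series_rep_inverse[OF h that] unfolding smooth_at0_Analytic_iff by blast
  show "isCont h 0"
    by (rule isCont_power_series_rep[OF h])
  show "\<exists>D. (\<forall>i. smooth_at0 Analytic (D i)) \<and>
      (\<forall>\<^sub>F x in nhds 0. \<forall>v. ((\<lambda>t. h (x + t *s v)) has_field_derivative (\<Sum>i\<in>UNIV. v $ i * D i x)) (at 0))"
    unfolding smooth_at0_Analytic_iff by (rule power_series_rep_partials[OF h]) blast
  show "\<exists>H. smooth_at0 Analytic H \<and> H 0 = 0 \<and>
      (\<forall>\<^sub>F x in nhds 0. ((\<lambda>t. H (x + t *s axis i 1)) has_field_derivative h x) (at 0))" for i
    using power_series_rep_primitive[OF h, of i] unfolding smooth_at0_Analytic_iff by blast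
  assume "smooth_at0 Analytic g"
  then obtain M' R' d where g: "power_series_rep M' R' d g"
    unfolding smooth_at0_Analytic_iff by blast
  have h': "power_series_rep M (max R R') c h" and g': "power_series_rep M' (max R R') d g"
    by (rule power_series_rep_weaken[OF h] power_series_rep_weaken[OF g]; simp)+
  show "smooth_at0 Analytic (\<lambda>x. g x + h x)" "smooth_at0 Analytic (\<lambda>x. g x * h x)"
    using power_series_rep_add[OF g' h'] power_series_rep_mult[OF g' h'] unfolding smooth_at0_Analytic_iff by blast+
qed (rule refl)

section \<open>Moduli of volume preserving subgroups\<close>

theorem proposition3p1:
  shows
    "(\<forall>s (f :: (real ^ 'n, real ^ 'p) germ) G.
        f \<in> map_germs s \<longrightarrow> valid_subgroup s G \<longrightarrow> moduli_space_iso s G f) \<and>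
     (\<forall>(f :: (complex ^ 'n, complex ^ 'p) germ) G.
        f \<in> map_germs Analytic \<longrightarrow> valid_subgroup Analytic G \<longrightarrow> moduli_space_iso Analytic G f)"
proof (intro conjI allI impI)
  fix s and f :: "(real ^ 'n, real ^ 'p) germ"
    and G :: "((real, 'n) form_germ, (real, 'p) form_germ) volume_subgroup"
  assume "f \<in> map_germs s" "valid_subgroup s G"
  then show "moduli_space_iso s G f"
    by (cases s) (simp_all only: moduli_space_iso_of_calculus smooth_calculus_C_infinity smooth_calculus_Analytic)
next
  fix f :: "(complex ^ 'n, complex ^ 'p) germ"
    and G :: "((complex, 'n) form_germ, (complex, 'p) form_germ) volume_subgroup"
  assume "f \<in> map_germs Analytic" "valid_subgroup Analytic G"
  then show "moduli_space_iso Analytic G f"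
    by (intro moduli_space_iso_of_calculus smooth_calculus_Analytic)
qed

end
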